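(* Let $k,p\in\mathbb{N}$ and let $A_p=\{\alpha_i\}_{i=1}^p$ with $-1\le\alpha_p<\dots<\alpha_1\le1$. Let $$(r,m_1,m_3)\in\{(2j,2j-1,2j-1): j\in\mathbb{N}\}\cup\{(2j+1,2j-1,2j): j\in\mathbb{N}_0\}.$$ Then there is a number $N$ depending only on $d(A_p)$ and a constant $c=c(k,r,p)$ such that for every $f\in C^r[-1,1]$ and every $n\ge N$ there exists an algebraic polynomial $P_n$ of degree $\le n$ such that $P_n\ge f$ on $[-1,1]$, $P_n^{(i)}(\alpha)=f^{(i)}(\alpha)$ for all $\alpha\in A_p$ and $0\le i\le m_1$ (vacuous if $m_1=-1$), $P_n^{(i)}(\pm1)=f^{(i)}(\pm1)$ for $0\le i\le m_3$, and $$|f(x)-P_n(x)|\le c\,\rho_n^r(x)\,\omega_k(f^{(r)},\rho_n(x)),\qquad x\in[-1,1].$$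
   Context: $\rho_n(x):=n^{-1}\sqrt{1-x^2}+n^{-2}$; $\omega_k(g,t)$ is the classical $k$-th modulus of smoothness of $g$ on $[-1,1]$. $d(A_p)$ is the minimal distance between distinct points of $A_p\cup\{\pm1\}$.
   Formalization: N is allowed to depend on k, r and p as well as on d(A_p); independence of k and r is impossible, since f(x)=x^{r+k-1} has ω_k(f^{(r)},·)=0, which forces P_n=f and hence n≥r+k-1. *)

theory Defs
  imports "HOL-Analysis.Analysis" "HOL-Computational_Algebra.Polynomial"
begin

definition rho :: "nat \<Rightarrow> real \<Rightarrow> real" where
  "rho n x = sqrt (1 - x\<^sup>2) / real n + 1 / (real n)\<^sup>2"

definition fdiff :: "nat \<Rightarrow> real \<Rightarrow> (real \<Rightarrow> real) \<Rightarrow> real \<Rightarrow> real" where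
  "fdiff k h g x = (\<Sum>i\<le>k. (-1) ^ (k - i) * real (k choose i) * g (x + real i * h))"

definition omega :: "nat \<Rightarrow> (real \<Rightarrow> real) \<Rightarrow> real \<Rightarrow> real" where
  "omega k g t = Sup {\<bar>fdiff k h g x\<bar> | h x. 0 \<le> h \<and> h \<le> t \<and>
                        x \<in> {-1..1} \<and> x + real k * h \<in> {-1..1}}"

definition dmin :: "real set \<Rightarrow> real" where
  "dmin A = Min {\<bar>a - b\<bar> | a b. a \<in> A \<union> {-1, 1} \<and> b \<in> A \<union> {-1, 1} \<and> a \<noteq> b}"

definition Cr_derivs :: "nat \<Rightarrow> (real \<Rightarrow> real) \<Rightarrow> (nat \<Rightarrow> real \<Rightarrow> real) \<Rightarrow> bool" where
  "Cr_derivs r f D \<longleftrightarrow> (\<forall>x\<in>{-1..1}. D 0 x = f x) \<and>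
     (\<forall>i<r. \<forall>x\<in>{-1..1}. (D i has_real_derivative D (Suc i) x) (at x within {-1..1})) \<and>
     continuous_on {-1..1} (D r)"

end

theory Submission
  imports Defs
begin

text \<open>
  Let \<open>x = cos t\<close>. Even sums of translates of a power of the Fejer kernel over equispaced nodes
  give algebraic polynomials \<open>\<Psi> j \<ge> 0\<close> with sum \<open>1\<close>, where \<open>\<Psi> j\<close> decays fast away from its node \<open>\<xi> j\<close>
  on the scale \<open>h j = rho m (\<xi> j)\<close>. Near each node, \<open>f\<close> is replaced by a polynomial \<open>L j\<close> of bounded degree
  that interpolates \<open>f\<close> to order \<open>r\<close> at \<^emph>\<open>all\<close> points of \<open>B = A \<union> {-1, 1}\<close> and whose error, controlled
  by Whitney's inequality, grows only polynomially in the distance to \<open>\<xi> j\<close>. Since the \<open>\<Psi> j\<close> sum to \<open>1\<close>,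
  the polynomial \<open>\<Sum>j. \<Psi> j * L j\<close> inherits the interpolation, and its error at \<open>x\<close> is at most a constant times
  \<open>omega k (D r) \<rho> * min \<rho> \<bar>x - \<alpha>\<bar> ^ r\<close> with \<open>\<rho> = rho m x\<close>, for every \<open>\<alpha> \<in> B\<close>.

  One-sidedness is achieved by adding a multiple of the nonnegative polynomial
  \<open>\<Sum>j. h j ^ r * omega k (D r) (h j) * \<Psi> j x * (\<Prod>\<alpha>\<in>B. (\<bar>x - \<alpha>\<bar> / (\<bar>\<xi> j - \<alpha>\<bar> + h j)) ^ \<mu> \<alpha>)\<close>,
  where \<open>\<mu> \<alpha>\<close> is \<open>r\<close> at \<open>\<plusminus>1\<close> and the largest even number \<open>\<le> r\<close> elsewhere. It dominates the error because
  for large \<open>n\<close> at most one point of \<open>B\<close> lies within \<open>\<rho>\<close> of \<open>x\<close>.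
\<close>

section \<open>Finite differences and the modulus of smoothness\<close>

text \<open>The obstacle is uniformity: \<open>c\<close> may depend on \<open>k\<close>,
  \<open>r\<close>, \<open>p\<close> but not on where the points of \<open>A\<close> lie. A large
  \<open>n\<close> makes the scale smaller than the gaps of \<open>B\<close>, yet the ratio of gap
  to scale stays unbounded and must not enter any constant. Interpolation at points of
  \<open>B\<close> far from a node is therefore delicate, as the data there is only controlled up to
  a power of distance/scale; a high power of a linear factor that is small near the centre pays for
  it (\<open>hermite_correction\<close>). All other losses (change of scale in \<open>omega\<close>,
  ratio of scales, growth of the local polynomials) are powers of the weight \<open>v j x\<close>.
  Their exponents are fixed by \<open>k\<close>, \<open>r\<close>, \<open>p\<close> before the power
  \<open>s\<close> of the Fejer kernel is chosen, and the decay \<open>v j x\<close> to the power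
  -2s then wins. This dictates the order of quantifiers in the lemmas. Parity enters at one place
  only: a power of \<bar>x - \<alpha>\<bar> is a polynomial on [-1,1] if the exponent is even or
  \<alpha> is an endpoint. The approximant before the one-sided correction has contact of order
  \<open>r\<close> everywhere; for odd \<open>r\<close> the correction costs one order at interior
  points.\<close>

lemma sum_choose_Suc:
  fixes a :: "nat \<Rightarrow> real"
  shows "(\<Sum>i\<le>Suc k. real (Suc k choose i) * a i) = (\<Sum>i\<le>k. real (k choose i) * (a i + a (Suc i)))"
proof -
  have "(\<Sum>i\<le>Suc k. real (Suc k choose i) * a i)
      = a 0 + (\<Sum>i\<le>k. real (k choose i) * a (Suc i)) + (\<Sum>i\<le>k. real (k choose Suc i) * a (Suc i))"
    by (simp add: sum.atMost_Suc_shift sum.distrib algebra_simps del: sum.atMost_Suc)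
  moreover have "a 0 + (\<Sum>i\<le>k. real (k choose Suc i) * a (Suc i)) = (\<Sum>i\<le>Suc k. real (k choose i) * a i)"
    by (simp add: sum.atMost_Suc_shift del: sum.atMost_Suc)
  moreover have "\<dots> = (\<Sum>i\<le>k. real (k choose i) * a i)" by (simp add: binomial_eq_0)
  ultimately show ?thesis by (simp add: sum.distrib algebra_simps)
qed

lemma fdiff_alt: "fdiff k h g x = (-1)^k * (\<Sum>i\<le>k. real (k choose i) * ((-1)^i * g (x + real i * h)))"
  unfolding fdiff_def sum_distrib_left
  by (intro sum.cong refl) (auto simp: neg_one_power_add_eq_neg_one_power_diff[symmetric] power_add)

lemma fdiff_Suc: "fdiff (Suc k) h g x = fdiff k h g (x + h) - fdiff k h g x"
  unfolding fdiff_alt sum_choose_Suc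
  by (simp add: algebra_simps sum.distrib sum_subtractf sum_negf)

lemma fdiff_0 [simp]: "fdiff 0 h g x = g x"
  by (simp add: fdiff_def)

text \<open>With E the shift by \<open>h\<close>, this is (E^2 - 1)^k = (E + 1)^k (E - 1)^k. It is
  the reason why doubling the argument of \<open>omega\<close> costs at most 2^k.\<close>

lemma fdiff_double: "fdiff k (2 * h) g x = (\<Sum>i\<le>k. real (k choose i) * fdiff k h g (x + real i * h))"
proof (induction k arbitrary: x)
  case (Suc k)
  have "fdiff (Suc k) (2 * h) g x = (\<Sum>i\<le>k. real (k choose i) *
          (fdiff k h g (x + 2 * h + real i * h) - fdiff k h g (x + real i * h)))"
    unfolding fdiff_Suc Suc.IH by (simp add: sum_subtractf algebra_simps)
  also have "\<dots> = (\<Sum>i\<le>k. real (k choose i) *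
          (fdiff (Suc k) h g (x + real i * h) + fdiff (Suc k) h g (x + real (Suc i) * h)))"
    unfolding fdiff_Suc by (simp add: algebra_simps)
  finally show ?case unfolding sum_choose_Suc .
qed simp

lemma fdiff_diff: "fdiff k h (\<lambda>x. f x - g x) x = fdiff k h f x - fdiff k h g x"
  by (simp add: fdiff_def sum_subtractf algebra_simps)

lemma fdiff_first: "fdiff (Suc k) h g x = fdiff k h (\<lambda>x. g (x + h) - g x) x"
  unfolding fdiff_diff fdiff_Suc by (simp add: fdiff_def algebra_simps)

text \<open>The leading coefficients of q(x + h) and q cancel, so each difference lowers the degree.
  Hence subtracting a polynomial of degree below \<open>k\<close> leaves all k-th differences
  unchanged, which is how the lemma is used.\<close>

lemma fdiff_poly_eq_0:
  assumes "degree q < k"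
  shows "fdiff k h (poly q) x = 0"
  using assms
proof (induction k arbitrary: q x)
  case (Suc k)
  define q' where "q' = q \<circ>\<^sub>p [:h, 1:] - q"
  have "poly q' = (\<lambda>x. poly q (x + h) - poly q x)"
    by (simp add: q'_def poly_pcompose add.commute fun_eq_iff)
  then have fd: "fdiff (Suc k) h (poly q) x = fdiff k h (poly q') x"
    unfolding fdiff_first by simp
  show ?case
  proof (cases "degree q = 0")
    case True
    then obtain c where "q = [:c:]" by (meson degree_eq_zeroE)
    then have "q' = 0" by (simp add: q'_def pcompose_pCons)
    then show ?thesis unfolding fd by (simp add: fdiff_def)
  next
    case False
    have "coeff (q \<circ>\<^sub>p [:h, 1:]) (degree q) = coeff q (degree q)"
      using lead_coeff_comp[of "[:h, 1:]" q] by (simp add: degree_pcompose)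
    moreover have "degree q' \<le> degree q"
      unfolding q'_def by (rule degree_diff_le) (simp_all add: degree_pcompose)
    ultimately have "degree q' < degree q"
      using False by (metis coeff_diff eq_iff_diff_eq_0 leading_coeff_0_iff le_neq_implies_less q'_def degree_0)
    then show ?thesis unfolding fd using Suc by simp
  qed
qed simp

lemma abs_fdiff_le:
  assumes "\<And>i. i \<le> k \<Longrightarrow> \<bar>g (x + real i * h)\<bar> \<le> M"
  shows "\<bar>fdiff k h g x\<bar> \<le> 2 ^ k * M"
proof -
  have "\<bar>fdiff k h g x\<bar> \<le> (\<Sum>i\<le>k. real (k choose i) * M)"
    unfolding fdiff_def using assms
    by (intro order.trans[OF sum_abs] sum_mono) (auto simp: abs_mult intro!: mult_left_mono)
  also have "\<dots> = 2 ^ k * M"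
    using choose_row_sum[of k] by (metis of_nat_numeral of_nat_power of_nat_sum sum_distrib_right)
  finally show ?thesis .
qed

lemma node_between:
  fixes h x a b :: real
  assumes "0 \<le> h" "a \<le> x" "x + real k * h \<le> b" "i \<le> k"
  shows "x + real i * h \<in> {a..b}"
proof -
  have "real i * h \<le> real k * h" "0 \<le> real i * h" using assms by (auto intro: mult_right_mono)
  then show ?thesis unfolding atLeastAtMost_iff using assms by linarith
qed

text \<open>\<open>Sup\<close> of an unbounded set of reals carries no information, so comparing a
  single difference with \<open>omega\<close> rests on this bound.\<close>

lemma omega_set_bdd:
  assumes "continuous_on {-1..1} g"
  shows "bdd_above {\<bar>fdiff k h g x\<bar> | h x. 0 \<le> h \<and> h \<le> t \<and> x \<in> {-1..1} \<and> x + real k * h \<in> {-1..1}}"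
proof -
  have "bounded (g ` {-1..1})"
    using assms compact_continuous_image compact_imp_bounded by blast
  then obtain M where "\<And>y. y \<in> {-1..1} \<Longrightarrow> \<bar>g y\<bar> \<le> M"
    unfolding bounded_iff by fastforce
  then have "\<bar>fdiff k h g x\<bar> \<le> 2 ^ k * M" if "0 \<le> h" "-1 \<le> x" "x + real k * h \<le> 1" for h x
    using node_between[OF that] by (intro abs_fdiff_le) blast
  then show ?thesis
    by (intro bdd_aboveI[where M = "2 ^ k * M"]) auto
qed

lemma fdiff_le_omega:
  assumes "continuous_on {-1..1} g" "0 \<le> h" "h \<le> t" "-1 \<le> x" "x + real k * h \<le> 1"
  shows "\<bar>fdiff k h g x\<bar> \<le> omega k g t"
proof -
  have "x + real 0 * h \<in> {-1..1}" "x + real k * h \<in> {-1..1}"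
    using assms by (auto intro!: node_between[of _ _ _ k] simp del: atLeastAtMost_iff of_nat_0)
  then show ?thesis
    unfolding omega_def using assms by (intro cSup_upper omega_set_bdd) auto
qed

lemma omega_le:
  assumes "0 \<le> t"
    and "\<And>h x. 0 \<le> h \<Longrightarrow> h \<le> t \<Longrightarrow> -1 \<le> x \<Longrightarrow> x + real k * h \<le> 1 \<Longrightarrow> \<bar>fdiff k h g x\<bar> \<le> M"
  shows "omega k g t \<le> M"
  unfolding omega_def
proof (rule cSup_least)
  show "{\<bar>fdiff k h g x\<bar> | h x. 0 \<le> h \<and> h \<le> t \<and> x \<in> {-1..1} \<and> x + real k * h \<in> {-1..1}} \<noteq> {}"
    using assms(1) by (auto intro!: exI[of _ "0::real"])
qed (use assms in auto)

lemma omega_nonneg: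
  assumes "continuous_on {-1..1} g" "0 \<le> t"
  shows "0 \<le> omega k g t"
  using fdiff_le_omega[of g 0 t 0 k] assms by fastforce

lemma omega_mono:
  assumes "continuous_on {-1..1} g" "0 \<le> s" "s \<le> t"
  shows "omega k g s \<le> omega k g t"
  using assms by (intro omega_le fdiff_le_omega) auto

lemma omega_double:
  assumes g: "continuous_on {-1..1} g" and t: "0 \<le> t"
  shows "omega k g (2 * t) \<le> 2 ^ k * omega k g t"
proof (rule omega_le)
  fix h x :: real
  assume h: "0 \<le> h" "h \<le> 2 * t" and x: "-1 \<le> x" "x + real k * h \<le> 1"
  have "\<bar>fdiff k (h/2) g (x + real i * (h/2))\<bar> \<le> omega k g t" if "i \<le> k" for i
  proof (rule fdiff_le_omega[OF g])
    have "real i * h \<le> real k * h" using that h by (auto intro: mult_right_mono)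
    then show "x + real i * (h/2) + real k * (h/2) \<le> 1" using x by simp
    have "0 \<le> real i * h" using h by simp
    then show "- 1 \<le> x + real i * (h/2)" using x by simp
  qed (use h in auto)
  then have "\<bar>fdiff k (2 * (h/2)) g x\<bar> \<le> (\<Sum>i\<le>k. real (k choose i) * omega k g t)"
    unfolding fdiff_double
    by (intro order.trans[OF sum_abs] sum_mono) (auto simp: abs_mult intro!: mult_left_mono)
  also have "\<dots> = 2 ^ k * omega k g t"
    using choose_row_sum[of k] by (metis of_nat_numeral of_nat_power of_nat_sum sum_distrib_right)
  finally show "\<bar>fdiff k h g x\<bar> \<le> 2 ^ k * omega k g t" by simp
qed (use t in auto)

lemma omega_double_power:
  assumes "continuous_on {-1..1} g" "0 \<le> t"
  shows "omega k g (2 ^ i * t) \<le> (2 ^ i) ^ k * omega k g t"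
proof (induction i)
  case (Suc i)
  have "omega k g (2 * (2 ^ i * t)) \<le> 2 ^ k * omega k g (2 ^ i * t)"
    using assms by (intro omega_double) auto
  also have "\<dots> \<le> 2 ^ k * ((2 ^ i) ^ k * omega k g t)"
    using Suc.IH by (intro mult_left_mono) auto
  finally show ?case by (simp add: power_mult_distrib mult_ac)
qed simp

text \<open>The least exponent that reaches \<open>y\<close> overshoots by at most a factor
  \<open>b\<close>. The base is left general because it is 2 in \<open>omega_scale\<close> and 1 +
  1/k in \<open>radial_growth\<close>.\<close>

lemma ex_power_near:
  fixes b y :: real
  assumes "1 < b" "1 \<le> y"
  shows "\<exists>i. y \<le> b ^ i \<and> b ^ i \<le> b * y"
proof -
  obtain n where n: "y < b ^ n" using real_arch_pow[OF assms(1)] by blast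
  define i where "i = (LEAST i. y \<le> b ^ i)"
  have i: "y \<le> b ^ i" unfolding i_def using n by (metis (mono_tags, lifting) LeastI less_imp_le)
  have "b ^ i \<le> b * y"
  proof (cases i)
    case 0
    then show ?thesis using assms mult_mono[of 1 b 1 y] by simp
  next
    case (Suc l)
    then have "\<not> y \<le> b ^ l" unfolding i_def using not_less_Least by (metis lessI)
    then show ?thesis using Suc assms by simp
  qed
  then show ?thesis using i by blast
qed

text \<open>The factor 2 inside the power is the price of rounding \<open>y\<close> up to a power of
  2.\<close>

lemma omega_scale:
  assumes "continuous_on {-1..1} g" "0 \<le> t" "1 \<le> y"
  shows "omega k g (y * t) \<le> (2 * y) ^ k * omega k g t"
proof -
  obtain i where i: "y \<le> 2 ^ i" "2 ^ i \<le> 2 * y" using ex_power_near[of 2 y] assms by auto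
  have "omega k g (y * t) \<le> omega k g (2 ^ i * t)"
    using assms i by (intro omega_mono mult_right_mono) auto
  also have "\<dots> \<le> (2 ^ i) ^ k * omega k g t" using assms by (intro omega_double_power)
  also have "\<dots> \<le> (2 * y) ^ k * omega k g t"
    using i assms by (intro mult_right_mono power_mono omega_nonneg) auto
  finally show ?thesis .
qed

section \<open>Whitney's inequality with polynomial growth\<close>

lemma poly_antiderivative:
  fixes q :: "real poly"
  shows "\<exists>P. pderiv P = q \<and> poly P a = v \<and> (q = 0 \<or> degree q < d \<longrightarrow> P = 0 \<or> degree P < Suc d)"
proof -
  define P where "P = (\<Sum>i\<le>degree q. monom (coeff q i / real (Suc i)) (Suc i))"
  have "pderiv P = (\<Sum>i\<le>degree q. monom (coeff q i) i)"
    unfolding P_def higher_pderiv_sum[of 1, simplified]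
    by (intro sum.cong refl) (simp add: pderiv_monom del: of_nat_Suc)
  then have P: "pderiv P = q" by (simp add: poly_as_sum_of_monoms)
  have "degree P \<le> Suc (degree q)"
    unfolding P_def by (intro degree_sum_le) (auto intro: order.trans[OF degree_monom_le])
  moreover have "degree P = 0" if "q = 0"
    using P that by (simp add: pderiv_eq_0_iff)
  ultimately have "q = 0 \<or> degree q < d \<longrightarrow> degree P < Suc d" by auto
  then have "q = 0 \<or> degree q < d \<longrightarrow> degree (P + [:v - poly P a:]) < Suc d"
    using degree_add_le_max[of P "[:v - poly P a:]"] by auto
  then show ?thesis
    using P by (intro exI[of _ "P + [:v - poly P a:]"]) (auto simp: pderiv_add pderiv_pCons)
qed

text \<open>Integrates \<open>q\<close> repeatedly and fits each constant of integration to
  \<open>v\<close>. The disjunction \<open>q = 0 \<or> degree q < d\<close> expresses membership in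
  the d-dimensional space of polynomials of degree below \<open>d\<close> also for
  \<open>d = 0\<close>, where it forces \<open>q = 0\<close>; Taylor polynomials arise from that
  case.\<close>

lemma poly_prescribed_derivs:
  fixes q :: "real poly"
  shows "\<exists>L. (pderiv ^^ r) L = q \<and> (\<forall>i<r. poly ((pderiv ^^ i) L) a = v i) \<and>
             (q = 0 \<or> degree q < d \<longrightarrow> L = 0 \<or> degree L < d + r)"
proof (induction r arbitrary: v)
  case (Suc r)
  obtain L1 where L1: "(pderiv ^^ r) L1 = q" "\<forall>i<r. poly ((pderiv ^^ i) L1) a = v (Suc i)"
    "q = 0 \<or> degree q < d \<longrightarrow> L1 = 0 \<or> degree L1 < d + r"
    using Suc.IH[of "\<lambda>i. v (Suc i)"] by blast
  obtain L where L: "pderiv L = L1" "poly L a = v 0" "L1 = 0 \<or> degree L1 < d + r \<longrightarrow> L = 0 \<or> degree L < Suc (d + r)"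
    using poly_antiderivative[of L1 a "v 0" "d + r"] by blast
  have "poly ((pderiv ^^ i) L) a = v i" if "i < Suc r" for i
    using that L L1 by (cases i) (auto simp: funpow_Suc_right simp del: funpow.simps)
  moreover have "(pderiv ^^ Suc r) L = q"
    using L L1 by (simp add: funpow_Suc_right del: funpow.simps)
  ultimately show ?case using L(3) L1(3) by (intro exI[of _ L]) auto
qed auto

text \<open>The mean value inequality is applied r - i times, going down from order
  \<open>r\<close>, so no factorials appear. \<open>M\<close> has to bound the top derivative on the
  segment only, which lets callers insert bounds that grow with the distance from a centre.\<close>

lemma flat_bound:
  fixes E :: "nat \<Rightarrow> real \<Rightarrow> real"
  assumes S: "convex S" "a \<in> S" "x \<in> S"
    and E: "\<And>i x. i < r \<Longrightarrow> x \<in> S \<Longrightarrow> (E i has_real_derivative E (Suc i) x) (at x within S)"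
    and flat: "\<And>i. i < r \<Longrightarrow> E i a = 0"
    and M: "\<And>z. z \<in> closed_segment a x \<Longrightarrow> \<bar>E r z\<bar> \<le> M"
    and i: "i \<le> r"
  shows "\<bar>E i x\<bar> \<le> M * \<bar>x - a\<bar> ^ (r - i)"
proof -
  have M0: "0 \<le> M" using M[of a] by fastforce
  have sub: "closed_segment a x \<subseteq> S" using S by (simp add: closed_segment_subset)
  have "\<forall>z\<in>closed_segment a x. \<bar>E (r - j) z\<bar> \<le> M * \<bar>z - a\<bar> ^ j" if "j \<le> r" for j
    using that
  proof (induction j)
    case (Suc j)
    show ?case
    proof
      fix z assume z: "z \<in> closed_segment a x"
      have subz: "closed_segment a z \<subseteq> closed_segment a x"
        using z by (simp add: subset_closed_segment)
      have "norm (E (r - Suc j) z - E (r - Suc j) a) \<le> M * \<bar>z - a\<bar> ^ j * norm (z - a)"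
      proof (rule field_differentiable_bound[where S = "closed_segment a z"])
        fix w assume w: "w \<in> closed_segment a z"
        have "Suc (r - Suc j) = r - j" using Suc.prems by simp
        then show "(E (r - Suc j) has_field_derivative E (r - j) w) (at w within closed_segment a z)"
          using DERIV_subset[OF E[of "r - Suc j" w]] Suc.prems w subz sub by auto
        have "\<bar>E (r - j) w\<bar> \<le> M * \<bar>w - a\<bar> ^ j" using Suc w subz by auto
        also have "\<dots> \<le> M * \<bar>z - a\<bar> ^ j"
          using w M0 by (intro mult_left_mono power_mono) (auto simp: closed_segment_eq_real_ivl split: if_splits)
        finally show "norm (E (r - j) w) \<le> M * \<bar>z - a\<bar> ^ j" by simp
      qed auto
      then show "\<bar>E (r - Suc j) z\<bar> \<le> M * \<bar>z - a\<bar> ^ Suc j"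
        using flat[of "r - Suc j"] Suc.prems by (simp add: mult_ac)
    qed
  qed (use M in auto)
  from this[of "r - i"] show ?thesis using i by simp
qed

text \<open>
  \<open>shiftop p\<close> is the operator \<open>p(E)\<close>, where \<open>E\<close> is the shift by \<open>1\<close>. For \<open>V = steklov k\<close> and an
  antiderivative \<open>G\<close> of \<open>g\<close>, the function \<open>V(E) G\<close> is the Steklov-type mean of \<open>g\<close> obtained by averaging
  \<open>g - (-1) ^ k * fdiff k s g\<close> over \<open>s \<in> [0, 1]\<close>. As \<open>V\<close> is divisible by \<open>E - 1\<close>, the \<open>k\<close>-th derivative of the
  \<open>k\<close>-fold iterated mean is a combination of \<open>k\<close>-th differences of \<open>g\<close>.
\<close>

definition shiftop :: "real poly \<Rightarrow> (real \<Rightarrow> real) \<Rightarrow> real \<Rightarrow> real" where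
  "shiftop p u x = (\<Sum>i\<le>degree p. coeff p i * u (x + real i))"

lemma shiftop_eq:
  assumes "degree p \<le> n"
  shows "shiftop p u x = (\<Sum>i\<le>n. coeff p i * u (x + real i))"
  unfolding shiftop_def using assms
  by (intro sum.mono_neutral_left) (auto simp: coeff_eq_0)

lemma shiftop_0 [simp]: "shiftop 0 u x = 0"
  by (simp add: shiftop_def)

lemma shiftop_add: "shiftop (p + q) u x = shiftop p u x + shiftop q u x"
  using degree_add_le_max[of p q]
  by (simp add: shiftop_eq[where n = "max (degree p) (degree q)"] sum.distrib algebra_simps)

lemma shiftop_smult: "shiftop (smult c p) u x = c * shiftop p u x"
  using degree_smult_le[of c p]
  by (simp add: shiftop_eq[where n = "degree p"] sum_distrib_left mult_ac)

lemma shiftop_pCons: "shiftop (pCons a p) u x = a * u x + shiftop p u (x + 1)"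
  unfolding shiftop_eq[OF degree_pCons_le]
  by (simp add: shiftop_def sum.atMost_Suc_shift algebra_simps del: sum.atMost_Suc)

text \<open>The map from p to p(E) is multiplicative, so factorizations of polynomials become
  factorizations of operators.\<close>

lemma shiftop_mult: "shiftop (p * q) u x = shiftop p (shiftop q u) x"
  by (induction p arbitrary: x) (simp_all add: shiftop_add shiftop_smult shiftop_pCons)

lemma shiftop_sum: "shiftop (\<Sum>i\<in>I. p i) u x = (\<Sum>i\<in>I. shiftop (p i) u x)"
  by (induction I rule: infinite_finite_induct) (simp_all add: shiftop_add)

lemma shiftop_1 [simp]: "shiftop 1 u = u"
  by (simp add: shiftop_def fun_eq_iff)

lemma shiftop_monom: "shiftop (monom 1 i) u x = u (x + real i)"
  by (induction i arbitrary: x) (simp_all add: monom_0 monom_Suc shiftop_pCons add_ac)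

lemma shiftop_diff: "shiftop (p - q) u x = shiftop p u x - shiftop q u x"
  using shiftop_add[of "p - q" q u x] by simp

lemma shiftop_fun_diff: "shiftop p (\<lambda>x. u x - w x) x = shiftop p u x - shiftop p w x"
  by (simp add: shiftop_def sum_subtractf algebra_simps)

lemma shiftop_power_fdiff: "shiftop ([:-1, 1:] ^ k) u x = fdiff k 1 u x"
proof (induction k arbitrary: u x)
  case (Suc k)
  have "shiftop ([:-1, 1:] ^ Suc k) u x = shiftop ([:-1, 1:] ^ k) (shiftop [:-1, 1:] u) x"
    by (simp only: power_Suc2 shiftop_mult)
  also have "shiftop [:-1, 1:] u = (\<lambda>x. u (x + 1) - u x)"
    by (simp add: fun_eq_iff shiftop_pCons)
  finally show ?case by (simp add: Suc fdiff_first)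
qed simp

lemma shiftop_deriv:
  assumes "\<And>x. (u has_real_derivative v x) (at x)"
  shows "(shiftop p u has_real_derivative shiftop p v x) (at x)"
proof -
  have "((\<lambda>x. u (x + c)) has_real_derivative v (x + c)) (at x)" for c
    using assms DERIV_shift by blast
  then show ?thesis
    unfolding shiftop_def[abs_def] by (auto intro!: derivative_eq_intros simp: mult.commute)
qed

lemma shiftop_bound:
  assumes "degree p \<le> n" "\<And>y. x \<le> y \<Longrightarrow> y \<le> x + real n \<Longrightarrow> \<bar>u y\<bar> \<le> M"
  shows "\<bar>shiftop p u x\<bar> \<le> (\<Sum>i\<le>n. \<bar>coeff p i\<bar>) * M"
  unfolding shiftop_eq[OF assms(1)] sum_distrib_right
  using assms(2) by (intro order.trans[OF sum_abs] sum_mono) (auto simp: abs_mult intro!: mult_left_mono)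

text \<open>The quotient by \<open>i\<close> comes from averaging: the mean of g(x + s*i) over s in
  [0,1] is (G(x + i) - G(x))/i.\<close>

definition steklov :: "nat \<Rightarrow> real poly" where
  "steklov k = (\<Sum>i=1..k. smult ((-1) ^ Suc i * real (k choose i) / real i) (monom 1 i - 1))"

lemma shiftop_steklov:
  "shiftop (steklov k) u x = (\<Sum>i=1..k. (-1) ^ Suc i * real (k choose i) / real i * (u (x + real i) - u x))"
  unfolding steklov_def shiftop_sum shiftop_smult shiftop_diff shiftop_monom by simp

lemma degree_steklov: "degree (steklov k) \<le> k"
  unfolding steklov_def
  by (intro degree_sum_le) (auto intro!: order.trans[OF degree_smult_le] degree_diff_le order.trans[OF degree_monom_le])

text \<open>The zero at 1 makes the k-th power of \<open>steklov k\<close> contain (E - 1)^k, that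
  is, the k-th unit difference.\<close>

lemma steklov_factor: "\<exists>U. steklov k = U * [:-1, 1:]"
proof -
  have "poly (steklov k) 1 = 0" by (simp add: steklov_def poly_sum poly_monom)
  then show ?thesis by (metis poly_eq_0_iff_dvd dvdE mult.commute)
qed

lemma sum_choose_from_1_le: "(\<Sum>i=1..k. real (k choose i)) \<le> 2 ^ k"
proof -
  have "(\<Sum>i=1..k. real (k choose i)) \<le> (\<Sum>i\<le>k. real (k choose i))"
    by (intro sum_mono2) auto
  then show ?thesis using choose_row_sum[of k] by (metis of_nat_numeral of_nat_power of_nat_sum)
qed

text \<open>Each quotient (u(x + i) - u(x))/i is bounded like a mean value of \<open>v\<close>, so
  one application of the operator to an antiderivative costs only the sum of the binomial
  coefficients.\<close>

lemma steklov_bound: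
  assumes u: "\<And>x. (u has_real_derivative v x) (at x)"
    and v: "\<And>y. x \<le> y \<Longrightarrow> y \<le> x + real k \<Longrightarrow> \<bar>v y\<bar> \<le> M"
  shows "\<bar>shiftop (steklov k) u x\<bar> \<le> 2 ^ k * M"
proof -
  have M0: "0 \<le> M" using v[of x] by fastforce
  have "\<bar>(-1) ^ Suc i * real (k choose i) / real i * (u (x + real i) - u x)\<bar> \<le> real (k choose i) * M"
    if i: "i \<in> {1..k}" for i
  proof -
    have "norm (u (x + real i) - u x) \<le> M * norm (x + real i - x)"
    proof (rule field_differentiable_bound[where S = "{x..x + real i}" and f' = v])
      show "norm (v z) \<le> M" if "z \<in> {x..x + real i}" for z
        using v[of z] that i by simp
    qed (use u in \<open>simp_all add: has_field_derivative_at_within\<close>)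
    then have "real (k choose i) / real i * \<bar>u (x + real i) - u x\<bar> \<le> real (k choose i) / real i * (M * real i)"
      by (intro mult_left_mono) auto
    then show ?thesis using i by (simp add: abs_mult)
  qed
  then have "\<bar>shiftop (steklov k) u x\<bar> \<le> (\<Sum>i=1..k. real (k choose i) * M)"
    unfolding shiftop_steklov by (intro order.trans[OF sum_abs] sum_mono)
  also have "\<dots> \<le> 2 ^ k * M"
    unfolding sum_distrib_right[symmetric] using sum_choose_from_1_le M0 by (rule mult_right_mono)
  finally show ?thesis .
qed

lemma steklov_error:
  assumes G: "\<And>x. (G has_real_derivative g x) (at x)"
    and W: "\<And>h. 0 \<le> h \<Longrightarrow> h \<le> 1 \<Longrightarrow> \<bar>fdiff k h g x\<bar> \<le> W"
  shows "\<bar>g x - shiftop (steklov k) G x\<bar> \<le> W"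
proof -
  \<comment> \<open>\<open>H\<close> integrates the signed k-th difference over the step size from 0
    to \<open>s\<close>. Hence \<open>H 1 - H 0\<close>, the error of the mean, is bounded by the
    supremum of the differences.\<close>
  define H where "H s = s * g x + (\<Sum>i=1..k. (-1) ^ i * real (k choose i) / real i * (G (x + s * real i) - G x))" for s
  have fd: "(-1)^k * fdiff k s g x = g x + (\<Sum>i=1..k. (-1) ^ i * real (k choose i) / real i * (g (x + s * real i) * real i))" for s
  proof -
    have "(-1)^k * fdiff k s g x = (\<Sum>i\<le>k. real (k choose i) * ((-1)^i * g (x + real i * s)))"
      by (simp add: fdiff_alt flip: mult.assoc power_add)
    also have "\<dots> = g x + (\<Sum>i=1..k. real (k choose i) * ((-1)^i * g (x + real i * s)))"
      by (simp add: sum.atMost_shift sum.atLeast1_atMost_eq lessThan_Suc_atMost)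
    also have "(\<Sum>i=1..k. real (k choose i) * ((-1)^i * g (x + real i * s)))
        = (\<Sum>i=1..k. (-1) ^ i * real (k choose i) / real i * (g (x + s * real i) * real i))"
      by (rule sum.cong) (simp_all add: mult.commute mult.left_commute)
    finally show ?thesis .
  qed
  have dG: "((\<lambda>s. G (x + s * c) - G x) has_real_derivative g (x + s * c) * c) (at s)" for s c
  proof -
    have "((\<lambda>s. x + s * c) has_real_derivative c) (at s)"
      by (auto intro!: derivative_eq_intros)
    from DERIV_diff[OF DERIV_chain2[OF G this] DERIV_const[of "G x"]] show ?thesis by simp
  qed
  have H: "(H has_real_derivative (-1)^k * fdiff k s g x) (at s)" for s
    unfolding H_def fd by (intro DERIV_add DERIV_sum DERIV_cmult dG) (auto intro!: derivative_eq_intros)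
  have "norm (H 1 - H 0) \<le> W * norm (1 - 0 :: real)"
  proof (rule field_differentiable_bound[where S = "{0..1}" and f' = "\<lambda>s. (-1)^k * fdiff k s g x"])
    show "norm ((-1)^k * fdiff k z g x) \<le> W" if "z \<in> {0..1}" for z
      using W[of z] that by (simp add: abs_mult)
  qed (use H in \<open>simp_all add: has_field_derivative_at_within\<close>)
  moreover have "H 1 - H 0 = g x - shiftop (steklov k) G x"
    unfolding H_def shiftop_steklov by (simp add: sum_negf)
  ultimately show ?thesis by simp
qed

lemma ex_antiderivative_chain:
  assumes "continuous_on UNIV g"
  shows "\<exists>G. G 0 = g \<and> (\<forall>i x. (G (Suc i) has_real_derivative G i x) (at x))"
proof -
  have anti: "\<exists>F. \<forall>x. (F has_real_derivative u x) (at x)" if "continuous_on UNIV u" for u :: "real \<Rightarrow> real"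
    using einterval_antiderivative[of "-\<infinity>" "\<infinity>" u] that
    by (auto simp: continuous_on_eq_continuous_at has_real_derivative_iff_has_vector_derivative)
  have "\<exists>G. \<forall>i. (continuous_on UNIV (G i) \<and> (i = 0 \<longrightarrow> G i = g)) \<and> (\<forall>x. (G (Suc i) has_real_derivative G i x) (at x))"
  proof (rule dependent_nat_choice)
    show "\<exists>u. continuous_on UNIV u \<and> (0 = (0::nat) \<longrightarrow> u = g)" using assms by auto
    fix u i assume "continuous_on UNIV u \<and> (i = (0::nat) \<longrightarrow> u = g)"
    then obtain F where "\<forall>x. (F has_real_derivative u x) (at x)" using anti by blast
    then show "\<exists>w. (continuous_on UNIV w \<and> (Suc i = 0 \<longrightarrow> w = g)) \<and> (\<forall>x. (w has_real_derivative u x) (at x))"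
      by (auto simp: continuous_on_eq_continuous_at intro: DERIV_isCont)
  qed
  then show ?thesis by blast
qed

lemma taylor_approx:
  fixes F :: "nat \<Rightarrow> real \<Rightarrow> real"
  assumes F: "\<And>i x. i < k \<Longrightarrow> (F i has_real_derivative F (Suc i) x) (at x)"
    and M: "\<And>x. a \<le> x \<Longrightarrow> x \<le> a + 1 \<Longrightarrow> \<bar>F k x\<bar> \<le> M" and k: "k \<ge> 1"
  shows "\<exists>q. degree q < k \<and> (\<forall>x\<in>{a..a + 1}. \<bar>F 0 x - poly q x\<bar> \<le> M)"
proof -
  obtain q where q: "(pderiv ^^ k) q = 0" "\<forall>i<k. poly ((pderiv ^^ i) q) a = F i a" "q = 0 \<or> degree q < k"
    using poly_prescribed_derivs[of k "0 :: real poly" a "\<lambda>i. F i a" 0] by auto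
  have "\<bar>F 0 x - poly q x\<bar> \<le> M" if x: "x \<in> {a..a + 1}" for x
  proof -
    have "\<bar>F 0 x - poly ((pderiv ^^ 0) q) x\<bar> \<le> M * \<bar>x - a\<bar> ^ (k - 0)"
    proof (rule flat_bound[where E = "\<lambda>i x. F i x - poly ((pderiv ^^ i) q) x" and S = UNIV])
      show "\<bar>F k z - poly ((pderiv ^^ k) q) z\<bar> \<le> M" if "z \<in> closed_segment a x" for z
        using that x q(1) by (auto intro!: M simp: closed_segment_eq_real_ivl)
      show "((\<lambda>x. F i x - poly ((pderiv ^^ i) q) x) has_real_derivative
          F (Suc i) x - poly ((pderiv ^^ Suc i) q) x) (at x)" if "i < k" for i x
        using F[OF that] poly_DERIV by (auto intro!: DERIV_diff)
    qed (use q in auto)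
    moreover have "\<bar>x - a\<bar> ^ k \<le> 1" using x by (intro power_le_one) auto
    moreover have "0 \<le> M" using M[of a] by fastforce
    ultimately show ?thesis using mult_left_mono[of "\<bar>x - a\<bar> ^ k" 1 M] by simp
  qed
  then show ?thesis using q(3) k by (intro exI[of _ q]) auto
qed

text \<open>Let \<open>G i\<close> be iterated antiderivatives of \<open>g\<close> and V the Steklov
  polynomial. Then \<open>g\<close> minus V^k(E) \<open>G k\<close> telescopes into the terms V^l(E)
  \<open>e l\<close> for l < k, where \<open>e l\<close> is the error of one averaging at level l.
  The remaining function V^k(E) \<open>G k\<close> has k-th derivative V^k(E) g = U^k(E) (E - 1)^k
  g, a combination of k-th differences, so its Taylor polynomial serves as \<open>q\<close>. The
  window [0, k^2 + 1] is what the shifts need: at most k*(k - 1) from the powers of V or U,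
  \<open>k\<close> from the difference itself, and 1 for \<open>x\<close>.\<close>

lemma whitney_unit:
  assumes k: "k \<ge> 1"
  shows "\<exists>C\<ge>0. \<forall>g W. continuous_on UNIV g \<and>
    (\<forall>h x. 0 \<le> h \<and> h \<le> 1 \<and> 0 \<le> x \<and> x + real k * h \<le> real k ^ 2 + 1 \<longrightarrow> \<bar>fdiff k h g x\<bar> \<le> W) \<longrightarrow>
    (\<exists>q. degree q < k \<and> (\<forall>x\<in>{0..1}. \<bar>g x - poly q x\<bar> \<le> C * W))"
proof -
  obtain U where U: "steklov k = U * [:-1, 1:]" using steklov_factor by blast
  define n where "n = degree (U ^ k)"
  have "degree U \<le> k - 1"
  proof (cases "U = 0")
    case False
    then have "degree (steklov k) = Suc (degree U)" unfolding U by (subst degree_mult_eq) auto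
    then show ?thesis using degree_steklov[of k] by simp
  qed simp
  then have n: "n \<le> (k - 1) * k"
    unfolding n_def using degree_power_le[of U k] by (meson mult_le_mono1 order.trans)
  then have nk: "real n + real k \<le> real k ^ 2"
    by (metis (no_types, lifting) add_le_cancel_right assms mult_eq_if not_one_le_zero of_nat_add of_nat_le_iff of_nat_power power2_eq_square add.commute)
  define C1 where "C1 = (\<Sum>i\<le>n. \<bar>coeff (U ^ k) i\<bar>)"
  define C where "C = (\<Sum>l<k. (2 ^ k) ^ l) + C1"
  have C1: "C1 \<ge> 0" unfolding C1_def by (intro sum_nonneg) auto
  have "C \<ge> 0" unfolding C_def using C1 by (intro add_nonneg_nonneg sum_nonneg) auto
  moreover have "\<exists>q. degree q < k \<and> (\<forall>x\<in>{0..1}. \<bar>g x - poly q x\<bar> \<le> C * W)"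
    if g: "continuous_on UNIV g"
      and W: "\<And>h x. 0 \<le> h \<Longrightarrow> h \<le> 1 \<Longrightarrow> 0 \<le> x \<Longrightarrow> x + real k * h \<le> real k ^ 2 + 1 \<Longrightarrow> \<bar>fdiff k h g x\<bar> \<le> W" for g W
  proof -
    obtain G where G0: "G 0 = g" and G: "\<And>i x. (G (Suc i) has_real_derivative G i x) (at x)"
      using ex_antiderivative_chain[OF g] by blast
    define V where "V = steklov k"
    define e where "e i x = G i x - shiftop V (G (Suc i)) x" for i x
    have e0: "\<bar>e 0 x\<bar> \<le> W" if x: "0 \<le> x" "x \<le> real k ^ 2 - real k + 1" for x
    proof -
      have "\<bar>fdiff k h g x\<bar> \<le> W" if h: "0 \<le> h" "h \<le> 1" for h
      proof -
        have "real k * h \<le> real k" using h by (simp add: mult_left_le)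
        then show ?thesis using W[of h x] x h by simp
      qed
      then show ?thesis
        unfolding e_def V_def G0 using steklov_error[of "G 1" g k x W] G[of 0] G0 by simp
    qed
    have e': "(e (Suc i) has_real_derivative e i x) (at x)" for i x
      unfolding e_def by (intro DERIV_diff G shiftop_deriv)
    \<comment> \<open>\<open>e (Suc l)\<close> is an antiderivative of \<open>e l\<close>, so
      \<open>steklov_bound\<close> carries the estimate from level \<open>l\<close> to
      \<open>Suc l\<close>, consuming \<open>k\<close> more units of the window.\<close>
    have err: "\<bar>shiftop (V ^ l) (e l) x\<bar> \<le> (2 ^ k) ^ l * W"
      if "0 \<le> x" "x + real (k * l) \<le> real k ^ 2 - real k + 1" for l x
      using that
    proof (induction l arbitrary: x)
      case 0
      then show ?case using e0 by simp
    next
      case (Suc l)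
      have "\<bar>shiftop V (shiftop (V ^ l) (e (Suc l))) x\<bar> \<le> 2 ^ k * ((2 ^ k) ^ l * W)"
        unfolding V_def
      proof (rule steklov_bound)
        show "(shiftop (steklov k ^ l) (e (Suc l)) has_real_derivative shiftop (steklov k ^ l) (e l) y) (at y)" for y
          by (intro shiftop_deriv e')
        fix y assume "x \<le> y" "y \<le> x + real k"
        then show "\<bar>shiftop (steklov k ^ l) (e l) y\<bar> \<le> (2 ^ k) ^ l * W"
          using Suc.IH[of y] Suc.prems unfolding V_def by (simp add: algebra_simps)
      qed
      then show ?case by (simp add: shiftop_mult mult_ac)
    qed
    have shift_e: "shiftop (V ^ l) (e l) x = shiftop (V ^ l) (G l) x - shiftop (V ^ Suc l) (G (Suc l)) x" for l x
      unfolding e_def shiftop_fun_diff by (simp only: power_Suc2 shiftop_mult)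
    have part1: "\<bar>g x - shiftop (V ^ k) (G k) x\<bar> \<le> (\<Sum>l<k. (2 ^ k) ^ l) * W" if x: "x \<in> {0..1}" for x
    proof -
      have "g x - shiftop (V ^ k) (G k) x = (\<Sum>l<k. shiftop (V ^ l) (e l) x)"
        unfolding shift_e using sum_lessThan_telescope'[of "\<lambda>l. shiftop (V ^ l) (G l) x" k] by (simp add: G0 del: power_Suc)
      also have "\<bar>\<dots>\<bar> \<le> (\<Sum>l<k. (2 ^ k) ^ l * W)"
      proof (intro order.trans[OF sum_abs] sum_mono err)
        fix l assume "l \<in> {..<k}"
        then have "k * Suc l \<le> k * k" by (intro mult_left_mono) auto
        then have "real (k * Suc l) \<le> real (k * k)" by (simp only: of_nat_le_iff)
        then show "x + real (k * l) \<le> real k ^ 2 - real k + 1"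
          using x by (simp add: power2_eq_square algebra_simps)
      qed (use x in auto)
      finally show ?thesis by (simp add: sum_distrib_right)
    qed
    obtain q where q: "degree q < k" "\<And>x. x \<in> {0..1} \<Longrightarrow> \<bar>shiftop (V ^ k) (G k) x - poly q x\<bar> \<le> C1 * W"
    proof -
      have "\<exists>q. degree q < k \<and> (\<forall>x\<in>{0..0 + 1}. \<bar>shiftop (V ^ k) (G (k - 0)) x - poly q x\<bar> \<le> C1 * W)"
      proof (rule taylor_approx[OF _ _ k, where F = "\<lambda>i. shiftop (V ^ k) (G (k - i))"])
        fix i x assume "i < k"
        then have "k - i = Suc (k - Suc i)" by simp
        then show "(shiftop (V ^ k) (G (k - i)) has_real_derivative shiftop (V ^ k) (G (k - Suc i)) x) (at x)"
          using shiftop_deriv[OF G] by metis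
      next
        fix x :: real assume x: "0 \<le> x" "x \<le> 0 + 1"
        have "shiftop (V ^ k) g x = shiftop (U ^ k) (fdiff k 1 g) x"
          unfolding V_def U power_mult_distrib shiftop_mult shiftop_power_fdiff[abs_def] ..
        also have "\<bar>\<dots>\<bar> \<le> C1 * W"
          unfolding C1_def using x nk by (intro shiftop_bound W) (auto simp: n_def)
        finally show "\<bar>shiftop (V ^ k) (G (k - k)) x\<bar> \<le> C1 * W" by (simp add: G0)
      qed
      then show ?thesis using that by auto
    qed
    have "\<bar>g x - poly q x\<bar> \<le> C * W" if "x \<in> {0..1}" for x
      using part1[OF that] q(2)[OF that] unfolding C_def by (simp add: algebra_simps)
    then show ?thesis using q(1) by blast
  qed
  ultimately show ?thesis by (intro exI[of _ C]) blast
qed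

text \<open>On equally spaced points from \<open>c\<close> to \<open>x\<close> the k-th difference
  expresses \<open>e x\<close> by values nearer to \<open>c\<close>. With rings growing by b = 1 +
  1/k, those points lie in the previous ring because (1 - 1/k)(1 + 1/k) <= 1, and one ring costs a
  factor 2^k up to an additive term. Bernoulli gives b^k >= 2; hence b^i <= 2*Y implies 2^i <=
  (2*Y)^k and the geometric cost becomes polynomial. The exponent k*(k + 1) consists of (2^i)^k for
  the rings and one further 2^i that absorbs their number.\<close>

lemma radial_growth:
  fixes e :: "real \<Rightarrow> real"
  assumes k: "k \<ge> 1" and eta: "0 < \<eta>" and C: "0 \<le> C" and w: "0 \<le> w"
    and c: "-1 \<le> c" "c \<le> 1"
    and base: "\<And>x. x \<in> {-1..1} \<Longrightarrow> \<bar>x - c\<bar> \<le> \<eta> \<Longrightarrow> \<bar>e x\<bar> \<le> C * w"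
    and W: "\<And>h x y. 0 \<le> h \<Longrightarrow> -1 \<le> x \<Longrightarrow> x + real k * h \<le> 1 \<Longrightarrow> 1 \<le> y \<Longrightarrow> h \<le> y * \<eta> \<Longrightarrow>
               \<bar>fdiff k h e x\<bar> \<le> (2 * y) ^ k * w"
    and x: "x \<in> {-1..1}"
  shows "\<bar>e x\<bar> \<le> (C + 4 ^ k) * (2 * (1 + \<bar>x - c\<bar> / \<eta>)) ^ (k * (k + 1)) * w"
proof -
  define b where "b = 1 + 1 / real k"
  have b: "1 < b" "b \<le> 2" unfolding b_def using k by auto
  have bk: "2 \<le> b ^ k"
  proof -
    have "1 + real k * (1 / real k) \<le> b ^ k" 
      unfolding b_def by (intro Bernoulli_inequality order.trans[of "-1" 0 "1 / real k"]) simp_all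
    then show ?thesis using k by simp
  qed
  have grow: "\<bar>e x\<bar> \<le> (C + 4 ^ k * real i) * (2 ^ k) ^ i * w"
    if "x \<in> {-1..1}" "\<bar>x - c\<bar> \<le> \<eta> * b ^ i" for i x
    using that
  proof (induction i arbitrary: x)
    case 0
    then show ?case using base by simp
  next
    case (Suc i)
    define K where "K = (C + 4 ^ k * real i) * (2 ^ k) ^ i * w"
    define h where "h = (x - c) / real k"
    define z where "z l = c + real l * h" for l
    have zx: "z k = x" using k by (simp add: z_def h_def)
    have zl: "z l \<in> {-1..1}" if "l \<le> k" for l
    proof -
      have "z l = (1 - real l / real k) * c + (real l / real k) * x"
        using k by (simp add: z_def h_def field_simps)
      moreover have "real l / real k \<le> 1" using that k by simp
      ultimately show ?thesis
        using convexD_alt[of "{-1..1::real}" c x "real l / real k"] c Suc.prems(1) by simp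
    qed
    have ez: "\<bar>e (z l)\<bar> \<le> K" if "l < k" for l
      unfolding K_def
    proof (rule Suc.IH)
      show "z l \<in> {-1..1}" using zl that by simp
      have "\<bar>z l - c\<bar> = real l / real k * \<bar>x - c\<bar>" by (simp add: z_def h_def abs_mult)
      also have "\<dots> \<le> (1 - 1 / real k) * (\<eta> * b ^ Suc i)"
        using Suc.prems(2) that k by (intro mult_mono) (auto simp: field_simps)
      also have "\<dots> = (1 - 1 / real k) * (1 + 1 / real k) * (\<eta> * b ^ i)" by (simp add: b_def)
      also have "\<dots> \<le> 1 * (\<eta> * b ^ i)"
        using eta b by (intro mult_right_mono) (auto simp: algebra_simps)
      finally show "\<bar>z l - c\<bar> \<le> \<eta> * b ^ i" by simp
    qed
    have K0: "0 \<le> K" unfolding K_def using C w by simp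
    have habs: "\<bar>h\<bar> \<le> 2 ^ Suc i * \<eta>"
    proof -
      have "\<bar>h\<bar> \<le> \<bar>x - c\<bar>" 
        using k mult_right_mono[of 1 "real k" "\<bar>x - c\<bar>"] by (simp add: h_def field_simps)
      also have "\<dots> \<le> \<eta> * 2 ^ Suc i"
        using Suc.prems(2) power_mono[of b 2 "Suc i"] b eta
        by (meson less_imp_le mult_left_mono order.trans zero_le_one)
      finally show ?thesis by (simp add: mult.commute)
    qed
    \<comment> \<open>The finite difference over the nodes \<open>z 0, \<dots>, z k\<close>, solved for the outermost value \<open>e x\<close>.\<close>
    have p: "(1::real) \<le> 2 ^ Suc i" by (rule one_le_power) simp
    have fd: "\<bar>\<Sum>l\<le>k. (-1) ^ (k - l) * real (k choose l) * e (z l)\<bar> \<le> (2 * 2 ^ Suc i) ^ k * w"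
    proof (cases "0 \<le> h")
      case True
      have "\<bar>fdiff k h e c\<bar> \<le> (2 * 2 ^ Suc i) ^ k * w"
        using True habs c zx Suc.prems(1) p unfolding z_def by (intro W) simp_all
      then show ?thesis by (simp add: fdiff_def z_def)
    next
      case False
      have "\<bar>fdiff k (-h) e x\<bar> \<le> (2 * 2 ^ Suc i) ^ k * w"
        using False habs c zx Suc.prems(1) p unfolding z_def by (intro W) auto
      moreover have "fdiff k (-h) e x = (\<Sum>l\<le>k. (-1) ^ l * real (k choose l) * e (z l))"
        unfolding fdiff_def
        by (rule sum.reindex_bij_witness[of _ "\<lambda>l. k - l" "\<lambda>l. k - l"])
          (auto simp: zx[symmetric] z_def binomial_symmetric[symmetric] of_nat_diff algebra_simps)
      moreover have "(\<Sum>l\<le>k. (-1) ^ (k - l) * real (k choose l) * e (z l))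
          = (-1) ^ k * (\<Sum>l\<le>k. (-1) ^ l * real (k choose l) * e (z l))"
        unfolding sum_distrib_left
        by (intro sum.cong refl) (auto simp: neg_one_power_add_eq_neg_one_power_diff[symmetric] power_add)
      ultimately show ?thesis by (simp add: abs_mult)
    qed
    have "(\<Sum>l\<le>k. (-1) ^ (k - l) * real (k choose l) * e (z l))
        = (\<Sum>l<k. (-1) ^ (k - l) * real (k choose l) * e (z l)) + e x"
      by (simp add: lessThan_Suc_atMost[symmetric] zx)
    then have "\<bar>e x\<bar> \<le> (2 * 2 ^ Suc i) ^ k * w + \<bar>\<Sum>l<k. (-1) ^ (k - l) * real (k choose l) * e (z l)\<bar>"
      using fd by linarith
    also have "\<bar>\<Sum>l<k. (-1) ^ (k - l) * real (k choose l) * e (z l)\<bar> \<le> (\<Sum>l<k. real (k choose l) * K)"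
      using ez by (intro order.trans[OF sum_abs] sum_mono) (auto simp: abs_mult intro!: mult_left_mono)
    also have "\<dots> \<le> (\<Sum>l\<le>k. real (k choose l) * K)" using K0 by (intro sum_mono2) auto
    also have "\<dots> = 2 ^ k * K"
      using choose_row_sum[of k] by (metis of_nat_numeral of_nat_power of_nat_sum sum_distrib_right)
    also have "(2 * 2 ^ Suc i) ^ k * w = 4 ^ k * (2 ^ k) ^ i * w"
      by (simp add: power_mult_distrib power_mult[symmetric] mult_ac)
    also have "\<dots> + 2 ^ k * K \<le> 4 ^ k * (2 ^ k) ^ Suc i * w + 2 ^ k * K"
      using w by (intro add_right_mono mult_right_mono mult_left_mono power_increasing) auto
    also have "\<dots> = (C + 4 ^ k * real (Suc i)) * (2 ^ k) ^ Suc i * w"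
      unfolding K_def by (simp add: algebra_simps)
    finally show ?case by simp
  qed
  define Y where "Y = 1 + \<bar>x - c\<bar> / \<eta>"
  have Y: "1 \<le> Y" unfolding Y_def using eta by simp
  obtain i where i: "Y \<le> b ^ i" "b ^ i \<le> b * Y" using ex_power_near[of b Y] b Y by blast
  have "b * Y \<le> 2 * Y" using b Y by (intro mult_right_mono) auto
  then have bi: "b ^ i \<le> 2 * Y" using i by linarith
  have "\<bar>x - c\<bar> \<le> \<eta> * Y" using eta by (simp add: Y_def field_simps)
  also have "\<dots> \<le> \<eta> * b ^ i" using i eta by simp
  finally have "\<bar>e x\<bar> \<le> (C + 4 ^ k * real i) * (2 ^ k) ^ i * w" using grow x by blast
  also have "\<dots> \<le> ((C + 4 ^ k) * 2 ^ i) * (2 ^ k) ^ i * w"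
  proof (intro mult_right_mono)
    have "C * 1 \<le> C * 2 ^ i" "4 ^ k * real i \<le> 4 ^ k * 2 ^ i"
      using C by (intro mult_left_mono; simp add: less_imp_le)+
    then show "C + 4 ^ k * real i \<le> (C + 4 ^ k) * 2 ^ i" unfolding distrib_right by linarith
  qed (use w in auto)
  also have "\<dots> = (C + 4 ^ k) * (2 ^ i) ^ (k + 1) * w"
    by (simp add: power_mult[symmetric] mult_ac power_add)
  also have "\<dots> \<le> (C + 4 ^ k) * ((2 * Y) ^ k) ^ (k + 1) * w"
  proof (intro mult_right_mono mult_left_mono power_mono)
    have "2 ^ i \<le> (b ^ k) ^ i" using bk by (intro power_mono) auto
    also have "\<dots> = (b ^ i) ^ k" by (simp add: power_mult[symmetric] mult.commute)
    also have "\<dots> \<le> (2 * Y) ^ k" using bi b by (intro power_mono) auto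
    finally show "(2::real) ^ i \<le> (2 * Y) ^ k" .
  qed (use C w in auto)
  finally show ?thesis by (simp only: Y_def power_mult[symmetric])
qed

text \<open>\<open>whitney_unit\<close>, rescaled, gives \<open>q\<close> on a short interval near
  \<open>x0\<close>. Since g - q has the same k-th differences as \<open>g\<close>,
  \<open>radial_growth\<close> then spreads the estimate over all of [-1,1] with constants
  independent of \<open>x0\<close> and \<open>h\<close>.\<close>

lemma whitney:
  assumes k: "k \<ge> 1"
  shows "\<exists>C\<ge>0. \<forall>g x0 h. continuous_on {-1..1} g \<and> x0 \<in> {-1..1} \<and> 0 < h \<and> h \<le> 1 \<longrightarrow>
    (\<exists>q. degree q < k \<and> (\<forall>x\<in>{-1..1}.
       \<bar>g x - poly q x\<bar> \<le> C * (1 + \<bar>x - x0\<bar> / h) ^ (k * (k + 1)) * omega k g h))"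
proof -
  from whitney_unit[OF k] obtain C0 where C0: "C0 \<ge> 0" and unit: "\<forall>g W. continuous_on UNIV g \<and>
    (\<forall>h x. 0 \<le> h \<and> h \<le> 1 \<and> 0 \<le> x \<and> x + real k * h \<le> real k ^ 2 + 1 \<longrightarrow> \<bar>fdiff k h g x\<bar> \<le> W) \<longrightarrow>
    (\<exists>q. degree q < k \<and> (\<forall>x\<in>{0..1}. \<bar>g x - poly q x\<bar> \<le> C0 * W))"
    by (elim exE conjE)
  \<comment> \<open>Length of the window in \<open>whitney_unit\<close>; the scale \<tau> = h/m
    below makes this window fit into an interval of length \<open>h\<close>.\<close>
  define m where "m = real k ^ 2 + 1"
  have m: "m \<ge> 1" by (simp add: m_def)
  define C where "C = (C0 + 4 ^ k) * (8 * m) ^ (k * (k + 1))"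
  have C: "C \<ge> 0" using C0 m by (simp add: C_def)
  moreover have "\<exists>q. degree q < k \<and> (\<forall>x\<in>{-1..1}.
       \<bar>g x - poly q x\<bar> \<le> C * (1 + \<bar>x - x0\<bar> / h) ^ (k * (k + 1)) * omega k g h)"
    if g: "continuous_on {-1..1} g" and x0: "x0 \<in> {-1..1}" and h: "0 < h" "h \<le> 1" for g x0 h
  proof -
    define \<tau> where "\<tau> = h / m"
    have \<tau>: "0 < \<tau>" "\<tau> \<le> h" "\<tau> * m = h" using h m by (auto simp: \<tau>_def field_simps)
    \<comment> \<open>The window [a, a + h] starts or ends at \<open>x0\<close>, on the side that
      stays inside [-1,1]; h <= 1 makes this possible.\<close>
    define a where "a = (if x0 \<le> 0 then x0 else x0 - h)"
    have a: "-1 \<le> a" "a + h \<le> 1" using x0 h by (auto simp: a_def)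
    \<comment> \<open>Clamping extends \<open>g\<close> continuously to the line, where
      \<open>whitney_unit\<close> takes its antiderivatives. The differences in question only see
      the window, where nothing has changed.\<close>
    define g' where "g' y = g (max (-1) (min 1 y))" for y
    define u where "u y = g' (a + \<tau> * y)" for y
    define w where "w = omega k g h"
    have w: "0 \<le> w" unfolding w_def using g h by (intro omega_nonneg) auto
    have contu: "continuous_on UNIV u"
      unfolding u_def g'_def
      by (rule continuous_on_compose2[OF g]) (auto intro!: continuous_intros)
    have W: "\<bar>fdiff k s u x\<bar> \<le> w" if s: "0 \<le> s" "s \<le> 1" "0 \<le> x" "x + real k * s \<le> real k ^ 2 + 1" for s x
    proof -
      have "\<tau> * (x + real k * s) \<le> \<tau> * m" using s \<tau> unfolding m_def by (intro mult_left_mono) auto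
      then have r: "-1 \<le> a + \<tau> * x" "a + \<tau> * x + real k * (\<tau> * s) \<le> 1"
        using a s \<tau> by (simp_all add: algebra_simps add_increasing2)
      have "fdiff k s u x = fdiff k (\<tau> * s) g (a + \<tau> * x)"
        unfolding fdiff_def
      proof (intro sum.cong refl)
        fix i assume "i \<in> {..k}"
        then have "a + \<tau> * x + real i * (\<tau> * s) \<in> {-1..1}"
          using node_between[of "\<tau> * s" "-1" "a + \<tau> * x" k 1 i] r s \<tau> by simp
        then have "g' (a + \<tau> * x + real i * (\<tau> * s)) = g (a + \<tau> * x + real i * (\<tau> * s))"
          by (simp add: g'_def)
        then show "(-1) ^ (k - i) * real (k choose i) * u (x + real i * s)
            = (-1) ^ (k - i) * real (k choose i) * g (a + \<tau> * x + real i * (\<tau> * s))"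
          by (simp add: u_def algebra_simps)
      qed
      also have "\<bar>\<dots>\<bar> \<le> w"
        unfolding w_def
      proof (intro fdiff_le_omega g r)
        have "\<tau> * s \<le> \<tau> * 1" using s \<tau> by (intro mult_left_mono) auto
        then show "\<tau> * s \<le> h" unfolding mult_1_right using \<tau>(2) by linarith
      qed (use s \<tau> in auto)
      finally show ?thesis .
    qed
    obtain q1 where q1: "degree q1 < k" "\<And>x. x \<in> {0..1} \<Longrightarrow> \<bar>u x - poly q1 x\<bar> \<le> C0 * w"
      using unit[rule_format, of u w] contu W by blast
    define q where "q = q1 \<circ>\<^sub>p [:- a / \<tau>, 1 / \<tau>:]"
    have q: "degree q < k" unfolding q_def using q1(1) \<tau> by (simp add: degree_pcompose)
    define c where "c = a + \<tau> / 2"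
    define e where "e x = g x - poly q x" for x
    have eb: "\<bar>e x\<bar> \<le> C0 * w" if "x \<in> {-1..1}" "\<bar>x - c\<bar> \<le> \<tau> / 2" for x
    proof -
      have x: "a \<le> x" "x \<le> a + \<tau>" using that(2)[unfolded c_def abs_le_iff] by linarith+
      have "\<bar>u ((x - a) / \<tau>) - poly q1 ((x - a) / \<tau>)\<bar> \<le> C0 * w"
        using x \<tau> by (intro q1) (auto simp: field_simps)
      moreover have "u ((x - a) / \<tau>) = g x" using \<tau> that(1) by (simp add: u_def g'_def)
      moreover have "poly q1 ((x - a) / \<tau>) = poly q x"
        by (simp add: q_def poly_pcompose diff_divide_distrib)
      ultimately show ?thesis by (simp add: e_def)
    qed
    have We: "\<bar>fdiff k s e x\<bar> \<le> (2 * y) ^ k * w"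
      if "0 \<le> s" "-1 \<le> x" "x + real k * s \<le> 1" "1 \<le> y" "s \<le> y * (\<tau> / 2)" for s x y
    proof -
      have "\<bar>fdiff k s e x\<bar> = \<bar>fdiff k s g x\<bar>"
        unfolding e_def fdiff_diff using q by (simp add: fdiff_poly_eq_0)
      also have "\<dots> \<le> omega k g (y * (\<tau> / 2))" using that by (intro fdiff_le_omega g)
      also have "\<dots> \<le> (2 * y) ^ k * omega k g (\<tau> / 2)" using that \<tau> by (intro omega_scale g) auto
      also have "\<dots> \<le> (2 * y) ^ k * w"
        unfolding w_def using that \<tau> by (intro mult_left_mono omega_mono g) auto
      finally show ?thesis .
    qed
    have "\<bar>g x - poly q x\<bar> \<le> C * (1 + \<bar>x - x0\<bar> / h) ^ (k * (k + 1)) * w" if x: "x \<in> {-1..1}" for x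
    proof -
      have "\<bar>e x\<bar> \<le> (C0 + 4 ^ k) * (2 * (1 + \<bar>x - c\<bar> / (\<tau> / 2))) ^ (k * (k + 1)) * w"
        by (rule radial_growth[OF k _ C0 w _ _ eb We x]) (use \<tau> a in \<open>auto simp: c_def\<close>)
      also have "\<dots> \<le> (C0 + 4 ^ k) * (8 * m * (1 + \<bar>x - x0\<bar> / h)) ^ (k * (k + 1)) * w"
      proof (intro mult_right_mono mult_left_mono power_mono)
        have "\<bar>x0 - c\<bar> \<le> h" unfolding c_def a_def using \<tau>(1,2) by (cases "x0 \<le> 0") simp_all
        then have "\<bar>x - c\<bar> \<le> \<bar>x - x0\<bar> + h" by linarith
        then have "\<bar>x - c\<bar> / (\<tau> / 2) \<le> (\<bar>x - x0\<bar> + h) / (\<tau> / 2)" using \<tau> by (intro divide_right_mono) auto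
        also have "\<dots> = 2 * m * (\<bar>x - x0\<bar> / h + 1)" using h m by (simp add: \<tau>_def field_simps)
        finally have "2 * (1 + \<bar>x - c\<bar> / (\<tau> / 2)) \<le> 2 * (1 + 2 * m * (\<bar>x - x0\<bar> / h + 1))"
          by (intro mult_left_mono add_left_mono) auto
        also have "\<dots> = 2 + 4 * m * (1 + \<bar>x - x0\<bar> / h)" by (simp add: algebra_simps)
        also have "2 \<le> 4 * m * (1 + \<bar>x - x0\<bar> / h)"
          using mult_mono[of 1 m 1 "1 + \<bar>x - x0\<bar> / h"] m h by simp
        finally show "2 * (1 + \<bar>x - c\<bar> / (\<tau> / 2)) \<le> 8 * m * (1 + \<bar>x - x0\<bar> / h)" by simp
      qed (use C0 w \<tau> in auto)
      finally show ?thesis unfolding e_def C_def by (simp only: power_mult_distrib mult_ac)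
    qed
    then show ?thesis using q unfolding w_def by blast
  qed
  ultimately show ?thesis by blast
qed

section \<open>Local Hermite interpolation\<close>

lemma higher_pderiv_linear_mult:
  fixes q :: "real poly"
  shows "(pderiv ^^ Suc i) ([:-a, 1:] * q) = [:-a, 1:] * (pderiv ^^ Suc i) q + smult (real (Suc i)) ((pderiv ^^ i) q)"
proof -
  have "pderiv [:-a, 1:] = 1" by (simp add: pderiv_pCons)
  then have D: "pderiv ([:-a, 1:] * u) = [:-a, 1:] * pderiv u + u" for u
    by (simp only: pderiv_mult mult_1_right)
  show ?thesis
  proof (induction i)
    case 0
    show ?case using D[of q] by simp
  next
    case (Suc i)
    have "(pderiv ^^ Suc (Suc i)) ([:-a, 1:] * q)
        = pderiv ([:-a, 1:] * (pderiv ^^ Suc i) q + smult (real (Suc i)) ((pderiv ^^ i) q))"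
      unfolding Suc[symmetric] by simp
    also have "\<dots> = [:-a, 1:] * pderiv ((pderiv ^^ Suc i) q) + (pderiv ^^ Suc i) q + smult (real (Suc i)) ((pderiv ^^ Suc i) q)"
      unfolding pderiv_add pderiv_smult D by simp
    also have "\<dots> = [:-a, 1:] * (pderiv ^^ Suc (Suc i)) q + smult (real (Suc (Suc i))) ((pderiv ^^ Suc i) q)"
      unfolding of_nat_Suc[of "Suc i"] smult_add_left by simp
    finally show ?case .
  qed
qed

lemma poly_higher_pderiv_linear_mult:
  fixes q :: "real poly"
  shows "poly ((pderiv ^^ Suc i) ([:-a, 1:] * q)) a = real (Suc i) * poly ((pderiv ^^ i) q) a"
  unfolding higher_pderiv_linear_mult by simp

text \<open>Turns Hermite conditions into divisibility, so that they pass through sums and products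
  by ring arithmetic.\<close>

lemma linear_power_dvd_iff:
  fixes p :: "real poly"
  shows "[:-a, 1:] ^ r dvd p \<longleftrightarrow> (\<forall>i<r. poly ((pderiv ^^ i) p) a = 0)"
proof (induction r arbitrary: p)
  case (Suc r)
  show ?case
  proof
    assume "[:-a, 1:] ^ Suc r dvd p"
    then obtain q where p: "p = [:-a, 1:] * q" and q: "[:-a, 1:] ^ r dvd q"
      by (metis dvdE dvd_triv_left mult.assoc power_Suc)
    show "\<forall>i<Suc r. poly ((pderiv ^^ i) p) a = 0"
    proof (intro allI impI)
      fix i assume "i < Suc r"
      then show "poly ((pderiv ^^ i) p) a = 0"
        using q unfolding p Suc.IH by (cases i) (simp_all only: poly_higher_pderiv_linear_mult, simp_all)
    qed
  next
    assume A: "\<forall>i<Suc r. poly ((pderiv ^^ i) p) a = 0"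
    then have "poly p a = 0" by force
    then obtain q where p: "p = [:-a, 1:] * q" by (auto simp: poly_eq_0_iff_dvd elim: dvdE)
    have "poly ((pderiv ^^ i) q) a = 0" if "i < r" for i
    proof -
      have "poly ((pderiv ^^ Suc i) p) a = 0" using A that by blast
      then have "real (Suc i) * poly ((pderiv ^^ i) q) a = 0"
        unfolding p poly_higher_pderiv_linear_mult .
      then show ?thesis by simp
    qed
    then have "[:-a, 1:] ^ r dvd q" using Suc.IH by blast
    then show "[:-a, 1:] ^ Suc r dvd p" unfolding p power_Suc by (intro mult_dvd_mono dvd_refl)
  qed
qed simp

lemma higher_pderiv_diff:
  fixes p q :: "real poly"
  shows "(pderiv ^^ i) (p - q) = (pderiv ^^ i) p - (pderiv ^^ i) q"
  by (induction i) (simp_all add: pderiv_diff)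

lemma poly_higher_pderiv_diff_eq_0_iff:
  fixes p q :: "real poly"
  shows "poly ((pderiv ^^ i) (p - q)) a = 0 \<longleftrightarrow> poly ((pderiv ^^ i) p) a = poly ((pderiv ^^ i) q) a"
  by (simp add: higher_pderiv_diff)

lemma higher_pderiv_pcompose_linear:
  fixes p :: "real poly"
  shows "(pderiv ^^ i) (p \<circ>\<^sub>p [:x0, h:]) = smult (h ^ i) ((pderiv ^^ i) p \<circ>\<^sub>p [:x0, h:])"
  by (induction i) (simp_all add: pderiv_smult pderiv_pcompose pderiv_pCons mult.commute)

lemma degree_higher_pderiv_le: "degree ((pderiv ^^ i) p) \<le> degree (p :: real poly)"
  by (induction i) (auto simp: degree_pderiv)

lemma pcompose_power: "(p ^ n) \<circ>\<^sub>p q = (p \<circ>\<^sub>p q) ^ n" for p q :: "real poly"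
  by (induction n) (simp_all add: pcompose_mult pcompose_1)

text \<open>
  The coefficient norm is applied to \<open>p \<circ>\<^sub>p [:x0, h:]\<close>, which makes estimates around \<open>x0\<close> at scale \<open>h\<close>
  multiplicative.
\<close>

definition pnorm :: "real poly \<Rightarrow> real" where
  "pnorm p = (\<Sum>i\<le>degree p. \<bar>coeff p i\<bar>)"

lemma pnorm_eq: "degree p \<le> n \<Longrightarrow> pnorm p = (\<Sum>i\<le>n. \<bar>coeff p i\<bar>)"
  unfolding pnorm_def by (rule sum.mono_neutral_left) (auto simp: coeff_eq_0)

lemma pnorm_nonneg: "0 \<le> pnorm p"
  by (simp add: pnorm_def sum_nonneg)

lemma pnorm_0 [simp]: "pnorm 0 = 0"
  by (simp add: pnorm_def)

lemma pnorm_1 [simp]: "pnorm 1 = 1"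
  by (simp add: pnorm_def)

lemma pnorm_pCons: "pnorm (pCons a p) = \<bar>a\<bar> + pnorm p"
  unfolding pnorm_eq[OF degree_pCons_le] by (simp add: pnorm_def sum.atMost_Suc_shift del: sum.atMost_Suc)

lemma pnorm_add_le: "pnorm (p + q) \<le> pnorm p + pnorm q"
proof -
  define n where "n = max (degree p) (degree q)"
  have "pnorm (p + q) = (\<Sum>i\<le>n. \<bar>coeff p i + coeff q i\<bar>)"
    using pnorm_eq[of "p + q" n] degree_add_le_max[of p q] by (simp add: n_def)
  also have "\<dots> \<le> (\<Sum>i\<le>n. \<bar>coeff p i\<bar> + \<bar>coeff q i\<bar>)" by (intro sum_mono) auto
  also have "\<dots> = pnorm p + pnorm q"
    using pnorm_eq[of p n] pnorm_eq[of q n] by (simp add: n_def sum.distrib)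
  finally show ?thesis .
qed

lemma pnorm_smult: "pnorm (smult c p) = \<bar>c\<bar> * pnorm p"
  using pnorm_eq[of "smult c p" "degree p"] degree_smult_le[of c p]
  by (simp add: pnorm_def abs_mult sum_distrib_left)

lemma pnorm_diff_le: "pnorm (p - q) \<le> pnorm p + pnorm q"
  using pnorm_add_le[of p "- q"] pnorm_smult[of "-1" q] by simp

lemma pnorm_mult_le: "pnorm (p * q) \<le> pnorm p * pnorm q"
proof (induction p)
  case (pCons a p)
  have "pnorm (pCons a p * q) \<le> pnorm (smult a q) + pnorm (pCons 0 (p * q))"
    unfolding mult_pCons_left by (rule pnorm_add_le)
  also have "\<dots> \<le> \<bar>a\<bar> * pnorm q + pnorm p * pnorm q"
    using pCons.IH by (simp add: pnorm_smult pnorm_pCons)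
  finally show ?case by (simp add: pnorm_pCons algebra_simps)
qed simp

lemma pnorm_power_le: "pnorm (p ^ n) \<le> pnorm p ^ n"
  by (induction n) (auto intro: order.trans[OF pnorm_mult_le] mult_left_mono pnorm_nonneg)

lemma pnorm_sum_le: "pnorm (\<Sum>i\<in>I. p i) \<le> (\<Sum>i\<in>I. pnorm (p i))"
  by (induction I rule: infinite_finite_induct) (auto intro: order.trans[OF pnorm_add_le])

lemma pnorm_prod_le: "pnorm (\<Prod>i\<in>I. p i) \<le> (\<Prod>i\<in>I. pnorm (p i))"
  by (induction I rule: infinite_finite_induct)
    (auto intro!: order.trans[OF pnorm_mult_le] mult_left_mono pnorm_nonneg)

lemma pnorm_pderiv_le: "pnorm (pderiv p) \<le> real (degree p) * pnorm p"
proof (cases "degree p")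
  case 0
  then show ?thesis by (simp add: pderiv_eq_0_iff[THEN iffD2])
next
  case (Suc d)
  have "pnorm (pderiv p) = (\<Sum>i\<le>d. real (Suc i) * \<bar>coeff p (Suc i)\<bar>)"
    using pnorm_eq[of "pderiv p" d] Suc by (simp add: degree_pderiv coeff_pderiv abs_mult)
  also have "\<dots> \<le> (\<Sum>i\<le>d. real (Suc d) * \<bar>coeff p (Suc i)\<bar>)"
    by (intro sum_mono mult_right_mono) auto
  also have "\<dots> \<le> real (degree p) * pnorm p"
    by (simp add: pnorm_def Suc sum.atMost_Suc_shift sum_distrib_left[symmetric] del: sum.atMost_Suc of_nat_Suc)
  finally show ?thesis .
qed

lemma pnorm_higher_pderiv_le:
  assumes "degree p \<le> n"
  shows "pnorm ((pderiv ^^ i) p) \<le> real n ^ i * pnorm p"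
proof (induction i)
  case (Suc i)
  have "pnorm ((pderiv ^^ Suc i) p) \<le> real (degree ((pderiv ^^ i) p)) * pnorm ((pderiv ^^ i) p)"
    using pnorm_pderiv_le by simp
  also have "\<dots> \<le> real n * (real n ^ i * pnorm p)"
    using assms degree_higher_pderiv_le[of i p] Suc by (intro mult_mono pnorm_nonneg) auto
  finally show ?case by (simp add: mult_ac)
qed simp

lemma abs_poly_le_pnorm:
  assumes "degree p \<le> n"
  shows "\<bar>poly p y\<bar> \<le> pnorm p * (1 + \<bar>y\<bar>) ^ n"
proof -
  have "\<bar>poly p y\<bar> \<le> (\<Sum>i\<le>degree p. \<bar>coeff p i\<bar> * (1 + \<bar>y\<bar>) ^ n)"
    unfolding poly_altdef
  proof (intro order.trans[OF sum_abs] sum_mono)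
    fix i assume "i \<in> {..degree p}"
    then have "\<bar>y\<bar> ^ i \<le> (1 + \<bar>y\<bar>) ^ n"
      using assms by (intro order.trans[OF power_mono[of "\<bar>y\<bar>" "1 + \<bar>y\<bar>"]] power_increasing) auto
    then show "\<bar>coeff p i * y ^ i\<bar> \<le> \<bar>coeff p i\<bar> * (1 + \<bar>y\<bar>) ^ n"
      by (simp add: abs_mult power_abs mult_left_mono)
  qed
  then show ?thesis by (simp add: pnorm_def sum_distrib_right)
qed

text \<open>Recursion F = b 0 + (X - a) * E: by Leibniz the derivative of order i + 1 of F at
  \<open>a\<close> is (i + 1) times that of order i of E. \<open>H\<close> dominates the coefficient
  norm of X - a around \<open>x0\<close> at scale \<open>h\<close>, so each step trades one factor
  \<open>H\<close> in the data for one in the norm.\<close>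

lemma poly_derivs_at_bounded:
  assumes "0 < H" "0 \<le> h" "\<bar>a - x0\<bar> + h \<le> H" "\<And>i. i < r \<Longrightarrow> \<bar>b i\<bar> * H ^ i \<le> X" "0 \<le> X"
  shows "\<exists>E. degree E \<le> r \<and> (\<forall>i<r. poly ((pderiv ^^ i) E) a = b i) \<and> pnorm (E \<circ>\<^sub>p [:x0, h:]) \<le> real r * X"
  using assms(4,5)
proof (induction r arbitrary: b X)
  case 0
  show ?case by (intro exI[of _ 0]) simp
next
  case (Suc r)
  have "\<bar>b (Suc i) / real (Suc i)\<bar> * H ^ i \<le> X / H" if "i < r" for i
  proof -
    have "\<bar>b (Suc i) / real (Suc i)\<bar> * H ^ i \<le> \<bar>b (Suc i)\<bar> * H ^ i"
      using assms(1) by (intro mult_right_mono) (auto simp: abs_div field_simps mult_le_cancel_left1)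
    also have "\<dots> \<le> X / H" using Suc.prems(1)[of "Suc i"] that assms(1) by (simp add: field_simps)
    finally show ?thesis .
  qed
  then obtain E where E: "degree E \<le> r" "\<forall>i<r. poly ((pderiv ^^ i) E) a = b (Suc i) / real (Suc i)"
    "pnorm (E \<circ>\<^sub>p [:x0, h:]) \<le> real r * (X / H)"
    using Suc.IH[of "\<lambda>i. b (Suc i) / real (Suc i)" "X / H"] Suc.prems(2) assms(1) by auto
  define F where "F = [:b 0:] + [:-a, 1:] * E"
  have "degree F \<le> Suc r"
    unfolding F_def using E(1) by (intro degree_add_le order.trans[OF degree_mult_le]) auto
  moreover have "poly ((pderiv ^^ i) F) a = b i" if "i < Suc r" for i
  proof (cases i)
    case 0
    then show ?thesis by (simp add: F_def)
  next
    case (Suc l)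
    have "(pderiv ^^ Suc l) [:b 0:] = 0"
      unfolding funpow_Suc_right by (simp add: pderiv_pCons)
    then have "poly ((pderiv ^^ Suc l) F) a = real (Suc l) * poly ((pderiv ^^ l) E) a"
      unfolding F_def higher_pderiv_add poly_add poly_higher_pderiv_linear_mult by simp
    then show ?thesis using E(2) that Suc by simp
  qed
  moreover have "pnorm (F \<circ>\<^sub>p [:x0, h:]) \<le> real (Suc r) * X"
  proof -
    have "F \<circ>\<^sub>p [:x0, h:] = [:b 0:] + [:x0 - a, h:] * (E \<circ>\<^sub>p [:x0, h:])"
      unfolding F_def pcompose_add pcompose_mult by (simp add: pcompose_pCons)
    then have "pnorm (F \<circ>\<^sub>p [:x0, h:]) \<le> \<bar>b 0\<bar> + (\<bar>x0 - a\<bar> + h) * pnorm (E \<circ>\<^sub>p [:x0, h:])"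
      using pnorm_add_le[of "[:b 0:]" "[:x0 - a, h:] * (E \<circ>\<^sub>p [:x0, h:])"]
        pnorm_mult_le[of "[:x0 - a, h:]" "E \<circ>\<^sub>p [:x0, h:]"] assms(2)
      by (simp add: pnorm_pCons)
    also have "\<dots> \<le> X + H * (real r * (X / H))"
      using Suc.prems(1)[of 0] assms E(3)
      by (intro add_mono mult_mono pnorm_nonneg) (auto simp: abs_minus_commute)
    finally show ?thesis using assms(1) by (simp add: algebra_simps)
  qed
  ultimately show ?case by blast
qed

text \<open>\<open>C\<close> and \<open>G\<close> depend only on \<open>r\<close>, \<open>P\<close>,
  \<open>K\<close>, although the gaps of \<open>B\<close> may be arbitrary multiples of
  \<open>h\<close>. Each \<alpha> other than \<open>x0\<close> contributes E * s, where E carries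
  the data and \<open>s\<close> is a cut-off that agrees with 1 at \<alpha> and with 0 at the other
  points, to order \<open>r\<close>. Put \<delta> = \<bar>\<alpha> - x0\<bar> / h >= 1. The data
  costs \<delta>^K and the factors for the other points cost at most (3*\<delta>)^a; both are repaid
  by a power of the linear factor vanishing at \<open>x0\<close>, whose norm after normalization at
  \<alpha> is 1/\<delta>.\<close>

lemma hermite_correction:
  fixes r P K :: nat
  shows "\<exists>C\<ge>0. \<exists>G. \<forall>B x0 h X b. finite B \<and> card B \<le> P \<and> x0 \<in> B \<and> 0 < h \<and> 0 \<le> X \<and>
    (\<forall>\<alpha>\<in>B. \<forall>\<beta>\<in>B. \<alpha> \<noteq> \<beta> \<longrightarrow> h \<le> \<bar>\<alpha> - \<beta>\<bar>) \<and>
    (\<forall>\<alpha>\<in>B - {x0}. \<forall>i<r. \<bar>b \<alpha> i\<bar> * (2 * \<bar>\<alpha> - x0\<bar>) ^ i \<le> X * (\<bar>\<alpha> - x0\<bar> / h) ^ K) \<longrightarrow>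
    (\<exists>R. degree R \<le> G \<and> (\<forall>\<alpha>\<in>B - {x0}. \<forall>i<r. poly ((pderiv ^^ i) R) \<alpha> = b \<alpha> i) \<and>
       (\<forall>i<r. poly ((pderiv ^^ i) R) x0 = 0) \<and> pnorm (R \<circ>\<^sub>p [:x0, h:]) \<le> C * X)"
proof -
  define a where "a = P * r"
  \<comment> \<open>\<open>a\<close> pays for the factors at the other points, \<open>K\<close> for
    the growth of the data, and \<open>r\<close> secures the zero of order \<open>r\<close> at
    \<open>x0\<close>.\<close>
  define M where "M = a + K + r"
  define c1 where "c1 = (3::real) ^ a"
  define c2 where "c2 = (\<Sum>l<r. (1 + c1) ^ l)"
  define C where "C = real P * (real r * c1 * c2)"
  define G where "G = r + ((a + M) + r * (a + M))"
  have c: "1 \<le> c1" "0 \<le> c2" unfolding c1_def c2_def by (auto intro!: sum_nonneg)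
  have main: "\<exists>R. degree R \<le> G \<and> (\<forall>\<alpha>\<in>B - {x0}. \<forall>i<r. poly ((pderiv ^^ i) R) \<alpha> = b \<alpha> i) \<and>
       (\<forall>i<r. poly ((pderiv ^^ i) R) x0 = 0) \<and> pnorm (R \<circ>\<^sub>p [:x0, h:]) \<le> C * X"
    if B: "finite B" "card B \<le> P" "x0 \<in> B" and h: "0 < h" and X: "0 \<le> X"
      and sep: "\<And>\<alpha> \<beta>. \<alpha> \<in> B \<Longrightarrow> \<beta> \<in> B \<Longrightarrow> \<alpha> \<noteq> \<beta> \<Longrightarrow> h \<le> \<bar>\<alpha> - \<beta>\<bar>"
      and b: "\<And>\<alpha> i. \<alpha> \<in> B - {x0} \<Longrightarrow> i < r \<Longrightarrow> \<bar>b \<alpha> i\<bar> * (2 * \<bar>\<alpha> - x0\<bar>) ^ i \<le> X * (\<bar>\<alpha> - x0\<bar> / h) ^ K"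
    for B x0 h X b
  proof -
    define fund where "fund \<alpha> R \<longleftrightarrow> degree R \<le> G \<and> [:-x0, 1:] ^ r dvd R \<and> (\<forall>\<beta>\<in>B - {x0, \<alpha>}. [:-\<beta>, 1:] ^ r dvd R) \<and>
      (\<forall>i<r. poly ((pderiv ^^ i) R) \<alpha> = b \<alpha> i) \<and> pnorm (R \<circ>\<^sub>p [:x0, h:]) \<le> real r * c1 * c2 * X" for \<alpha> R
    have "\<forall>\<alpha>\<in>B - {x0}. \<exists>R. fund \<alpha> R"
    proof
      fix \<alpha> assume \<alpha>: "\<alpha> \<in> B - {x0}"
      define \<delta> where "\<delta> = \<bar>\<alpha> - x0\<bar> / h"
      have D: "h \<le> \<bar>\<alpha> - x0\<bar>" using sep[of \<alpha> x0] \<alpha> B by auto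
      have \<delta>: "1 \<le> \<delta>" using D h by (simp add: \<delta>_def)
      obtain E where E: "degree E \<le> r" "\<And>i. i < r \<Longrightarrow> poly ((pderiv ^^ i) E) \<alpha> = b \<alpha> i"
        "pnorm (E \<circ>\<^sub>p [:x0, h:]) \<le> real r * (X * \<delta> ^ K)"
      proof -
        have "\<exists>E. degree E \<le> r \<and> (\<forall>i<r. poly ((pderiv ^^ i) E) \<alpha> = b \<alpha> i) \<and>
            pnorm (E \<circ>\<^sub>p [:x0, h:]) \<le> real r * (X * \<delta> ^ K)"
        proof (rule poly_derivs_at_bounded[where H = "2 * \<bar>\<alpha> - x0\<bar>"])
          show "\<bar>b \<alpha> i\<bar> * (2 * \<bar>\<alpha> - x0\<bar>) ^ i \<le> X * \<delta> ^ K" if "i < r" for i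
            unfolding \<delta>_def using b[OF \<alpha> that] .
        qed (use D h X \<delta> in simp_all)
        then show ?thesis using that by blast
      qed
      \<comment> \<open>Normalized to be 1 at \<alpha>; hence 1 - w vanishes at \<alpha>, and its
        r-th power vanishes there to order \<open>r\<close>.\<close>
      define u where "u \<beta> = smult (1 / (\<alpha> - \<beta>)) [:-\<beta>, 1:]" for \<beta>
      define w where "w = (\<Prod>\<beta>\<in>B - {x0, \<alpha>}. u \<beta> ^ r) * u x0 ^ M"
      have cardB: "card (B - {x0, \<alpha>}) * r \<le> a"
      proof -
        have "card (B - {x0, \<alpha>}) \<le> P" using card_mono[OF B(1), of "B - {x0, \<alpha>}"] B(2) by auto
        then show ?thesis unfolding a_def by (rule mult_right_mono) simp
      qed
      have u_comp: "pnorm (u \<beta> \<circ>\<^sub>p [:x0, h:]) = (\<bar>x0 - \<beta>\<bar> + h) / \<bar>\<alpha> - \<beta>\<bar>" for \<beta>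
      proof -
        have e: "[:-\<beta>, 1:] \<circ>\<^sub>p [:x0, h:] = [:x0 - \<beta>, h:]" by (simp add: pcompose_pCons)
        have n: "pnorm [:x0 - \<beta>, h:] = \<bar>x0 - \<beta>\<bar> + h" using h by (simp add: pnorm_pCons)
        show ?thesis unfolding u_def pcompose_smult pnorm_smult e n by (simp only: abs_divide abs_one times_divide_eq_left mult_1)
      qed
      have u3: "pnorm (u \<beta> \<circ>\<^sub>p [:x0, h:]) \<le> 3 * \<delta>" if "\<beta> \<in> B - {x0, \<alpha>}" for \<beta>
      proof -
        have s: "h \<le> \<bar>\<alpha> - \<beta>\<bar>" using sep[of \<alpha> \<beta>] that \<alpha> by auto
        have "(\<bar>x0 - \<beta>\<bar> + h) / \<bar>\<alpha> - \<beta>\<bar> \<le> (\<bar>\<alpha> - x0\<bar> + 2 * \<bar>\<alpha> - \<beta>\<bar>) / \<bar>\<alpha> - \<beta>\<bar>"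
          using s abs_triangle_ineq[of "x0 - \<alpha>" "\<alpha> - \<beta>"]
          by (intro divide_right_mono) (simp_all add: abs_minus_commute)
        also have "\<dots> = \<bar>\<alpha> - x0\<bar> / \<bar>\<alpha> - \<beta>\<bar> + 2" using s h by (simp add: add_divide_distrib)
        also have "\<bar>\<alpha> - x0\<bar> / \<bar>\<alpha> - \<beta>\<bar> \<le> \<delta>"
          unfolding \<delta>_def using s h by (intro divide_left_mono mult_pos_pos) auto
        finally show ?thesis unfolding u_comp using \<delta> by linarith
      qed
      have ux0: "pnorm (u x0 \<circ>\<^sub>p [:x0, h:]) = 1 / \<delta>"
        unfolding u_comp by (simp add: \<delta>_def)
      have w_bd: "pnorm (w \<circ>\<^sub>p [:x0, h:]) * \<delta> ^ K \<le> c1"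
      proof -
        have "w \<circ>\<^sub>p [:x0, h:] = (\<Prod>\<beta>\<in>B - {x0, \<alpha>}. (u \<beta> \<circ>\<^sub>p [:x0, h:]) ^ r) * (u x0 \<circ>\<^sub>p [:x0, h:]) ^ M"
          unfolding w_def pcompose_mult pcompose_prod pcompose_power ..
        also have "pnorm \<dots> \<le> pnorm (\<Prod>\<beta>\<in>B - {x0, \<alpha>}. (u \<beta> \<circ>\<^sub>p [:x0, h:]) ^ r) * pnorm ((u x0 \<circ>\<^sub>p [:x0, h:]) ^ M)"
          by (rule pnorm_mult_le)
        also have "\<dots> \<le> (\<Prod>\<beta>\<in>B - {x0, \<alpha>}. (3 * \<delta>) ^ r) * (1 / \<delta>) ^ M"
        proof (intro mult_mono)
          show "pnorm (\<Prod>\<beta>\<in>B - {x0, \<alpha>}. (u \<beta> \<circ>\<^sub>p [:x0, h:]) ^ r) \<le> (\<Prod>\<beta>\<in>B - {x0, \<alpha>}. (3 * \<delta>) ^ r)"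
            by (intro order.trans[OF pnorm_prod_le] prod_mono conjI pnorm_nonneg
                order.trans[OF pnorm_power_le] power_mono u3)
          show "pnorm ((u x0 \<circ>\<^sub>p [:x0, h:]) ^ M) \<le> (1 / \<delta>) ^ M"
            using pnorm_power_le[of "u x0 \<circ>\<^sub>p [:x0, h:]" M] by (simp only: ux0)
        qed (use \<delta> in \<open>auto intro!: pnorm_nonneg prod_nonneg\<close>)
        also have "(\<Prod>\<beta>\<in>B - {x0, \<alpha>}. (3 * \<delta>) ^ r) = (3 * \<delta>) ^ (card (B - {x0, \<alpha>}) * r)"
          by (simp only: prod_constant power_mult[symmetric] mult.commute)
        also have "\<dots> \<le> (3 * \<delta>) ^ a" using cardB \<delta> by (intro power_increasing) auto
        finally have "pnorm (w \<circ>\<^sub>p [:x0, h:]) * \<delta> ^ K \<le> (3 * \<delta>) ^ a * (1 / \<delta>) ^ M * \<delta> ^ K"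
          using \<delta> by (auto intro!: mult_right_mono)
        also have "\<dots> = c1 * (1 / \<delta>) ^ r"
          using \<delta> unfolding M_def c1_def
          by (simp add: power_mult_distrib power_add power_divide)
        also have "\<dots> \<le> c1 * 1" using \<delta> c by (intro mult_left_mono power_le_one) auto
        finally show ?thesis by simp
      qed
      have w_le: "pnorm (w \<circ>\<^sub>p [:x0, h:]) \<le> c1"
      proof -
        have "pnorm (w \<circ>\<^sub>p [:x0, h:]) * 1 \<le> pnorm (w \<circ>\<^sub>p [:x0, h:]) * \<delta> ^ K"
          using \<delta> by (intro mult_left_mono pnorm_nonneg one_le_power) auto
        then show ?thesis using w_bd by simp
      qed
      define s where "s = w * (\<Sum>l<r. (1 - w) ^ l)"
      \<comment> \<open>\<open>s\<close> agrees with \<open>1\<close> at \<open>\<alpha>\<close> to order \<open>r\<close> and inherits the zeros of \<open>w\<close>.\<close>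
      have s_eq: "1 - s = (1 - w) ^ r"
        unfolding s_def using one_diff_power_eq[of "1 - w" r] by simp
      define R where "R = E * s"
      have deg_u: "degree (u \<beta> ^ l) \<le> l" for \<beta> l
      proof -
        have "degree (u \<beta>) \<le> 1" unfolding u_def by (rule order.trans[OF degree_smult_le]) simp
        then have "degree (u \<beta>) * l \<le> 1 * l" by (rule mult_right_mono) simp
        then show ?thesis using degree_power_le[of "u \<beta>" l] by linarith
      qed
      have deg_w: "degree w \<le> a + M"
      proof -
        have "degree (\<Prod>\<beta>\<in>B - {x0, \<alpha>}. u \<beta> ^ r) \<le> (\<Sum>\<beta>\<in>B - {x0, \<alpha>}. r)"
          using B by (intro order.trans[OF degree_prod_sum_le] sum_mono) (auto intro: deg_u)
        then have "degree (\<Prod>\<beta>\<in>B - {x0, \<alpha>}. u \<beta> ^ r) \<le> a" using cardB by simp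
        then show ?thesis unfolding w_def using deg_u[of x0 M]
          by (intro order.trans[OF degree_mult_le]) auto
      qed
      have deg_s: "degree s \<le> (a + M) + r * (a + M)"
        unfolding s_def
      proof (intro order.trans[OF degree_mult_le] add_mono deg_w degree_sum_le)
        fix l assume "l \<in> {..<r}"
        have "degree (1 - w) \<le> a + M" using deg_w by (intro degree_diff_le) auto
        then have "degree ((1 - w) ^ l) \<le> (a + M) * l"
          using degree_power_le[of "1 - w" l] by (meson le_trans mult_le_mono1)
        also have "\<dots> \<le> (a + M) * r" using \<open>l \<in> {..<r}\<close> by simp
        finally show "degree ((1 - w) ^ l) \<le> r * (a + M)" by (simp add: mult.commute)
      qed simp
      have "degree R \<le> G"
        unfolding R_def G_def by (intro order.trans[OF degree_mult_le] add_mono E deg_s)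
      moreover have "[:-x0, 1:] ^ r dvd R"
      proof -
        have "[:-x0, 1:] ^ r dvd u x0 ^ M"
          unfolding u_def smult_power by (intro dvd_smult le_imp_power_dvd) (simp add: M_def)
        then show ?thesis by (simp add: R_def s_def w_def)
      qed
      moreover have "[:-\<beta>, 1:] ^ r dvd R" if "\<beta> \<in> B - {x0, \<alpha>}" for \<beta>
      proof -
        have "[:-\<beta>, 1:] ^ r dvd u \<beta> ^ r"
          unfolding u_def smult_power by (intro dvd_smult dvd_refl)
        also have "\<dots> dvd (\<Prod>\<beta>\<in>B - {x0, \<alpha>}. u \<beta> ^ r)" using that B by (intro dvd_prodI) auto
        finally show ?thesis by (simp add: R_def s_def w_def)
      qed
      moreover have "poly ((pderiv ^^ i) R) \<alpha> = b \<alpha> i" if "i < r" for i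
      proof -
        have u1: "poly (u \<beta>) \<alpha> = 1" if "\<alpha> \<noteq> \<beta>" for \<beta>
        proof -
          have "poly [:-\<beta>, 1:] \<alpha> = \<alpha> - \<beta>" by simp
          then show ?thesis unfolding u_def poly_smult using that by simp
        qed
        have "(\<Prod>\<beta>\<in>B - {x0, \<alpha>}. poly (u \<beta>) \<alpha> ^ r) = 1" by (rule prod.neutral) (auto simp: u1)
        then have "poly w \<alpha> = 1" using \<alpha> by (simp add: w_def poly_prod u1)
        then have "[:-\<alpha>, 1:] dvd 1 - w" by (simp add: poly_eq_0_iff_dvd[symmetric])
        then have "[:-\<alpha>, 1:] ^ r dvd E * (1 - s)" unfolding s_eq by (intro dvd_mult dvd_power_same)
        then have "[:-\<alpha>, 1:] ^ r dvd E - R" by (simp add: R_def algebra_simps)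
        then have "poly ((pderiv ^^ i) (E - R)) \<alpha> = 0" using that by (simp add: linear_power_dvd_iff)
        then show ?thesis using E(2)[OF that] by (simp add: poly_higher_pderiv_diff_eq_0_iff)
      qed
      moreover have "pnorm (R \<circ>\<^sub>p [:x0, h:]) \<le> real r * c1 * c2 * X"
      proof -
        define W where "W = w \<circ>\<^sub>p [:x0, h:]"
        have S: "pnorm (\<Sum>l<r. (1 - W) ^ l) \<le> c2"
          unfolding c2_def
        proof (intro order.trans[OF pnorm_sum_le] sum_mono order.trans[OF pnorm_power_le] power_mono pnorm_nonneg)
          show "pnorm (1 - W) \<le> 1 + c1" using pnorm_diff_le[of 1 W] w_le by (simp add: W_def)
        qed
        have "R \<circ>\<^sub>p [:x0, h:] = (E \<circ>\<^sub>p [:x0, h:]) * (W * (\<Sum>l<r. (1 - W) ^ l))"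
          by (simp add: R_def s_def W_def pcompose_mult pcompose_sum pcompose_power pcompose_diff pcompose_1)
        also have "pnorm \<dots> \<le> pnorm (E \<circ>\<^sub>p [:x0, h:]) * (pnorm W * pnorm (\<Sum>l<r. (1 - W) ^ l))"
          by (intro order.trans[OF pnorm_mult_le] mult_left_mono pnorm_mult_le pnorm_nonneg)
        also have "\<dots> \<le> (real r * (X * \<delta> ^ K)) * (pnorm W * c2)"
          using E(3) S X \<delta> by (intro mult_mono pnorm_nonneg mult_nonneg_nonneg order.refl) auto
        also have "\<dots> = real r * X * c2 * (pnorm W * \<delta> ^ K)" by (simp add: mult_ac)
        also have "\<dots> \<le> real r * X * c2 * c1"
          using w_bd X c unfolding W_def by (intro mult_left_mono) auto
        finally show ?thesis by (simp add: mult_ac)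
      qed
      ultimately show "\<exists>R. fund \<alpha> R" unfolding fund_def by blast
    qed
    from bchoice[OF this] obtain R where R0: "\<forall>\<alpha>\<in>B - {x0}. fund \<alpha> (R \<alpha>)" ..
    have R: "degree (R \<alpha>) \<le> G" "[:-x0, 1:] ^ r dvd R \<alpha>" "pnorm (R \<alpha> \<circ>\<^sub>p [:x0, h:]) \<le> real r * c1 * c2 * X"
      "\<And>\<beta>. \<beta> \<in> B - {x0, \<alpha>} \<Longrightarrow> [:-\<beta>, 1:] ^ r dvd R \<alpha>" "\<And>i. i < r \<Longrightarrow> poly ((pderiv ^^ i) (R \<alpha>)) \<alpha> = b \<alpha> i"
      if "\<alpha> \<in> B - {x0}" for \<alpha>
      using bspec[OF R0 that] unfolding fund_def by blast+
    define S where "S = (\<Sum>\<alpha>\<in>B - {x0}. R \<alpha>)"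
    have "degree S \<le> G" unfolding S_def using B R(1) by (intro degree_sum_le) auto
    moreover have "poly ((pderiv ^^ i) S) \<alpha> = b \<alpha> i" if "\<alpha> \<in> B - {x0}" "i < r" for \<alpha> i
    proof -
      have "poly ((pderiv ^^ i) S) \<alpha> = (\<Sum>\<beta>\<in>B - {x0}. poly ((pderiv ^^ i) (R \<beta>)) \<alpha>)"
        by (simp add: S_def higher_pderiv_sum poly_sum)
      also have "\<dots> = (\<Sum>\<beta>\<in>B - {x0}. if \<beta> = \<alpha> then b \<alpha> i else 0)"
      proof (rule sum.cong)
        fix \<beta> assume "\<beta> \<in> B - {x0}"
        then show "poly ((pderiv ^^ i) (R \<beta>)) \<alpha> = (if \<beta> = \<alpha> then b \<alpha> i else 0)"
          using R(4)[of \<beta> \<alpha>] R(5)[of \<beta> i] that by (auto simp: linear_power_dvd_iff)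
      qed simp
      also have "\<dots> = b \<alpha> i" using B that by simp
      finally show ?thesis .
    qed
    moreover have "poly ((pderiv ^^ i) S) x0 = 0" if "i < r" for i
      using R(2) that by (simp add: S_def higher_pderiv_sum poly_sum linear_power_dvd_iff)
    moreover have "pnorm (S \<circ>\<^sub>p [:x0, h:]) \<le> C * X"
    proof -
      have "pnorm (S \<circ>\<^sub>p [:x0, h:]) \<le> (\<Sum>\<alpha>\<in>B - {x0}. real r * c1 * c2 * X)"
        unfolding S_def pcompose_sum by (intro order.trans[OF pnorm_sum_le] sum_mono R(3))
      also have "\<dots> \<le> real P * (real r * c1 * c2 * X)"
        unfolding sum_constant
      proof (rule mult_right_mono)
        show "real (card (B - {x0})) \<le> real P" using card_mono[OF B(1), of "B - {x0}"] B(2) by auto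
      qed (use c X in simp)
      finally show ?thesis by (simp add: C_def mult_ac)
    qed
    ultimately show ?thesis by blast
  qed
  have "0 \<le> C" unfolding C_def using c by simp
  show ?thesis
  proof (intro exI[of _ C] conjI exI[of _ G] allI impI \<open>0 \<le> C\<close>)
    fix B :: "real set" and x0 h X :: real and b :: "real \<Rightarrow> nat \<Rightarrow> real"
    assume "finite B \<and> card B \<le> P \<and> x0 \<in> B \<and> 0 < h \<and> 0 \<le> X \<and>
      (\<forall>\<alpha>\<in>B. \<forall>\<beta>\<in>B. \<alpha> \<noteq> \<beta> \<longrightarrow> h \<le> \<bar>\<alpha> - \<beta>\<bar>) \<and>
      (\<forall>\<alpha>\<in>B - {x0}. \<forall>i<r. \<bar>b \<alpha> i\<bar> * (2 * \<bar>\<alpha> - x0\<bar>) ^ i \<le> X * (\<bar>\<alpha> - x0\<bar> / h) ^ K)"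
    then show "\<exists>R. degree R \<le> G \<and> (\<forall>\<alpha>\<in>B - {x0}. \<forall>i<r. poly ((pderiv ^^ i) R) \<alpha> = b \<alpha> i) \<and>
      (\<forall>i<r. poly ((pderiv ^^ i) R) x0 = 0) \<and> pnorm (R \<circ>\<^sub>p [:x0, h:]) \<le> C * X"
      by (elim conjE, intro main) blast+
  qed
qed

text \<open>The Whitney polynomial of \<open>D r\<close> at scale \<open>h\<close>, integrated from
  \<open>x0\<close>, has contact of order \<open>r\<close> with \<open>f\<close> at
  \<open>x0\<close>. Its defects at the other points of \<open>B\<close> grow at most like a fixed
  power of distance/scale, which is what \<open>hermite_correction\<close> tolerates, and their
  removal leaves \<open>x0\<close> undisturbed. The final error can then be expanded at any point of
  \<open>B\<close>.\<close>

lemma local_hermite: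
  fixes k r P :: nat
  assumes k: "k \<ge> 1"
  shows "\<exists>C\<ge>0. \<exists>G K. \<forall>f D B x0 h. Cr_derivs r f D \<and> finite B \<and> card B \<le> P \<and> B \<subseteq> {-1..1} \<and> x0 \<in> B \<and>
    0 < h \<and> h \<le> 1 \<and> (\<forall>\<alpha>\<in>B. \<forall>\<beta>\<in>B. \<alpha> \<noteq> \<beta> \<longrightarrow> h \<le> \<bar>\<alpha> - \<beta>\<bar>) \<longrightarrow>
    (\<exists>L. degree L \<le> G \<and> (\<forall>\<alpha>\<in>B. \<forall>i<r. poly ((pderiv ^^ i) L) \<alpha> = D i \<alpha>) \<and>
      (\<forall>x\<in>{-1..1}. \<forall>\<alpha>\<in>B.
        \<bar>f x - poly L x\<bar> \<le> C * omega k (D r) h * min h \<bar>x - \<alpha>\<bar> ^ r * (1 + \<bar>x - x0\<bar> / h) ^ K))"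
proof -
  obtain Cw where Cw: "Cw \<ge> 0" and wh: "\<forall>g x0 h. continuous_on {-1..1} g \<and> x0 \<in> {-1..1} \<and> 0 < h \<and> h \<le> 1 \<longrightarrow>
    (\<exists>q. degree q < k \<and> (\<forall>x\<in>{-1..1}.
       \<bar>g x - poly q x\<bar> \<le> Cw * (1 + \<bar>x - x0\<bar> / h) ^ (k * (k + 1)) * omega k g h))"
    using whitney[OF k] by (elim exE conjE)
  define K0 where "K0 = k * (k + 1)"
  obtain C1 G1 where C1: "C1 \<ge> 0" and hc: "\<forall>B x0 h X b. finite B \<and> card B \<le> P \<and> x0 \<in> B \<and> 0 < h \<and> 0 \<le> X \<and>
    (\<forall>\<alpha>\<in>B. \<forall>\<beta>\<in>B. \<alpha> \<noteq> \<beta> \<longrightarrow> h \<le> \<bar>\<alpha> - \<beta>\<bar>) \<and>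
    (\<forall>\<alpha>\<in>B - {x0}. \<forall>i<r. \<bar>b \<alpha> i\<bar> * (2 * \<bar>\<alpha> - x0\<bar>) ^ i \<le> X * (\<bar>\<alpha> - x0\<bar> / h) ^ (K0 + r)) \<longrightarrow>
    (\<exists>R. degree R \<le> G1 \<and> (\<forall>\<alpha>\<in>B - {x0}. \<forall>i<r. poly ((pderiv ^^ i) R) \<alpha> = b \<alpha> i) \<and>
       (\<forall>i<r. poly ((pderiv ^^ i) R) x0 = 0) \<and> pnorm (R \<circ>\<^sub>p [:x0, h:]) \<le> C1 * X)"
    using hermite_correction[where r = r and P = P and K = "K0 + r"] by (elim exE conjE)
  \<comment> \<open>\<open>K0\<close> is the growth exponent of Whitney's inequality and
    \<open>G1\<close> the degree bound of the correction; the sum dominates both. \<open>K\<close>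
    below adds \<open>r\<close> for the expansion at \<open>x0\<close>.\<close>
  define K1 where "K1 = K0 + G1"
  define C2 where "C2 = Cw + real G1 ^ r * C1 * (Cw * 2 ^ (K0 + r))"
  define C where "C = C2 * 2 ^ K1"
  define G where "G = max (k + r) G1"
  define K where "K = K1 + r"
  have C2: "0 \<le> C2" unfolding C2_def using Cw C1 by simp
  have C: "0 \<le> C" unfolding C_def using C2 by simp
  have main: "\<exists>L. degree L \<le> G \<and> (\<forall>\<alpha>\<in>B. \<forall>i<r. poly ((pderiv ^^ i) L) \<alpha> = D i \<alpha>) \<and>
      (\<forall>x\<in>{-1..1}. \<forall>\<alpha>\<in>B.
        \<bar>f x - poly L x\<bar> \<le> C * omega k (D r) h * min h \<bar>x - \<alpha>\<bar> ^ r * (1 + \<bar>x - x0\<bar> / h) ^ K)"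
    if f: "Cr_derivs r f D" and B: "finite B" "card B \<le> P" "B \<subseteq> {-1..1}" "x0 \<in> B"
      and h: "0 < h" "h \<le> 1" and sep: "\<forall>\<alpha>\<in>B. \<forall>\<beta>\<in>B. \<alpha> \<noteq> \<beta> \<longrightarrow> h \<le> \<bar>\<alpha> - \<beta>\<bar>" for f D B x0 h
  proof -
    have D0: "D 0 x = f x" if "x \<in> {-1..1}" for x using f that by (simp add: Cr_derivs_def)
    have D': "(D i has_real_derivative D (Suc i) x) (at x within {-1..1})" if "i < r" "x \<in> {-1..1}" for i x
      using f that by (simp add: Cr_derivs_def)
    have cont: "continuous_on {-1..1} (D r)" using f by (simp add: Cr_derivs_def)
    have x0: "x0 \<in> {-1..1}" using B by auto
    define w where "w = omega k (D r) h"
    have w: "0 \<le> w" unfolding w_def using cont h by (intro omega_nonneg) auto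
    define Y where "Y x = 1 + \<bar>x - x0\<bar> / h" for x
    have Y1: "1 \<le> Y x" for x unfolding Y_def using h by simp
    obtain q where q: "degree q < k" "\<And>x. x \<in> {-1..1} \<Longrightarrow> \<bar>D r x - poly q x\<bar> \<le> Cw * Y x ^ K0 * w"
      using wh[rule_format, of "D r" x0 h] cont x0 h unfolding Y_def K0_def w_def by blast
    obtain L0 where L0: "(pderiv ^^ r) L0 = q" "\<And>i. i < r \<Longrightarrow> poly ((pderiv ^^ i) L0) x0 = D i x0"
      "L0 = 0 \<or> degree L0 < k + r"
      using poly_prescribed_derivs[of r q x0 "\<lambda>i. D i x0" k] q(1) by blast
    define e where "e i x = D i x - poly ((pderiv ^^ i) L0) x" for i x
    have e': "(e i has_real_derivative e (Suc i) x) (at x within {-1..1})" if "i < r" "x \<in> {-1..1}" for i x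
      unfolding e_def using D'[OF that] poly_DERIV[of "(pderiv ^^ i) L0" x]
      by (auto intro!: DERIV_diff intro: has_field_derivative_at_within)
    have e_bd: "\<bar>e i x\<bar> \<le> (Cw * Y x ^ K0 * w) * \<bar>x - x0\<bar> ^ (r - i)" if "i \<le> r" "x \<in> {-1..1}" for i x
    proof (rule flat_bound[where S = "{-1..1}" and E = e, OF _ x0 that(2) e' _ _ that(1)])
      fix z assume z: "z \<in> closed_segment x0 x"
      then have z1: "z \<in> {-1..1}" using closed_segment_subset[OF x0 that(2)] by auto
      have zx: "\<bar>z - x0\<bar> \<le> \<bar>x - x0\<bar>" using dist_in_closed_segment[OF z] by (simp add: dist_real_def abs_minus_commute)
      have "\<bar>e r z\<bar> \<le> Cw * Y z ^ K0 * w" unfolding e_def L0(1) using q(2)[OF z1] .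
      also have "\<dots> \<le> Cw * Y x ^ K0 * w"
        using Cw w Y1[of z] h zx
        by (intro mult_right_mono mult_left_mono power_mono) (auto simp: Y_def divide_right_mono)
      finally show "\<bar>e r z\<bar> \<le> Cw * Y x ^ K0 * w" .
    qed (use L0(2) in \<open>auto simp: e_def\<close>)
    define X where "X = Cw * w * 2 ^ (K0 + r) * h ^ r"
    have X: "0 \<le> X" unfolding X_def using Cw w h by simp
    have data: "\<bar>e i \<alpha>\<bar> * (2 * \<bar>\<alpha> - x0\<bar>) ^ i \<le> X * (\<bar>\<alpha> - x0\<bar> / h) ^ (K0 + r)"
      if \<alpha>: "\<alpha> \<in> B - {x0}" and i: "i < r" for \<alpha> i
    proof -
      define \<Delta> where "\<Delta> = \<bar>\<alpha> - x0\<bar>"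
      have \<Delta>: "h \<le> \<Delta>" unfolding \<Delta>_def using sep \<alpha> B by auto
      have Ya: "Y \<alpha> \<le> 2 * (\<Delta> / h)" unfolding Y_def \<Delta>_def[symmetric] using \<Delta> h by (simp add: field_simps)
      have "\<bar>e i \<alpha>\<bar> * (2 * \<Delta>) ^ i \<le> (Cw * Y \<alpha> ^ K0 * w) * \<Delta> ^ (r - i) * (2 * \<Delta>) ^ i"
        using e_bd[of i \<alpha>] i \<alpha> B(3) \<Delta> h unfolding \<Delta>_def by (intro mult_right_mono) auto
      also have "\<dots> \<le> (Cw * (2 * (\<Delta> / h)) ^ K0 * w) * (2 * \<Delta>) ^ (r - i) * (2 * \<Delta>) ^ i"
        using Cw w Y1[of \<alpha>] Ya \<Delta> h by (intro mult_right_mono mult_mono mult_left_mono power_mono) auto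
      also have "\<dots> = (Cw * (2 * (\<Delta> / h)) ^ K0 * w) * (2 * \<Delta>) ^ r"
      proof -
        have "(2 * \<Delta>) ^ (r - i) * (2 * \<Delta>) ^ i = (2 * \<Delta>) ^ (r - i + i)" by (rule power_add[symmetric])
        also have "r - i + i = r" using i by simp
        finally have "(2 * \<Delta>) ^ (r - i) * (2 * \<Delta>) ^ i = (2 * \<Delta>) ^ r" .
        then show ?thesis by (simp only: mult.assoc)
      qed
      also have "(2 * \<Delta>) ^ r = (2 * (\<Delta> / h)) ^ r * h ^ r"
        using h by (simp add: power_mult_distrib power_divide)
      also have "(Cw * (2 * (\<Delta> / h)) ^ K0 * w) * ((2 * (\<Delta> / h)) ^ r * h ^ r) = X * (\<Delta> / h) ^ (K0 + r)"
        unfolding X_def power_mult_distrib power_add by (simp only: mult_ac)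
      finally show ?thesis unfolding \<Delta>_def .
    qed
    obtain R where R: "degree R \<le> G1" "\<And>\<alpha> i. \<alpha> \<in> B - {x0} \<Longrightarrow> i < r \<Longrightarrow> poly ((pderiv ^^ i) R) \<alpha> = e i \<alpha>"
      "\<And>i. i < r \<Longrightarrow> poly ((pderiv ^^ i) R) x0 = 0" "pnorm (R \<circ>\<^sub>p [:x0, h:]) \<le> C1 * X"
      using hc[rule_format, of B x0 h X "\<lambda>\<alpha> i. e i \<alpha>"] B h X sep data by blast
    define L where "L = L0 + R"
    have degL: "degree L \<le> G"
      unfolding L_def G_def using L0(3) R(1) by (intro degree_add_le) auto
    have interp: "poly ((pderiv ^^ i) L) \<alpha> = D i \<alpha>" if "\<alpha> \<in> B" "i < r" for \<alpha> i
      using that R(2)[of \<alpha> i] R(3)[of i] L0(2)[of i]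
      by (cases "\<alpha> = x0") (simp_all add: L_def higher_pderiv_add e_def)
    define E where "E i x = D i x - poly ((pderiv ^^ i) L) x" for i x
    have E': "(E i has_real_derivative E (Suc i) x) (at x within {-1..1})" if "i < r" "x \<in> {-1..1}" for i x
      unfolding E_def using D'[OF that] poly_DERIV[of "(pderiv ^^ i) L" x]
      by (auto intro!: DERIV_diff intro: has_field_derivative_at_within)
    have Er: "\<bar>E r z\<bar> \<le> C2 * w * Y z ^ K1" if z: "z \<in> {-1..1}" for z
    proof -
      define y where "y = (z - x0) / h"
      have Yz: "1 + \<bar>y\<bar> = Y z" using h by (simp add: y_def Y_def)
      have "(pderiv ^^ r) (R \<circ>\<^sub>p [:x0, h:]) = smult (h ^ r) ((pderiv ^^ r) R \<circ>\<^sub>p [:x0, h:])"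
        by (rule higher_pderiv_pcompose_linear)
      then have "h ^ r * poly ((pderiv ^^ r) R) z = poly ((pderiv ^^ r) (R \<circ>\<^sub>p [:x0, h:])) y"
        using h by (simp add: poly_pcompose y_def)
      then have "h ^ r * \<bar>poly ((pderiv ^^ r) R) z\<bar> = \<bar>poly ((pderiv ^^ r) (R \<circ>\<^sub>p [:x0, h:])) y\<bar>"
        using h by (metis abs_mult abs_of_pos zero_less_power)
      also have "\<dots> \<le> pnorm ((pderiv ^^ r) (R \<circ>\<^sub>p [:x0, h:])) * (1 + \<bar>y\<bar>) ^ G1"
        using R(1) degree_higher_pderiv_le[of r "R \<circ>\<^sub>p [:x0, h:]"] degree_pcompose_le[of R "[:x0, h:]"] h
        by (intro abs_poly_le_pnorm) auto
      also have "\<dots> \<le> (real G1 ^ r * (C1 * X)) * Y z ^ G1"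
        unfolding Yz
      proof (rule mult_right_mono)
        have "pnorm ((pderiv ^^ r) (R \<circ>\<^sub>p [:x0, h:])) \<le> real G1 ^ r * pnorm (R \<circ>\<^sub>p [:x0, h:])"
          using R(1) degree_pcompose_le[of R "[:x0, h:]"] h by (intro pnorm_higher_pderiv_le) auto
        also have "\<dots> \<le> real G1 ^ r * (C1 * X)" using R(4) by (intro mult_left_mono) auto
        finally show "pnorm ((pderiv ^^ r) (R \<circ>\<^sub>p [:x0, h:])) \<le> real G1 ^ r * (C1 * X)" .
      qed (use Y1[of z] in auto)
      also have "\<dots> = h ^ r * (real G1 ^ r * C1 * (Cw * 2 ^ (K0 + r)) * w * Y z ^ G1)"
        by (simp add: X_def mult_ac)
      finally have "\<bar>poly ((pderiv ^^ r) R) z\<bar> \<le> real G1 ^ r * C1 * (Cw * 2 ^ (K0 + r)) * w * Y z ^ G1"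
        using h by simp
      also have "\<dots> \<le> real G1 ^ r * C1 * (Cw * 2 ^ (K0 + r)) * w * Y z ^ K1"
        unfolding K1_def using Y1[of z] C1 Cw w by (intro mult_left_mono power_increasing) auto
      finally have Rb: "\<bar>poly ((pderiv ^^ r) R) z\<bar> \<le> real G1 ^ r * C1 * (Cw * 2 ^ (K0 + r)) * w * Y z ^ K1" .
      have "Cw * Y z ^ K0 * w \<le> Cw * Y z ^ K1 * w"
        unfolding K1_def using Y1[of z] Cw w by (intro mult_right_mono mult_left_mono power_increasing) auto
      then have "\<bar>D r z - poly q z\<bar> \<le> Cw * w * Y z ^ K1" using q(2)[OF z] by (simp add: mult_ac)
      moreover have "E r z = (D r z - poly q z) - poly ((pderiv ^^ r) R) z"
        by (simp add: E_def L_def higher_pderiv_add L0(1))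
      ultimately have "\<bar>E r z\<bar> \<le> Cw * w * Y z ^ K1 + real G1 ^ r * C1 * (Cw * 2 ^ (K0 + r)) * w * Y z ^ K1"
        using Rb by linarith
      then show ?thesis by (simp add: C2_def algebra_simps)
    qed
    \<comment> \<open>The expansion point is \<alpha>, but the growth is measured from
      \<open>x0\<close>: \<open>M\<close> is a radius about \<open>x0\<close> covering the segment
      from \<alpha> to \<open>x\<close>.\<close>
    have E0: "\<bar>f x - poly L x\<bar> \<le> C2 * w * (1 + M / h) ^ K1 * \<bar>x - \<alpha>\<bar> ^ r"
      if x: "x \<in> {-1..1}" and \<alpha>: "\<alpha> \<in> B" and M: "\<And>z. z \<in> closed_segment \<alpha> x \<Longrightarrow> \<bar>z - x0\<bar> \<le> M" for x \<alpha> M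
    proof -
      have \<alpha>1: "\<alpha> \<in> {-1..1}" using \<alpha> B by auto
      have "\<bar>E 0 x\<bar> \<le> (C2 * w * (1 + M / h) ^ K1) * \<bar>x - \<alpha>\<bar> ^ (r - 0)"
      proof (rule flat_bound[where S = "{-1..1}" and E = E, OF _ \<alpha>1 x E'])
        fix z assume z: "z \<in> closed_segment \<alpha> x"
        then have z1: "z \<in> {-1..1}" using closed_segment_subset[OF \<alpha>1 x] by auto
        have "Y z \<le> 1 + M / h" using M[OF z] h by (simp add: Y_def divide_right_mono)
        then have "C2 * w * Y z ^ K1 \<le> C2 * w * (1 + M / h) ^ K1"
          using C2 w Y1[of z] by (intro mult_left_mono power_mono) auto
        then show "\<bar>E r z\<bar> \<le> C2 * w * (1 + M / h) ^ K1" using Er[OF z1] by linarith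
      qed (use interp[OF \<alpha>] in \<open>auto simp: E_def\<close>)
      then show ?thesis using D0[OF x] by (simp add: E_def)
    qed
    have "\<bar>f x - poly L x\<bar> \<le> C * w * min h \<bar>x - \<alpha>\<bar> ^ r * Y x ^ K" if x: "x \<in> {-1..1}" and \<alpha>: "\<alpha> \<in> B" for x \<alpha>
    proof (cases "\<bar>x - \<alpha>\<bar> \<le> h")
      case True
      have "\<bar>f x - poly L x\<bar> \<le> C2 * w * (1 + (\<bar>x - x0\<bar> + h) / h) ^ K1 * \<bar>x - \<alpha>\<bar> ^ r"
      proof (rule E0[OF x \<alpha>])
        fix z assume "z \<in> closed_segment \<alpha> x"
        then have "\<bar>z - x\<bar> \<le> \<bar>x - \<alpha>\<bar>"
          using dist_in_closed_segment[of z \<alpha> x] by (simp add: dist_real_def abs_minus_commute)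
        then show "\<bar>z - x0\<bar> \<le> \<bar>x - x0\<bar> + h" using True by linarith
      qed
      also have "\<dots> \<le> C2 * w * (2 * Y x) ^ K1 * \<bar>x - \<alpha>\<bar> ^ r"
      proof (intro mult_right_mono mult_left_mono power_mono)
        have "(\<bar>x - x0\<bar> + h) / h = \<bar>x - x0\<bar> / h + 1" using h by (simp add: add_divide_distrib)
        then have eq: "1 + (\<bar>x - x0\<bar> + h) / h = 1 + Y x" by (simp add: Y_def)
        show "1 + (\<bar>x - x0\<bar> + h) / h \<le> 2 * Y x" unfolding eq using Y1[of x] by simp
      qed (use C2 w h in auto)
      also have "\<dots> = C * w * \<bar>x - \<alpha>\<bar> ^ r * Y x ^ K1" by (simp add: C_def power_mult_distrib mult_ac)
      also have "\<dots> \<le> C * w * \<bar>x - \<alpha>\<bar> ^ r * Y x ^ K"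
        unfolding K_def using Y1[of x] C w by (intro mult_left_mono power_increasing) auto
      finally show ?thesis using True by (simp add: min_def)
    next
      \<comment> \<open>Away from \<alpha> the expansion point is \<open>x0\<close> itself, which
        belongs to \<open>B\<close>. The bound \<bar>x - x0\<bar> <= h * Y x produces h^r and
        \<open>r\<close> more powers of the growth factor.\<close>
      case False
      have "\<bar>f x - poly L x\<bar> \<le> C2 * w * (1 + \<bar>x - x0\<bar> / h) ^ K1 * \<bar>x - x0\<bar> ^ r"
      proof (rule E0[OF x B(4)])
        fix z assume "z \<in> closed_segment x0 x"
        then show "\<bar>z - x0\<bar> \<le> \<bar>x - x0\<bar>"
          using dist_in_closed_segment[of z x0 x] by (simp add: dist_real_def abs_minus_commute)
      qed
      also have "\<dots> \<le> C2 * w * Y x ^ K1 * (h * Y x) ^ r"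
        unfolding Y_def[symmetric]
        using C2 w h Y1[of x] by (intro mult_left_mono power_mono) (auto simp: Y_def field_simps)
      also have "\<dots> = C2 * (w * h ^ r * Y x ^ K)" by (simp add: K_def power_mult_distrib power_add mult_ac)
      also have "\<dots> \<le> C * (w * h ^ r * Y x ^ K)"
      proof (rule mult_right_mono)
        show "C2 \<le> C" unfolding C_def using mult_left_mono[of 1 "2 ^ K1" C2] C2 by simp
      qed (use w h Y1[of x] in auto)
      finally show ?thesis using False by (simp add: min_def mult_ac)
    qed
    then show ?thesis using degL interp unfolding Y_def w_def by blast
  qed
  show ?thesis
  proof (rule exI[of _ C], rule conjI[OF C], rule exI[of _ G], rule exI[of _ K], intro allI impI)
    fix f :: "real \<Rightarrow> real" and D :: "nat \<Rightarrow> real \<Rightarrow> real" and B :: "real set" and x0 h :: real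
    assume "Cr_derivs r f D \<and> finite B \<and> card B \<le> P \<and> B \<subseteq> {-1..1} \<and> x0 \<in> B \<and>
      0 < h \<and> h \<le> 1 \<and> (\<forall>\<alpha>\<in>B. \<forall>\<beta>\<in>B. \<alpha> \<noteq> \<beta> \<longrightarrow> h \<le> \<bar>\<alpha> - \<beta>\<bar>)"
    then show "\<exists>L. degree L \<le> G \<and> (\<forall>\<alpha>\<in>B. \<forall>i<r. poly ((pderiv ^^ i) L) \<alpha> = D i \<alpha>) \<and>
      (\<forall>x\<in>{-1..1}. \<forall>\<alpha>\<in>B.
        \<bar>f x - poly L x\<bar> \<le> C * omega k (D r) h * min h \<bar>x - \<alpha>\<bar> ^ r * (1 + \<bar>x - x0\<bar> / h) ^ K)"
      by (elim conjE, intro main) blast+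
  qed
qed

section \<open>Localized polynomial partitions of unity\<close>

lemma chebyshev_poly_exists: "\<exists>T :: real poly. degree T \<le> k \<and> (\<forall>t. poly T (cos t) = cos (real k * t))"
proof (induction k rule: less_induct)
  case (less k)
  show ?case
  proof (cases "k \<le> 1")
    case True
    then consider "k = 0" | "k = 1" by linarith
    then show ?thesis
    proof cases
      case 1
      then show ?thesis by (intro exI[of _ 1]) simp
    next
      case 2
      then show ?thesis by (intro exI[of _ "[:0, 1:]"]) simp
    qed
  next
    case False
    then obtain l where l: "k = Suc (Suc l)" by (metis One_nat_def not_less_eq_eq old.nat.exhaust le0)
    obtain T where T: "degree T \<le> Suc l" "\<And>t. poly T (cos t) = cos (real (Suc l) * t)"
      using less.IH[of "Suc l"] l by auto
    obtain R where R: "degree R \<le> l" "\<And>t. poly R (cos t) = cos (real l * t)"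
      using less.IH[of l] l by auto
    have "degree (smult 2 ([:0, 1:] * T) - R) \<le> k"
      using T(1) R(1) l by (intro degree_diff_le order.trans[OF degree_smult_le] order.trans[OF degree_mult_le]) auto
    moreover have "poly (smult 2 ([:0, 1:] * T) - R) (cos t) = cos (real k * t)" for t
    proof -
      have "cos (real k * t) = cos (real (Suc l) * t + t)" "cos (real l * t) = cos (real (Suc l) * t - t)"
        by (simp_all add: l algebra_simps)
      then have "cos (real k * t) + cos (real l * t) = 2 * cos t * cos (real (Suc l) * t)"
        unfolding cos_add cos_diff by simp
      then show ?thesis using T(2)[of t] R(2)[of t] by simp
    qed
    ultimately show ?thesis by blast
  qed
qed

lemma poly_cos_expansion:
  fixes q :: "real poly"
  shows "\<exists>a. \<forall>u. poly q (cos u) = (\<Sum>k\<le>degree q. a k * cos (real k * u))"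
proof -
  have "degree q \<le> d \<Longrightarrow> \<exists>a. \<forall>u. poly q (cos u) = (\<Sum>k\<le>d. a k * cos (real k * u))" for d
  proof (induction d arbitrary: q)
    case 0
    then obtain c where "q = [:c:]" by (metis degree_eq_zeroE le_zero_eq)
    then show ?case by (intro exI[of _ "\<lambda>_. c"]) simp
  next
    case (Suc d)
    obtain c q' where q: "q = pCons c q'" by (metis pCons_cases)
    then have "degree q' \<le> d" using Suc.prems by (simp split: if_splits)
    then obtain a where a: "\<And>u. poly q' (cos u) = (\<Sum>k\<le>d. a k * cos (real k * u))"
      using Suc.IH by blast
    \<comment> \<open>Multiplication by cos u splits frequency k into halves at k + 1 and k - 1. The
      last term repairs k = 0, where the whole weight goes to frequency 1.\<close>
    define b where "b k = (if k = 0 then c else 0) + (if k = 0 then 0 else a (k - 1) / 2)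
        + (if k + 1 \<le> d then a (k + 1) / 2 else 0) + (if k = 1 then a 0 / 2 else 0)" for k
    have "poly q (cos u) = (\<Sum>k\<le>Suc d. b k * cos (real k * u))" for u
    proof -
      define C where "C k = cos (real k * u)" for k
      have C: "cos u * C (Suc k) = (C (Suc (Suc k)) + C k) / 2" for k
      proof -
        have "C (Suc (Suc k)) = cos (real (Suc k) * u + u)" "C k = cos (real (Suc k) * u - u)"
          by (simp_all add: C_def algebra_simps)
        then show ?thesis by (simp add: C_def cos_add cos_diff)
      qed
      have C01: "C 0 = 1" "cos u = C 1" by (simp_all add: C_def)
      have "(\<Sum>k\<le>Suc d. b k * C k) = c + (\<Sum>k\<le>d. a k / 2 * C (Suc k))
          + (\<Sum>k\<le>Suc d. (if k + 1 \<le> d then a (k + 1) / 2 else 0) * C k) + a 0 / 2 * C 1"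
      proof -
        have "(\<Sum>k\<le>Suc d. (if k = 0 then c else 0) * C k) = c"
          by (simp add: sum.atMost_Suc_shift C01 del: sum.atMost_Suc)
        moreover have "(\<Sum>k\<le>Suc d. (if k = 0 then 0 else a (k - 1) / 2) * C k) = (\<Sum>k\<le>d. a k / 2 * C (Suc k))"
          by (simp add: sum.atMost_Suc_shift del: sum.atMost_Suc)
        moreover have "(\<Sum>k\<le>Suc d. (if k = 1 then a 0 / 2 else 0) * C k) = a 0 / 2 * C 1"
          by (simp add: if_distrib[of "\<lambda>x. x * _"] sum.delta cong: if_cong del: sum.atMost_Suc)
        ultimately show ?thesis
          unfolding b_def distrib_right sum.distrib by simp
      qed
      also have "(\<Sum>k\<le>Suc d. (if k + 1 \<le> d then a (k + 1) / 2 else 0) * C k) = (\<Sum>k<d. a (Suc k) / 2 * C k)"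
        by (rule sum.mono_neutral_cong_right) auto
      also have "c + (\<Sum>k\<le>d. a k / 2 * C (Suc k)) + (\<Sum>k<d. a (Suc k) / 2 * C k) + a 0 / 2 * C 1
          = c + a 0 * C 1 + (\<Sum>k<d. a (Suc k) * (cos u * C (Suc k)))"
        unfolding C by (simp add: sum.atMost_shift sum.distrib[symmetric] algebra_simps add_divide_distrib)
      also have "\<dots> = c + cos u * (\<Sum>k\<le>d. a k * C k)"
        by (simp add: sum.atMost_shift C01 sum_distrib_left algebra_simps)
      finally show ?thesis by (simp add: q a C_def)
    qed
    then show ?case by blast
  qed
  then show ?thesis by blast
qed

text \<open>A single translate of an even kernel is in general not even in \<open>t\<close>, hence
  not a polynomial in cos t. The symmetric sum is, because cos(k(t - \<tau>)) + cos(k(t + \<tau>)) =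
  2 cos(k \<tau>) cos(k t).\<close>

lemma even_shift_poly:
  fixes q :: "real poly"
  shows "\<exists>p. degree p \<le> degree q \<and> (\<forall>t. poly p (cos t) = poly q (cos (t - \<tau>)) + poly q (cos (t + \<tau>)))"
proof -
  obtain a where a: "\<And>u. poly q (cos u) = (\<Sum>k\<le>degree q. a k * cos (real k * u))"
    using poly_cos_expansion by blast
  obtain T :: "nat \<Rightarrow> real poly" where T: "\<And>k. degree (T k) \<le> k" "\<And>k t. poly (T k) (cos t) = cos (real k * t)"
    using chebyshev_poly_exists by metis
  define p where "p = (\<Sum>k\<le>degree q. smult (2 * a k * cos (real k * \<tau>)) (T k))"
  have "degree p \<le> degree q"
    unfolding p_def by (intro degree_sum_le) (auto intro!: order.trans[OF degree_smult_le] order.trans[OF T(1)])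
  moreover have "poly p (cos t) = poly q (cos (t - \<tau>)) + poly q (cos (t + \<tau>))" for t
    unfolding a p_def poly_sum sum.distrib[symmetric]
    by (intro sum.cong refl) (simp add: T(2) right_diff_distrib distrib_left cos_add cos_diff)
  ultimately show ?thesis by blast
qed

lemma sum_cos_equispaced:
  assumes "0 < k" "k < N"
  shows "(\<Sum>j<N. cos (real k * (t - 2 * pi * real j / real N))) = 0"
proof -
  define z where "z = cis (- (2 * pi * real k / real N))"
  have "real k / real N \<notin> \<int>"
  proof
    assume "real k / real N \<in> \<int>"
    then obtain i where "real k / real N = of_int i" by (elim Ints_cases)
    moreover have "0 < real k / real N" "real k / real N < 1" using assms by auto
    ultimately show False by simp
  qed
  have z1: "z \<noteq> 1"
  proof
    assume "z = 1"
    then have "cos (2 * pi * real k / real N) = 1" by (simp add: z_def complex_eq_iff)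
    then obtain i where "2 * pi * real k / real N = of_int i * 2 * pi"
      by (auto simp: cos_one_2pi_int)
    then have "2 * pi * (real k / real N) = 2 * pi * of_int i" by (simp add: mult_ac)
    then have "real k / real N = of_int i" by (simp only: mult_cancel_left) simp
    then show False using \<open>real k / real N \<notin> \<int>\<close> by simp
  qed
  have "real N * (- (2 * pi * real k / real N)) = 2 * pi * of_int (- int k)"
    using assms by (simp add: field_simps)
  then have "z ^ N = cis (2 * pi * of_int (- int k))"
    unfolding z_def Complex.DeMoivre by (rule arg_cong)
  then have zN: "z ^ N = 1" by (subst (asm) cis_multiple_2pi) auto
  have "(\<Sum>j<N. cis (real k * (t - 2 * pi * real j / real N))) = (\<Sum>j<N. cis (real k * t) * z ^ j)"
    unfolding z_def Complex.DeMoivre cis_mult by (intro sum.cong refl arg_cong[where f = cis]) (simp add: field_simps)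
  also have "\<dots> = 0"
    unfolding sum_distrib_left[symmetric] using geometric_sum[OF z1, of N] zN by simp
  finally have "Re (\<Sum>j<N. cis (real k * (t - 2 * pi * real j / real N))) = 0" by simp
  then show ?thesis by simp
qed

text \<open>\<open>N\<close> equispaced samples annihilate every frequency k with 0 < k < N, so only
  the mean survives and the sum is independent of \<open>t\<close>. Both the partition of unity and
  the bounded overlap of its members come from this.\<close>

lemma sum_poly_cos_equispaced:
  fixes q :: "real poly"
  assumes "degree q < N"
  shows "(\<Sum>j<N. poly q (cos (t - 2 * pi * real j / real N))) = (\<Sum>j<N. poly q (cos (2 * pi * real j / real N)))"
proof -
  obtain a where a: "\<And>u. poly q (cos u) = (\<Sum>k\<le>degree q. a k * cos (real k * u))"
    using poly_cos_expansion by blast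
  have "(\<Sum>j<N. poly q (cos (s - 2 * pi * real j / real N))) = real N * a 0" for s
  proof -
    have "(\<Sum>j<N. poly q (cos (s - 2 * pi * real j / real N)))
        = (\<Sum>k\<le>degree q. a k * (\<Sum>j<N. cos (real k * (s - 2 * pi * real j / real N))))"
      unfolding a sum_distrib_left by (rule sum.swap)
    also have "\<dots> = (\<Sum>k\<le>degree q. if k = 0 then a 0 * real N else 0)"
    proof (intro sum.cong refl)
      fix k assume "k \<in> {..degree q}"
      then show "a k * (\<Sum>j<N. cos (real k * (s - 2 * pi * real j / real N))) = (if k = 0 then a 0 * real N else 0)"
        using sum_cos_equispaced[of k N s] assms by auto
    qed
    finally show ?thesis by (simp add: mult.commute)
  qed
  from this[of t] this[of 0] show ?thesis by simp
qed

section \<open>The Fejer kernel and angular distance to the nodes\<close>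

lemma fejer_kernel:
  assumes "m \<ge> 1"
  shows "\<exists>q :: real poly. degree q \<le> m - 1 \<and>
    (\<forall>u. poly q (cos u) = (norm (\<Sum>l<m. cis (real l * u)))\<^sup>2)"
proof -
  obtain T :: "nat \<Rightarrow> real poly" where T: "\<And>k. degree (T k) \<le> k" "\<And>k t. poly (T k) (cos t) = cos (real k * t)"
    using chebyshev_poly_exists by metis
  define ad where "ad l i = (if l \<le> i then i - l else l - i)" for l i :: nat
  have ad: "cos (real (ad l i) * u) = cos (real l * u) * cos (real i * u) + sin (real l * u) * sin (real i * u)" for l i u
  proof -
    have "cos (real (ad l i) * u) = cos (real l * u - real i * u)"
    proof (cases "l \<le> i")
      case True
      then have "real (ad l i) * u = - (real l * u - real i * u)" by (simp add: ad_def of_nat_diff algebra_simps)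
      then show ?thesis by (simp only: cos_minus)
    next
      case False
      then show ?thesis by (simp add: ad_def of_nat_diff algebra_simps)
    qed
    then show ?thesis by (simp add: cos_diff)
  qed
  define q where "q = (\<Sum>l<m. \<Sum>i<m. T (ad l i))"
  have "degree q \<le> m - 1"
    unfolding q_def by (intro degree_sum_le order.trans[OF T(1)]) (auto simp: ad_def)
  moreover have "poly q (cos u) = (norm (\<Sum>l<m. cis (real l * u)))\<^sup>2" for u
    unfolding q_def poly_sum T(2) ad cmod_power2
    by (simp add: power2_eq_square sum_product sum.distrib)
  ultimately show ?thesis by blast
qed

lemma fejer_kernel_sin:
  "(norm (\<Sum>l<m. cis (real l * u)))\<^sup>2 * (sin (u / 2))\<^sup>2 = (sin (real m * u / 2))\<^sup>2"
proof -
  have half: "(norm (cis v - 1))\<^sup>2 = 4 * (sin (v / 2))\<^sup>2" for v :: real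
  proof -
    have "(norm (cis v - 1))\<^sup>2 = (cos v - 1)\<^sup>2 + (sin v)\<^sup>2" by (simp add: cmod_power2)
    also have "\<dots> = 2 - 2 * cos v" using sin_cos_squared_add[of v] by (simp add: power2_eq_square algebra_simps)
    also have "\<dots> = 4 * (sin (v / 2))\<^sup>2" using cos_double_sin[of "v / 2"] by simp
    finally show ?thesis .
  qed
  have "(cis u - 1) * (\<Sum>l<m. cis (real l * u)) = cis (real m * u) - 1"
  proof -
    have "(\<Sum>l<m. cis (real l * u)) = (\<Sum>l<m. cis u ^ l)"
      by (intro sum.cong refl) (simp add: Complex.DeMoivre)
    then show ?thesis using power_diff_1_eq[of "cis u" m] by (simp only: Complex.DeMoivre)
  qed
  then have "(norm (cis u - 1))\<^sup>2 * (norm (\<Sum>l<m. cis (real l * u)))\<^sup>2 = (norm (cis (real m * u) - 1))\<^sup>2"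
    by (metis norm_mult power_mult_distrib)
  then show ?thesis unfolding half by (simp add: mult.commute)
qed

lemma sin_half_shift:
  fixes t \<tau> :: real
  defines "\<sigma> \<equiv> \<bar>sin ((t - \<tau>) / 2)\<bar>"
  shows "\<bar>cos t - cos \<tau>\<bar> \<le> 2 * \<sigma> * (\<bar>sin \<tau>\<bar> + \<sigma>)" "\<bar>sin t\<bar> \<le> \<bar>sin \<tau>\<bar> + 2 * \<sigma>"
    "\<bar>sin \<tau>\<bar> \<le> \<bar>sin t\<bar> + 2 * \<sigma>"
proof -
  have "sin ((t + \<tau>) / 2) = sin (\<tau> + (t - \<tau>) / 2)" by (simp add: field_simps)
  also have "\<bar>\<dots>\<bar> \<le> \<bar>sin \<tau>\<bar> * \<bar>cos ((t - \<tau>) / 2)\<bar> + \<bar>cos \<tau>\<bar> * \<sigma>"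
    unfolding sin_add \<sigma>_def by (intro order.trans[OF abs_triangle_ineq]) (simp add: abs_mult)
  also have "\<dots> \<le> \<bar>sin \<tau>\<bar> * 1 + 1 * \<sigma>"
    by (intro add_mono mult_left_mono mult_right_mono) (auto simp: \<sigma>_def)
  finally have s: "\<bar>sin ((t + \<tau>) / 2)\<bar> \<le> \<bar>sin \<tau>\<bar> + \<sigma>" by simp
  have "cos t - cos \<tau> = 2 * sin ((t + \<tau>) / 2) * sin ((\<tau> - t) / 2)" by (rule cos_diff_cos)
  then have "\<bar>cos t - cos \<tau>\<bar> = 2 * \<bar>sin ((t + \<tau>) / 2)\<bar> * \<sigma>"
    unfolding \<sigma>_def using sin_minus[of "(t - \<tau>) / 2"] by (simp add: abs_mult minus_divide_left)
  also have "\<dots> \<le> 2 * (\<bar>sin \<tau>\<bar> + \<sigma>) * \<sigma>"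
    using s by (intro mult_right_mono) (auto simp: \<sigma>_def)
  finally show "\<bar>cos t - cos \<tau>\<bar> \<le> 2 * \<sigma> * (\<bar>sin \<tau>\<bar> + \<sigma>)" by (simp add: mult_ac)
  have "sin t - sin \<tau> = 2 * sin ((t - \<tau>) / 2) * cos ((t + \<tau>) / 2)" by (rule sin_diff_sin)
  then have "\<bar>sin t - sin \<tau>\<bar> = 2 * \<sigma> * \<bar>cos ((t + \<tau>) / 2)\<bar>" by (simp add: abs_mult \<sigma>_def)
  also have "\<dots> \<le> 2 * \<sigma> * 1" by (intro mult_left_mono) (auto simp: \<sigma>_def)
  finally show "\<bar>sin t\<bar> \<le> \<bar>sin \<tau>\<bar> + 2 * \<sigma>" "\<bar>sin \<tau>\<bar> \<le> \<bar>sin t\<bar> + 2 * \<sigma>" by linarith+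
qed

lemma abs_sin_add_le: "\<bar>sin (x + y)\<bar> \<le> \<bar>sin x\<bar> + \<bar>sin y\<bar>" for x y :: real
proof -
  have "\<bar>sin (x + y)\<bar> \<le> \<bar>sin x\<bar> * \<bar>cos y\<bar> + \<bar>cos x\<bar> * \<bar>sin y\<bar>"
    unfolding sin_add by (intro order.trans[OF abs_triangle_ineq]) (simp add: abs_mult)
  also have "\<dots> \<le> \<bar>sin x\<bar> * 1 + 1 * \<bar>sin y\<bar>"
    by (intro add_mono mult_left_mono mult_right_mono) auto
  finally show ?thesis by simp
qed

text \<open>Counts the overlap of the nodes. The Fejer kernel of order \<open>N\<close> sums to N^2
  over the nodes and equals sin^2(N u/2) / sin^2(u/2). As sin^2(N u/2) is the same at all nodes, it
  bounds the summands from above unless that numerator is small.\<close>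

lemma sum_inverse_square_sin:
  fixes N :: nat and t :: real
  assumes N: "N \<ge> 1"
  shows "(\<Sum>j<N. 1 / (1 + real N * \<bar>sin ((t - 2 * pi * real j / real N) / 2)\<bar>)\<^sup>2) \<le> 18"
proof -
  obtain q :: "real poly" where q: "degree q \<le> N - 1"
    "\<And>u. poly q (cos u) = (norm (\<Sum>l<N. cis (real l * u)))\<^sup>2"
    using fejer_kernel[OF N] by blast
  have q0: "poly q (cos (2 * pi * real j / real N)) = (if j = 0 then (real N)\<^sup>2 else 0)" if "j < N" for j
  proof (cases "j = 0")
    case False
    have "0 < sin (2 * pi * real j / real N / 2)"
      using False that by (intro sin_gt_zero) (auto simp: field_simps)
    moreover have "sin (real N * (2 * pi * real j / real N) / 2) = 0"
      using N sin_npi[of j] by (simp add: mult.commute)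
    ultimately show ?thesis
      using fejer_kernel_sin[of "2 * pi * real j / real N" N] False by (simp add: q(2))
  qed (use q(2)[of 0] in simp)
  have total: "(\<Sum>j<N. poly q (cos (s - 2 * pi * real j / real N))) = (real N)\<^sup>2" for s :: real
    using N q(1) by (subst sum_poly_cos_equispaced) (auto simp: q0)
  \<comment> \<open>Away from the nodes each summand is comparable to a value of the Fejer kernel.\<close>
  have main: "(\<Sum>j<N. 1 / (1 + real N * \<bar>sin ((s - 2 * pi * real j / real N) / 2)\<bar>)\<^sup>2) \<le> 2"
    if s: "(sin (real N * s / 2))\<^sup>2 \<ge> 1 / 2" for s :: real
  proof -
    have "1 / (1 + real N * \<bar>sin ((s - 2 * pi * real j / real N) / 2)\<bar>)\<^sup>2
        \<le> 2 / (real N)\<^sup>2 * poly q (cos (s - 2 * pi * real j / real N))" for j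
    proof -
      define u where "u = s - 2 * pi * real j / real N"
      have "real N * u / 2 = real N * s / 2 - pi * real j"
        using N by (simp add: u_def field_simps)
      then have "sin (real N * u / 2) = sin (real N * s / 2 - pi * real j)" by (rule arg_cong)
      also have "\<dots> = sin (real N * s / 2) * (-1) ^ j" by (simp add: sin_diff cos_npi mult.commute[of pi])
      finally have "(sin (real N * u / 2))\<^sup>2 = (sin (real N * s / 2))\<^sup>2"
        by (simp add: power_mult_distrib flip: power_mult)
      then have F: "poly q (cos u) * (sin (u / 2))\<^sup>2 \<ge> 1 / 2"
        using fejer_kernel_sin[of u N] s q(2) by simp
      then have nz: "sin (u / 2) \<noteq> 0" by auto
      then have "0 < real N * \<bar>sin (u / 2)\<bar>" using N by simp
      then have "1 / (1 + real N * \<bar>sin (u / 2)\<bar>)\<^sup>2 \<le> 1 / (real N * \<bar>sin (u / 2)\<bar>)\<^sup>2"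
        using N by (intro divide_left_mono power_mono mult_pos_pos zero_less_power) auto
      also have "\<dots> \<le> 2 / (real N)\<^sup>2 * poly q (cos u)"
        using F nz N by (simp add: power_mult_distrib field_simps)
      finally show ?thesis by (simp add: u_def)
    qed
    then have "(\<Sum>j<N. 1 / (1 + real N * \<bar>sin ((s - 2 * pi * real j / real N) / 2)\<bar>)\<^sup>2)
        \<le> 2 / (real N)\<^sup>2 * (\<Sum>j<N. poly q (cos (s - 2 * pi * real j / real N)))"
      unfolding sum_distrib_left by (intro sum_mono)
    then show ?thesis unfolding total using N by simp
  qed
  show ?thesis
  proof (cases "(sin (real N * t / 2))\<^sup>2 \<ge> 1 / 2")
    case True
    then show ?thesis using main[of t] by simp
  next
    case False
    \<comment> \<open>Half a node spacing turns the numerator into a squared cosine, which is then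
      at least 1/2. The move changes 1 + N * \<sigma> by a factor of at most 3, whence 9, and 18 = 9
      * 2.\<close>
    define t' where "t' = t + pi / real N"
    have "real N * t' / 2 = real N * t / 2 + pi / 2" using N by (simp add: t'_def field_simps)
    then have "sin (real N * t' / 2) = sin (real N * t / 2 + pi / 2)" by (rule arg_cong)
    then have eq: "sin (real N * t' / 2) = cos (real N * t / 2)" by (simp add: sin_add)
    have "(sin (real N * t' / 2))\<^sup>2 \<ge> 1 / 2"
      unfolding eq using False sin_cos_squared_add[of "real N * t / 2"] by linarith
    from main[OF this] have t': "(\<Sum>j<N. 1 / (1 + real N * \<bar>sin ((t' - 2 * pi * real j / real N) / 2)\<bar>)\<^sup>2) \<le> 2" .
    have "1 / (1 + real N * \<bar>sin ((t - 2 * pi * real j / real N) / 2)\<bar>)\<^sup>2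
        \<le> 9 * (1 / (1 + real N * \<bar>sin ((t' - 2 * pi * real j / real N) / 2)\<bar>)\<^sup>2)" for j
    proof -
      define \<sigma> where "\<sigma> = \<bar>sin ((t - 2 * pi * real j / real N) / 2)\<bar>"
      define \<sigma>' where "\<sigma>' = \<bar>sin ((t' - 2 * pi * real j / real N) / 2)\<bar>"
      have "\<sigma>' \<le> \<sigma> + \<bar>sin (pi / (2 * real N))\<bar>"
        unfolding \<sigma>_def \<sigma>'_def
        using abs_sin_add_le[of "(t - 2 * pi * real j / real N) / 2" "pi / (2 * real N)"]
        by (simp add: t'_def add_divide_distrib diff_divide_distrib algebra_simps)
      also have "\<bar>sin (pi / (2 * real N))\<bar> \<le> pi / (2 * real N)"
        using abs_sin_x_le_abs_x[of "pi / (2 * real N)"] by simp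
      finally have "real N * \<sigma>' \<le> real N * (\<sigma> + pi / (2 * real N))" by (intro mult_left_mono) auto
      also have "\<dots> = real N * \<sigma> + pi / 2" using N by (simp add: field_simps)
      also have "\<dots> \<le> real N * \<sigma> + 2" using pi_less_4 by simp
      also have "\<dots> \<le> 3 * (real N * \<sigma>) + 2" by (simp add: \<sigma>_def)
      finally have "1 + real N * \<sigma>' \<le> 3 * (1 + real N * \<sigma>)" by simp
      then have "(1 + real N * \<sigma>')\<^sup>2 \<le> (3 * (1 + real N * \<sigma>))\<^sup>2"
        by (intro power_mono) (auto simp: \<sigma>'_def)
      also have "\<dots> = 9 * (1 + real N * \<sigma>)\<^sup>2" unfolding power_mult_distrib by simp
      finally have "(1 + real N * \<sigma>')\<^sup>2 \<le> 9 * (1 + real N * \<sigma>)\<^sup>2" .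
      moreover have "0 < 1 + real N * \<sigma>" "0 < 1 + real N * \<sigma>'"
        by (auto simp: \<sigma>_def \<sigma>'_def intro: add_pos_nonneg)
      ultimately show ?thesis
        unfolding \<sigma>_def[symmetric] \<sigma>'_def[symmetric]
        by (simp add: power_mult_distrib divide_simps)
    qed
    then have "(\<Sum>j<N. 1 / (1 + real N * \<bar>sin ((t - 2 * pi * real j / real N) / 2)\<bar>)\<^sup>2)
        \<le> 9 * (\<Sum>j<N. 1 / (1 + real N * \<bar>sin ((t' - 2 * pi * real j / real N) / 2)\<bar>)\<^sup>2)"
      unfolding sum_distrib_left by (intro sum_mono)
    then show ?thesis using t' by linarith
  qed
qed

lemma rho_cos: "rho m (cos t) = \<bar>sin t\<bar> / real m + 1 / (real m)\<^sup>2"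
  by (simp add: rho_def sin_squared_eq[symmetric])

text \<open>\<open>w\<close> is an angular distance in units of 1/m. \<open>rho m\<close> changes at
  most linearly in it, while a distance in \<open>x\<close> is a product of two sines, each
  contributing one power of \<open>w\<close>.\<close>

lemma node_comparison:
  fixes t \<tau> :: real
  assumes m: "m \<ge> 1"
  defines "w \<equiv> 1 + real m * \<bar>sin ((t - \<tau>) / 2)\<bar>"
  shows "\<bar>cos t - cos \<tau>\<bar> \<le> 2 * rho m (cos \<tau>) * w\<^sup>2"
    "rho m (cos t) \<le> 2 * w * rho m (cos \<tau>)" "rho m (cos \<tau>) \<le> 2 * w * rho m (cos t)"
proof -
  define \<sigma> where "\<sigma> = \<bar>sin ((t - \<tau>) / 2)\<bar>"
  define M where "M = real m"
  have M: "M > 0" using m by (simp add: M_def)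
  have w: "w = 1 + M * \<sigma>" by (simp add: w_def M_def \<sigma>_def)
  have \<sigma>: "0 \<le> \<sigma>" by (simp add: \<sigma>_def)
  have w1: "1 \<le> w" unfolding w using M \<sigma> by simp
  note sh = sin_half_shift[where t = t and \<tau> = \<tau>, folded \<sigma>_def]
  have "\<sigma> * (\<bar>sin \<tau>\<bar> + \<sigma>) \<le> (w / M) * ((\<bar>sin \<tau>\<bar> + 1 / M) * w)"
  proof (intro mult_mono)
    show "\<sigma> \<le> w / M" using M by (simp add: w field_simps)
    have "(\<bar>sin \<tau>\<bar> + 1 / M) * w = \<bar>sin \<tau>\<bar> + \<sigma> + 1 / M + \<bar>sin \<tau>\<bar> * (M * \<sigma>)"
      using M by (simp add: w field_simps)
    then show "\<bar>sin \<tau>\<bar> + \<sigma> \<le> (\<bar>sin \<tau>\<bar> + 1 / M) * w" using M \<sigma> by simp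
  qed (use \<sigma> M w1 in auto)
  also have "\<dots> = rho m (cos \<tau>) * w\<^sup>2"
    using M by (simp add: rho_cos M_def power2_eq_square field_simps)
  finally show "\<bar>cos t - cos \<tau>\<bar> \<le> 2 * rho m (cos \<tau>) * w\<^sup>2" using sh(1) by linarith
  have "a / M + 1 / M\<^sup>2 \<le> 2 * w * (b / M + 1 / M\<^sup>2)" if "a \<le> b + 2 * \<sigma>" "0 \<le> b" for a b
  proof -
    have "a / M + 1 / M\<^sup>2 \<le> (b + 2 * \<sigma>) / M + 1 / M\<^sup>2"
      using that M by (intro add_right_mono divide_right_mono) auto
    also have "\<dots> \<le> 2 * (b / M) + 2 * (1 / M\<^sup>2 + \<sigma> / M)"
    proof -
      have "(b + 2 * \<sigma>) / M = b / M + 2 * (\<sigma> / M)" by (simp add: add_divide_distrib)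
      moreover have "0 \<le> b / M" "0 \<le> 1 / M\<^sup>2" using that M by auto
      moreover have "A + 2 * S + B \<le> 2 * A + 2 * (B + S)" if "0 \<le> A" "0 \<le> B" for A B S :: real
        using that by simp
      ultimately show ?thesis by presburger
    qed
    also have "\<dots> = 2 * (1 * (b / M)) + 2 * (w * (1 / M\<^sup>2))"
      using M by (simp add: w power2_eq_square field_simps)
    also have "\<dots> \<le> 2 * (w * (b / M)) + 2 * (w * (1 / M\<^sup>2))"
      using that M w1 by (intro add_right_mono mult_left_mono mult_right_mono) auto
    finally show ?thesis by (simp add: algebra_simps)
  qed
  from this[OF sh(2)] this[OF sh(3)]
  show "rho m (cos t) \<le> 2 * w * rho m (cos \<tau>)" "rho m (cos \<tau>) \<le> 2 * w * rho m (cos t)"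
    by (simp_all add: rho_cos M_def)
qed

text \<open>
  With \<open>x = cos t\<close> and \<open>\<xi> j = cos \<tau>\<close>, the weight \<open>v j x\<close> is \<open>1 + m * \<bar>sin ((t \<mp> \<tau>) / 2)\<bar>\<close> for the sign that makes it smaller.
\<close>

definition localized_partition ::
    "nat \<Rightarrow> nat \<Rightarrow> real \<Rightarrow> (nat \<Rightarrow> real poly) \<Rightarrow> (nat \<Rightarrow> real) \<Rightarrow> (nat \<Rightarrow> real \<Rightarrow> real) \<Rightarrow> bool" where
  "localized_partition s m C \<Psi> \<xi> v \<longleftrightarrow>
     (\<forall>j<s * m. degree (\<Psi> j) \<le> s * m \<and> \<xi> j \<in> {-1..1}) \<and>
     (\<forall>x\<in>{-1..1}. (\<Sum>j<s * m. poly (\<Psi> j) x) = 1 \<and> (\<Sum>j<s * m. 1 / (v j x)\<^sup>2) \<le> C \<and>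
       (\<exists>j<s * m. 1 / C \<le> poly (\<Psi> j) x \<and> v j x \<le> 2) \<and>
       (\<forall>j<s * m. 0 \<le> poly (\<Psi> j) x \<and> 1 \<le> v j x \<and> poly (\<Psi> j) x \<le> C / v j x ^ (2 * s) \<and>
          \<bar>x - \<xi> j\<bar> \<le> 2 * rho m (\<xi> j) * (v j x)\<^sup>2 \<and>
          rho m x \<le> 2 * v j x * rho m (\<xi> j) \<and> rho m (\<xi> j) \<le> 2 * v j x * rho m x))"

text \<open>The s-th power J of the normalized Fejer kernel has degree at most s*(m - 1), below the
  number N = s*m of nodes, so its translates add up to a constant. The normalized kernel F is at
  most 1 and decays like the inverse square of m \<bar>sin(u/2)\<bar>, which gives J decay of order
  2s.\<close>

lemma ex_localized_partition:
  assumes s: "s \<ge> 7"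
  shows "\<exists>C\<ge>1. \<forall>m\<ge>1. \<exists>\<Psi> \<xi> v. localized_partition s m C \<Psi> \<xi> v"
proof -
  \<comment> \<open>18 is the overlap bound for \<open>N\<close> nodes, and s^2 accounts for
    measuring with \<open>m\<close> instead of N = s*m. In \<open>C\<close> one 4^s stems from the
    decay estimate of J through the bound c <= 4^s * c3, the other from the lower bound (1/4)^s of J
    at a nearby node.\<close>
  define c3 where "c3 = 18 * (real s)\<^sup>2"
  define C where "C = 2 * 4 ^ s * 4 ^ s * c3"
  have c3: "1 \<le> c3" using s mult_mono[of 1 18 1 "(real s)\<^sup>2"] by (simp add: c3_def)
  have p4: "(1::real) \<le> 4 ^ s" by simp
  have C: "1 \<le> C" "2 * c3 \<le> C" "4 ^ s \<le> C"
  proof -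
    have p16: "(1::real) \<le> 4 ^ s * 4 ^ s" using mult_mono[OF p4 p4] by simp
    show C2: "2 * c3 \<le> C"
      using mult_right_mono[OF p16, of "2 * c3"] c3 by (simp add: C_def mult_ac)
    show "1 \<le> C" using C2 c3 by linarith
    have "4 ^ s * 1 \<le> 4 ^ s * (2 * 4 ^ s * c3)"
      using mult_mono[OF p4 c3] p4 by (intro mult_left_mono) auto
    then show "4 ^ s \<le> C" by (simp add: C_def mult_ac)
  qed
  have "\<exists>\<Psi> \<xi> v. localized_partition s m C \<Psi> \<xi> v" if m: "m \<ge> 1" for m
  proof -
    define N where "N = s * m"
    have N: "N \<ge> 1" using m s by (simp add: N_def)
    obtain q :: "real poly" where q: "degree q \<le> m - 1"
      "\<And>u. poly q (cos u) = (norm (\<Sum>l<m. cis (real l * u)))\<^sup>2"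
      using fejer_kernel[OF m] by blast
    define J where "J = (smult (1 / (real m)\<^sup>2) q) ^ s"
    define \<tau> where "\<tau> j = 2 * pi * real j / real N" for j
    define F where "F u = poly q (cos u) / (real m)\<^sup>2" for u
    have J: "poly J (cos u) = F u ^ s" for u by (simp add: J_def F_def)
    have F0: "0 \<le> F u" for u by (simp add: F_def q(2))
    have F1: "F u \<le> 1" for u
    proof -
      have "norm (\<Sum>l<m. cis (real l * u)) \<le> real m"
        by (intro order.trans[OF norm_sum]) simp
      then have "(norm (\<Sum>l<m. cis (real l * u)))\<^sup>2 \<le> (real m)\<^sup>2" by (intro power_mono) auto
      then show ?thesis using m by (simp add: F_def q(2))
    qed
    have F4: "F u * (1 + real m * \<bar>sin (u / 2)\<bar>)\<^sup>2 \<le> 4" for u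
    proof -
      have "F u * (real m * \<bar>sin (u / 2)\<bar>)\<^sup>2 = (sin (real m * u / 2))\<^sup>2"
        using fejer_kernel_sin[of u m] m by (simp add: F_def q(2) power_mult_distrib)
      also have "\<dots> \<le> 1" by (simp add: abs_square_le_1)
      finally have a: "F u * (real m * \<bar>sin (u / 2)\<bar>)\<^sup>2 \<le> 1" .
      have "F u * (1 + real m * \<bar>sin (u / 2)\<bar>)\<^sup>2 \<le> F u * (2 + 2 * (real m * \<bar>sin (u / 2)\<bar>)\<^sup>2)"
        using sum_squares_bound[of 1 "real m * \<bar>sin (u / 2)\<bar>"] F0
        by (intro mult_left_mono) (auto simp: power2_sum)
      also have "\<dots> \<le> 4" using a F1[of u] by (simp add: distrib_left)
      finally show ?thesis .
    qed
    have Jle: "poly J (cos u) \<le> 4 ^ s / (1 + real m * \<bar>sin (u / 2)\<bar>) ^ (2 * s)" for u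
    proof -
      have pos: "0 < 1 + real m * \<bar>sin (u / 2)\<bar>" by (simp add: add_pos_nonneg)
      have "(F u * (1 + real m * \<bar>sin (u / 2)\<bar>)\<^sup>2) ^ s \<le> 4 ^ s"
        using F4 F0 by (intro power_mono) auto
      then show ?thesis using pos by (simp add: J power_mult_distrib power_mult pos_le_divide_eq)
    qed
    have degJ: "degree J < N"
    proof -
      have "degree J \<le> degree (smult (1 / (real m)\<^sup>2) q) * s" unfolding J_def by (rule degree_power_le)
      also have "\<dots> \<le> (m - 1) * s"
        by (intro mult_right_mono order.trans[OF degree_smult_le] q(1)) simp
      also have "\<dots> < N" using m s by (simp add: N_def)
      finally show ?thesis .
    qed
    define c where "c = (\<Sum>j<N. poly J (cos (\<tau> j)))"
    have csum: "(\<Sum>j<N. poly J (cos (t - \<tau> j))) = c" for t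
      unfolding c_def \<tau>_def by (rule sum_poly_cos_equispaced[OF degJ])
    have csum': "(\<Sum>j<N. poly J (cos (t + \<tau> j))) = c" for t
    proof -
      have "cos (t + \<tau> j) = cos (- t - \<tau> j)" for j using cos_minus[of "t + \<tau> j"] by simp
      then show ?thesis using csum[of "- t"] by simp
    qed
    have J0: "0 \<le> poly J (cos u)" for u by (simp add: J F0)
    have "poly J (cos (\<tau> 0)) \<le> c"
      unfolding c_def using N J0 by (intro member_le_sum) auto
    moreover have "F 0 = 1" using m q(2)[of 0] by (simp add: F_def)
    ultimately have c1: "1 \<le> c" using J[of 0] by (simp add: \<tau>_def)
    have vsum: "(\<Sum>j<N. 1 / (1 + real m * \<bar>sin ((t - \<tau> j) / 2)\<bar>)\<^sup>2) \<le> c3" for t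
    proof -
      have "1 / (1 + real m * y)\<^sup>2 \<le> (real s)\<^sup>2 * (1 / (1 + real N * y)\<^sup>2)" if "0 \<le> y" for y
      proof -
        have "1 + real N * y \<le> real s * (1 + real m * y)"
          using s by (simp add: N_def algebra_simps)
        then have "(1 + real N * y)\<^sup>2 \<le> (real s * (1 + real m * y))\<^sup>2"
          using that by (intro power_mono) auto
        moreover have "0 < 1 + real N * y" "0 < 1 + real m * y" using that by (auto intro: add_pos_nonneg)
        ultimately show ?thesis by (simp add: power_mult_distrib divide_simps)
      qed
      then have "(\<Sum>j<N. 1 / (1 + real m * \<bar>sin ((t - \<tau> j) / 2)\<bar>)\<^sup>2)
          \<le> (real s)\<^sup>2 * (\<Sum>j<N. 1 / (1 + real N * \<bar>sin ((t - \<tau> j) / 2)\<bar>)\<^sup>2)"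
        unfolding sum_distrib_left by (intro sum_mono) simp
      also have "\<dots> \<le> (real s)\<^sup>2 * 18"
        unfolding \<tau>_def using sum_inverse_square_sin[OF N] by (intro mult_left_mono) auto
      finally show ?thesis by (simp add: c3_def)
    qed
    have c2: "c \<le> 4 ^ s * c3"
    proof -
      have "poly J (cos (0 - \<tau> j)) \<le> 4 ^ s * (1 / (1 + real m * \<bar>sin ((0 - \<tau> j) / 2)\<bar>)\<^sup>2)" for j
      proof -
        define w where "w = 1 + real m * \<bar>sin ((0 - \<tau> j) / 2)\<bar>"
        have w: "1 \<le> w" by (simp add: w_def)
        have "poly J (cos (0 - \<tau> j)) \<le> 4 ^ s / w ^ (2 * s)" unfolding w_def by (rule Jle)
        also have "\<dots> \<le> 4 ^ s / w ^ 2"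
          using w s by (intro divide_left_mono power_increasing) auto
        finally show ?thesis by (simp add: w_def)
      qed
      then have "(\<Sum>j<N. poly J (cos (0 - \<tau> j))) \<le> 4 ^ s * (\<Sum>j<N. 1 / (1 + real m * \<bar>sin ((0 - \<tau> j) / 2)\<bar>)\<^sup>2)"
        unfolding sum_distrib_left by (intro sum_mono)
      also have "\<dots> \<le> 4 ^ s * c3" by (intro mult_left_mono vsum) auto
      finally show ?thesis unfolding csum .
    qed
    have "\<forall>j. \<exists>p. degree p \<le> degree J \<and> (\<forall>t. poly p (cos t) = poly J (cos (t - \<tau> j)) + poly J (cos (t + \<tau> j)))"
      using even_shift_poly by blast
    then obtain p where p: "\<And>j. degree (p j) \<le> degree J"
      "\<And>j t. poly (p j) (cos t) = poly J (cos (t - \<tau> j)) + poly J (cos (t + \<tau> j))"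
      by metis
    \<comment> \<open>Both the translates by +\<tau> j and those by -\<tau> j sum to
      \<open>c\<close>, whence 2*c.\<close>
    define \<Psi> where "\<Psi> j = smult (1 / (2 * c)) (p j)" for j
    define \<xi> where "\<xi> j = cos (\<tau> j)" for j
    define w where "w t \<theta> = 1 + real m * \<bar>sin ((t - \<theta>) / 2)\<bar>" for t \<theta>
    define v where "v j x = min (w (arccos x) (\<tau> j)) (w (arccos x) (- \<tau> j))" for j x
    have w1: "1 \<le> w t \<theta>" for t \<theta> by (simp add: w_def)
    have "localized_partition s m C \<Psi> \<xi> v"
      unfolding localized_partition_def N_def[symmetric]
    proof (intro conjI ballI allI impI)
      fix j assume "j < N"
      show "degree (\<Psi> j) \<le> N"
        unfolding \<Psi>_def using degJ p(1)[of j] by (intro order.trans[OF degree_smult_le]) auto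
      show "\<xi> j \<in> {-1..1}" by (simp add: \<xi>_def)
    next
      fix x :: real assume x: "x \<in> {-1..1}"
      define t where "t = arccos x"
      have t: "cos t = x" "0 \<le> t" "t \<le> pi"
        using x arccos_lbound[of x] arccos_ubound[of x] by (auto simp: t_def)
      have \<Psi>x: "poly (\<Psi> j) x = (poly J (cos (t - \<tau> j)) + poly J (cos (t + \<tau> j))) / (2 * c)" for j
        using p(2)[of j t] by (simp add: \<Psi>_def t)
      show "(\<Sum>j<N. poly (\<Psi> j) x) = 1"
        using c1 unfolding \<Psi>x sum_divide_distrib[symmetric] sum.distrib csum csum' by simp
      have vs: "1 / (v j x)\<^sup>2 \<le> 1 / (w t (\<tau> j))\<^sup>2 + 1 / (w t (- \<tau> j))\<^sup>2" for j
        using zero_le_divide_1_iff[of "(w t (\<tau> j))\<^sup>2"] zero_le_divide_1_iff[of "(w t (- \<tau> j))\<^sup>2"]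
        unfolding v_def t_def[symmetric] min_def by (cases "w t (\<tau> j) \<le> w t (- \<tau> j)") simp_all
      have wneg: "w t (- \<tau> j) = w (- t) (\<tau> j)" for j
        unfolding w_def using sin_minus[of "(t - - \<tau> j) / 2"] by (simp add: minus_divide_left)
      have "(\<Sum>j<N. 1 / (w t (\<tau> j))\<^sup>2 + 1 / (w t (- \<tau> j))\<^sup>2) \<le> c3 + c3"
        unfolding sum.distrib wneg
        using vsum[of t, folded w_def] vsum[of "- t", folded w_def] by (rule add_mono)
      then show "(\<Sum>j<N. 1 / (v j x)\<^sup>2) \<le> C"
        using sum_mono[of "{..<N}" "\<lambda>j. 1 / (v j x)\<^sup>2", OF vs] C(2) by linarith
      show "\<exists>j<N. 1 / C \<le> poly (\<Psi> j) x \<and> v j x \<le> 2"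
      proof -
        \<comment> \<open>The last node at or before \<open>t\<close>. Then m*u <= 2*pi/s <= 1,
          which is where s >= 7 enters; all phases l*u lie in [0,1], where the cosine is at least
          1/2, so the kernel suffers no cancellation.\<close>
        define j where "j = nat \<lfloor>t * real N / (2 * pi)\<rfloor>"
        have a: "0 \<le> t * real N / (2 * pi)" using t by simp
        have "t * real N / (2 * pi) \<le> pi * real N / (2 * pi)"
          using t by (intro divide_right_mono mult_right_mono) auto
        also have "\<dots> < real N" using N by simp
        finally have b: "t * real N / (2 * pi) < real N" .
        have j1: "real j \<le> t * real N / (2 * pi)" unfolding j_def using a by simp
        have j2: "t * real N / (2 * pi) < real j + 1" unfolding j_def using a by linarith
        have jN: "j < N" using j1 b by linarith
        define u where "u = t - \<tau> j"
        have u0: "0 \<le> u" using j1 N by (simp add: u_def \<tau>_def field_simps)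
        have "t * real N < 2 * pi * (real j + 1)" using j2 by (simp add: field_simps)
        then have "t < 2 * pi * (real j + 1) / real N" using N by (simp add: pos_less_divide_eq)
        then have "u \<le> 2 * pi / real N" by (simp add: u_def \<tau>_def distrib_left add_divide_distrib)
        then have "real m * u \<le> real m * (2 * pi / real N)" by (intro mult_left_mono) auto
        also have "\<dots> = 2 * pi / real s" using m s by (simp add: N_def)
        also have "\<dots> \<le> 1" using pi_approx s by simp
        finally have mu: "real m * u \<le> 1" .
        have coslow: "1 / 2 \<le> cos (real l * u)" if "l < m" for l
        proof -
          define y where "y = real l * u"
          have "y \<le> real m * u" unfolding y_def using that u0 by (intro mult_right_mono) auto
          then have y: "0 \<le> y" "y \<le> 1" using u0 mu by (auto simp: y_def)
          have "\<bar>sin (y / 2)\<bar> \<le> 1 / 2" using abs_sin_x_le_abs_x[of "y / 2"] y by simp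
          then have "\<bar>sin (y / 2)\<bar>\<^sup>2 \<le> (1 / 2)\<^sup>2" by (intro power_mono) auto
          then have "(sin (y / 2))\<^sup>2 \<le> 1 / 4" by (simp add: power2_eq_square)
          then show ?thesis using cos_double_sin[of "y / 2"] by (simp add: y_def)
        qed
        have "(\<Sum>l<m. 1 / 2) \<le> (\<Sum>l<m. cos (real l * u))" using coslow by (intro sum_mono) auto
        then have "real m / 2 \<le> Re (\<Sum>l<m. cis (real l * u))" by simp
        also have "\<dots> \<le> norm (\<Sum>l<m. cis (real l * u))" by (rule complex_Re_le_cmod)
        finally have "(real m / 2)\<^sup>2 \<le> (norm (\<Sum>l<m. cis (real l * u)))\<^sup>2" by (intro power_mono) auto
        then have "1 / 4 \<le> F u" using m by (simp add: F_def q(2) field_simps)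
        then have Jlow: "(1 / 4) ^ s \<le> poly J (cos u)" unfolding J by (intro power_mono) auto
        have "1 / C = (1 / 4) ^ s / (2 * (4 ^ s * c3))" by (simp add: C_def power_divide)
        also have "\<dots> \<le> (1 / 4) ^ s / (2 * c)"
          using c1 c2 c3 by (intro divide_left_mono mult_pos_pos) auto
        also have "\<dots> \<le> poly (\<Psi> j) x"
          unfolding \<Psi>x u_def[symmetric] using Jlow J0[of "t + \<tau> j"] c1 by (intro divide_right_mono) auto
        finally have "1 / C \<le> poly (\<Psi> j) x" .
        moreover have "v j x \<le> 2"
        proof -
          have "real m * \<bar>sin (u / 2)\<bar> \<le> real m * (u / 2)"
            using abs_sin_x_le_abs_x[of "u / 2"] u0 by (intro mult_left_mono) auto
          then have "w t (\<tau> j) \<le> 2" using mu by (simp add: w_def u_def)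
          then show ?thesis unfolding v_def t_def[symmetric] by simp
        qed
        ultimately show ?thesis using jN by blast
      qed
      fix j assume "j < N"
      show "0 \<le> poly (\<Psi> j) x" unfolding \<Psi>x using J0 c1 by simp
      show v1: "1 \<le> v j x" unfolding v_def using w1 by simp
      show "poly (\<Psi> j) x \<le> C / v j x ^ (2 * s)"
      proof -
        have "poly J (cos (t - \<theta>)) \<le> 4 ^ s / v j x ^ (2 * s)" if "\<theta> = \<tau> j \<or> \<theta> = - \<tau> j" for \<theta>
        proof -
          have "v j x \<le> w t \<theta>" using that unfolding v_def t_def by auto
          then have "4 ^ s / w t \<theta> ^ (2 * s) \<le> 4 ^ s / v j x ^ (2 * s)"
            using v1 w1[of t \<theta>] by (intro divide_left_mono power_mono mult_pos_pos zero_less_power) auto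
          then show ?thesis using Jle[of "t - \<theta>"] unfolding w_def by linarith
        qed
        from this[of "\<tau> j"] this[of "- \<tau> j"]
        have "poly (\<Psi> j) x \<le> (2 * (4 ^ s / v j x ^ (2 * s))) / (2 * c)"
          unfolding \<Psi>x using c1 by (intro divide_right_mono) auto
        also have "\<dots> = (4 ^ s / v j x ^ (2 * s)) / c" by simp
        also have "\<dots> \<le> (4 ^ s / v j x ^ (2 * s)) / 1"
          using c1 v1 by (intro divide_left_mono) auto
        also have "\<dots> \<le> C / v j x ^ (2 * s)" using C(3) v1 by (simp add: divide_right_mono)
        finally show ?thesis .
      qed
      obtain \<theta> where \<theta>: "v j x = w t \<theta>" "cos \<theta> = \<xi> j"
        unfolding v_def t_def[symmetric] \<xi>_def min_def by (cases "w t (\<tau> j) \<le> w t (- \<tau> j)") auto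
      show "\<bar>x - \<xi> j\<bar> \<le> 2 * rho m (\<xi> j) * (v j x)\<^sup>2" "rho m x \<le> 2 * v j x * rho m (\<xi> j)"
        "rho m (\<xi> j) \<le> 2 * v j x * rho m x"
        using node_comparison[OF m, where t = t and \<tau> = \<theta>] unfolding \<theta> w_def[symmetric] t(1) by auto
    qed
    then show ?thesis by blast
  qed
  then show ?thesis using C(1) by blast
qed

section \<open>One-sided approximation\<close>

lemma rho_pos: "m \<ge> 1 \<Longrightarrow> x \<in> {-1..1} \<Longrightarrow> 0 < rho m x"
  unfolding rho_def by (intro add_nonneg_pos) (auto simp: abs_square_le_1 abs_le_iff)

lemma omega_node_le:
  assumes g: "continuous_on {-1..1} g" and h: "0 \<le> h" "h \<le> 2 * v * \<rho>" and v: "1 \<le> v" and \<rho>: "0 \<le> \<rho>"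
  shows "omega k g h \<le> (4 * v) ^ k * omega k g \<rho>"
proof -
  have "omega k g h \<le> omega k g ((2 * v) * \<rho>)" using h by (intro omega_mono g) auto
  also have "\<dots> \<le> (2 * (2 * v)) ^ k * omega k g \<rho>" using v \<rho> by (intro omega_scale g) auto
  finally show ?thesis by simp
qed

text \<open>Growth of order \<open>e\<close> is absorbed by the decay 2s; the two powers left over
  make the sum finite uniformly in \<open>N\<close>.\<close>

lemma localized_sum_le:
  fixes T v q :: "nat \<Rightarrow> real"
  assumes T: "\<And>j. j < (N::nat) \<Longrightarrow> \<bar>T j\<bar> \<le> c * v j ^ e * q j"
    and q: "\<And>j. j < N \<Longrightarrow> 0 \<le> q j \<and> q j \<le> C / v j ^ (2 * s)"
    and v: "\<And>j. j < N \<Longrightarrow> 1 \<le> v j" and sum: "(\<Sum>j<N. 1 / (v j)\<^sup>2) \<le> C"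
    and e: "e + 2 \<le> 2 * s" and c: "0 \<le> c" and C: "0 \<le> C"
  shows "\<bar>\<Sum>j<N. T j\<bar> \<le> c * C\<^sup>2"
proof -
  have "\<bar>T j\<bar> \<le> c * C * (1 / (v j)\<^sup>2)" if j: "j < N" for j
  proof -
    have vj: "1 \<le> v j" using v j by blast
    have "\<bar>T j\<bar> \<le> c * v j ^ e * (C / v j ^ (2 * s))"
    proof (rule order.trans[OF T[OF j]], rule mult_left_mono)
      show "q j \<le> C / v j ^ (2 * s)" using q[OF j] ..
    qed (use c vj in auto)
    also have "\<dots> \<le> c * v j ^ e * (C / v j ^ (e + 2))"
      using vj e c C by (intro mult_left_mono divide_left_mono power_increasing mult_nonneg_nonneg mult_pos_pos zero_less_power) auto
    also have "\<dots> = c * C * (1 / (v j)\<^sup>2)" using vj by (simp add: power_add power2_eq_square)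
    finally show ?thesis .
  qed
  then have "\<bar>\<Sum>j<N. T j\<bar> \<le> (\<Sum>j<N. c * C * (1 / (v j)\<^sup>2))"
    by (intro order.trans[OF sum_abs] sum_mono) auto
  also have "\<dots> = c * C * (\<Sum>j<N. 1 / (v j)\<^sup>2)" by (simp only: sum_distrib_left)
  also have "\<dots> \<le> c * C * C" using sum c C by (intro mult_left_mono) auto
  finally show ?thesis by (simp add: power2_eq_square mult.assoc)
qed

lemma poly_eqI_interval:
  fixes p q :: "real poly"
  assumes "\<And>x. x \<in> {-1..1} \<Longrightarrow> poly p x = poly q x"
  shows "p = q"
proof (rule ccontr)
  assume "p \<noteq> q"
  then have "finite {x. poly (p - q) x = 0}" by (intro poly_roots_finite) simp
  moreover have "{-1..1} \<subseteq> {x. poly (p - q) x = 0}" using assms by auto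
  ultimately have "finite {-1..1::real}" by (rule rev_finite_subset)
  then show False using infinite_Icc[of "-1::real" 1] by simp
qed

text \<open>\<open>G\<close> and \<open>K0\<close> come before \<open>s\<close> since the growth to
  be absorbed depends only on \<open>k\<close>, \<open>r\<close>, \<open>P\<close>; the caller may
  then choose a large \<open>s\<close>. The error bound holds for every \<alpha> in
  \<open>B\<close>, so it can later be matched with whichever point the majorant supplies.\<close>

lemma hermite_quasi_interpolant:
  fixes k r P :: nat
  assumes k: "k \<ge> 1"
  shows "\<exists>G K0. \<forall>s C2. K0 \<le> 2 * s \<and> 1 \<le> C2 \<longrightarrow> (\<exists>C\<ge>0. \<forall>m \<Psi> \<xi> v f D B.
    m \<ge> 1 \<and> localized_partition s m C2 \<Psi> \<xi> v \<and> Cr_derivs r f D \<and> finite B \<and> card B \<le> P \<and> B \<subseteq> {-1..1} \<and>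
    (\<forall>x\<in>{-1..1}. rho m x \<le> 1 \<and> (\<forall>\<alpha>\<in>B. \<forall>\<beta>\<in>B. \<alpha> \<noteq> \<beta> \<longrightarrow> rho m x \<le> \<bar>\<alpha> - \<beta>\<bar>)) \<longrightarrow>
    (\<exists>p. degree p \<le> s * m + G \<and> (\<forall>\<alpha>\<in>B. \<forall>i<r. poly ((pderiv ^^ i) p) \<alpha> = D i \<alpha>) \<and>
      (\<forall>x\<in>{-1..1}. \<forall>\<alpha>\<in>B.
        \<bar>f x - poly p x\<bar> \<le> C * (omega k (D r) (rho m x) * min (rho m x) \<bar>x - \<alpha>\<bar> ^ r))))"
proof -
  \<comment> \<open>\<open>Suc P\<close> because the node may be added to \<open>B\<close> as an
    extra interpolation point.\<close>
  obtain C1 G K where C1: "C1 \<ge> 0" and LH: "\<forall>f D B x0 h. Cr_derivs r f D \<and> finite B \<and> card B \<le> Suc P \<and> B \<subseteq> {-1..1} \<and> x0 \<in> B \<and>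
    0 < h \<and> h \<le> 1 \<and> (\<forall>\<alpha>\<in>B. \<forall>\<beta>\<in>B. \<alpha> \<noteq> \<beta> \<longrightarrow> h \<le> \<bar>\<alpha> - \<beta>\<bar>) \<longrightarrow>
    (\<exists>L. degree L \<le> G \<and> (\<forall>\<alpha>\<in>B. \<forall>i<r. poly ((pderiv ^^ i) L) \<alpha> = D i \<alpha>) \<and>
      (\<forall>x\<in>{-1..1}. \<forall>\<alpha>\<in>B.
        \<bar>f x - poly L x\<bar> \<le> C1 * omega k (D r) h * min h \<bar>x - \<alpha>\<bar> ^ r * (1 + \<bar>x - x0\<bar> / h) ^ K))"
    using local_hermite[OF k, where r = r and P = "Suc P"] by (elim exE conjE)
  \<comment> \<open>Exponents of the weight: \<open>k\<close> from changing the scale in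
    \<open>omega\<close>, \<open>r\<close> from h j <= 2 v \<rho>, and 2*K because \<bar>x - \<xi>
    j\<bar> / h j is quadratic in \<open>v\<close>.\<close>
  define e where "e = k + r + 2 * K"
  have main: "\<exists>p. degree p \<le> s * m + G \<and> (\<forall>\<alpha>\<in>B. \<forall>i<r. poly ((pderiv ^^ i) p) \<alpha> = D i \<alpha>) \<and>
      (\<forall>x\<in>{-1..1}. \<forall>\<alpha>\<in>B.
        \<bar>f x - poly p x\<bar> \<le> C1 * 4 ^ k * 2 ^ r * 4 ^ K * C2\<^sup>2 * (omega k (D r) (rho m x) * min (rho m x) \<bar>x - \<alpha>\<bar> ^ r))"
    if s: "e + 2 \<le> 2 * s" and C2: "1 \<le> C2" and m: "m \<ge> 1"
      and part: "localized_partition s m C2 \<Psi> \<xi> v" and f: "Cr_derivs r f D"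
      and B: "finite B" "card B \<le> P" "B \<subseteq> {-1..1}"
      and sep: "\<forall>x\<in>{-1..1}. rho m x \<le> 1 \<and> (\<forall>\<alpha>\<in>B. \<forall>\<beta>\<in>B. \<alpha> \<noteq> \<beta> \<longrightarrow> rho m x \<le> \<bar>\<alpha> - \<beta>\<bar>)"
    for s C2 m \<Psi> \<xi> v f D B
  proof -
    define N where "N = s * m"
    note part = part[unfolded localized_partition_def N_def[symmetric]]
    have cont: "continuous_on {-1..1} (D r)" using f by (simp add: Cr_derivs_def)
    define h where "h j = rho m (\<xi> j)" for j
    have \<xi>: "\<xi> j \<in> {-1..1}" if "j < N" for j using part that by blast
    have h: "0 < h j" "h j \<le> 1" if "j < N" for j
      using rho_pos[OF m \<xi>[OF that]] sep \<xi>[OF that] by (auto simp: h_def)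
    have hsep: "h j \<le> \<bar>\<alpha> - \<beta>\<bar>" if "j < N" "\<alpha> \<in> B" "\<beta> \<in> B" "\<alpha> \<noteq> \<beta>" for j \<alpha> \<beta>
      using sep \<xi>[OF that(1)] that(2-) unfolding h_def by blast
    \<comment> \<open>If a point of \<open>B\<close> is too close to the node, the local polynomial is centred at that point.\<close>
    define loc where "loc j L \<longleftrightarrow> degree L \<le> G \<and> (\<forall>\<alpha>\<in>B. \<forall>i<r. poly ((pderiv ^^ i) L) \<alpha> = D i \<alpha>) \<and>
        (\<forall>x\<in>{-1..1}. \<forall>\<alpha>\<in>B.
          \<bar>f x - poly L x\<bar> \<le> C1 * omega k (D r) (h j) * min (h j) \<bar>x - \<alpha>\<bar> ^ r * (2 + \<bar>x - \<xi> j\<bar> / h j) ^ K)" for j L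
    have "\<forall>j\<in>{..<N}. \<exists>L. loc j L"
    proof
      fix j assume "j \<in> {..<N}"
      then have j: "j < N" by simp
      obtain c where c: "c \<in> insert (\<xi> j) B" "\<bar>c - \<xi> j\<bar> \<le> h j" "\<And>\<alpha>. \<alpha> \<in> B \<Longrightarrow> \<alpha> \<noteq> c \<Longrightarrow> h j \<le> \<bar>\<alpha> - c\<bar>"
      proof (cases "\<exists>\<alpha>\<in>B. \<bar>\<alpha> - \<xi> j\<bar> < h j")
        case True
        then obtain \<alpha> where "\<alpha> \<in> B" "\<bar>\<alpha> - \<xi> j\<bar> < h j" by blast
        then show ?thesis using that[of \<alpha>] hsep[OF j] by auto
      next
        case False
        then show ?thesis using that[of "\<xi> j"] h(1)[OF j] by fastforce
      qed
      define B' where "B' = insert c B"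
      have B': "finite B'" "card B' \<le> Suc P" "B' \<subseteq> {-1..1}" "c \<in> B'"
        using B c(1) \<xi>[OF j] by (auto simp: B'_def card_insert_if)
      have "\<forall>\<alpha>\<in>B'. \<forall>\<beta>\<in>B'. \<alpha> \<noteq> \<beta> \<longrightarrow> h j \<le> \<bar>\<alpha> - \<beta>\<bar>"
        unfolding B'_def using c(3) hsep[OF j] by (auto simp: abs_minus_commute)
      then obtain L where L: "degree L \<le> G" "\<forall>\<alpha>\<in>B'. \<forall>i<r. poly ((pderiv ^^ i) L) \<alpha> = D i \<alpha>"
        "\<forall>x\<in>{-1..1}. \<forall>\<alpha>\<in>B'. \<bar>f x - poly L x\<bar> \<le>
           C1 * omega k (D r) (h j) * min (h j) \<bar>x - \<alpha>\<bar> ^ r * (1 + \<bar>x - c\<bar> / h j) ^ K"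
        using LH[rule_format, of f D B' c "h j"] f B' h[OF j] by blast
      have "\<bar>f x - poly L x\<bar> \<le> C1 * omega k (D r) (h j) * min (h j) \<bar>x - \<alpha>\<bar> ^ r * (2 + \<bar>x - \<xi> j\<bar> / h j) ^ K"
        if x: "x \<in> {-1..1}" and \<alpha>: "\<alpha> \<in> B" for x \<alpha>
      proof -
        have "\<bar>f x - poly L x\<bar> \<le> C1 * omega k (D r) (h j) * min (h j) \<bar>x - \<alpha>\<bar> ^ r * (1 + \<bar>x - c\<bar> / h j) ^ K"
          using L(3) x \<alpha> unfolding B'_def by blast
        also have "\<dots> \<le> C1 * omega k (D r) (h j) * min (h j) \<bar>x - \<alpha>\<bar> ^ r * (2 + \<bar>x - \<xi> j\<bar> / h j) ^ K"
        proof (intro mult_left_mono power_mono)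
          have "\<bar>x - c\<bar> / h j \<le> (\<bar>x - \<xi> j\<bar> + h j) / h j" using c(2) h[OF j] by (intro divide_right_mono) auto
          also have "\<dots> = \<bar>x - \<xi> j\<bar> / h j + 1" using h[OF j] by (simp add: add_divide_distrib)
          finally show "1 + \<bar>x - c\<bar> / h j \<le> 2 + \<bar>x - \<xi> j\<bar> / h j" by simp
          show "0 \<le> C1 * omega k (D r) (h j) * min (h j) \<bar>x - \<alpha>\<bar> ^ r"
            using C1 h[OF j] omega_nonneg[OF cont, of "h j" k] by (intro mult_nonneg_nonneg zero_le_power) auto
          show "0 \<le> 1 + \<bar>x - c\<bar> / h j" using h[OF j] by simp
        qed
        finally show ?thesis .
      qed
      then have "loc j L" unfolding loc_def using L(1,2) by (auto simp: B'_def)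
      then show "\<exists>L. loc j L" ..
    qed
    from bchoice[OF this] obtain L where L: "\<forall>j\<in>{..<N}. loc j (L j)" ..
    define p where "p = (\<Sum>j<N. \<Psi> j * L j)"
    have "degree p \<le> N + G"
      unfolding p_def using part L
      by (intro degree_sum_le order.trans[OF degree_mult_le] add_mono) (auto simp: loc_def)
    moreover have "poly ((pderiv ^^ i) p) \<alpha> = D i \<alpha>" if \<alpha>: "\<alpha> \<in> B" and i: "i < r" for \<alpha> i
    proof -
      \<comment> \<open>A reference polynomial with the right derivatives at \<alpha>: as the
        weights sum to 1, p - T is the weighted sum of the L j - T, all divisible by the required
        power.\<close>
      obtain T :: "real poly" where T: "\<forall>i<r. poly ((pderiv ^^ i) T) \<alpha> = D i \<alpha>"
        using poly_prescribed_derivs[of r 0 \<alpha> "\<lambda>i. D i \<alpha>"] by blast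
      have "(\<Sum>j<N. \<Psi> j) = 1"
        using part by (intro poly_eqI_interval) (simp add: poly_sum)
      then have "p - T = (\<Sum>j<N. \<Psi> j * (L j - T))"
        unfolding p_def right_diff_distrib sum_subtractf sum_distrib_right[symmetric] by simp
      moreover have "[:-\<alpha>, 1:] ^ r dvd (\<Sum>j<N. \<Psi> j * (L j - T))"
      proof (intro dvd_sum dvd_mult)
        fix j assume "j \<in> {..<N}"
        then show "[:-\<alpha>, 1:] ^ r dvd L j - T"
          using L T \<alpha> unfolding linear_power_dvd_iff poly_higher_pderiv_diff_eq_0_iff loc_def by simp
      qed
      ultimately have "[:-\<alpha>, 1:] ^ r dvd p - T" by simp
      then show ?thesis
        using T i unfolding linear_power_dvd_iff poly_higher_pderiv_diff_eq_0_iff by simp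
    qed
    moreover have "\<bar>f x - poly p x\<bar> \<le> C1 * 4 ^ k * 2 ^ r * 4 ^ K * C2\<^sup>2 * (omega k (D r) (rho m x) * min (rho m x) \<bar>x - \<alpha>\<bar> ^ r)"
      if x: "x \<in> {-1..1}" and \<alpha>: "\<alpha> \<in> B" for x \<alpha>
    proof -
      define \<rho> where "\<rho> = rho m x"
      define w where "w = omega k (D r) \<rho>"
      have \<rho>: "0 < \<rho>" unfolding \<rho>_def using rho_pos[OF m x] .
      have w: "0 \<le> w" unfolding w_def using \<rho> by (intro omega_nonneg cont) simp
      define \<mu> where "\<mu> = min \<rho> \<bar>x - \<alpha>\<bar>"
      have \<mu>: "0 \<le> \<mu>" using \<rho> by (simp add: \<mu>_def)
      have px: "1 \<le> v j x" "0 \<le> poly (\<Psi> j) x" "poly (\<Psi> j) x \<le> C2 / v j x ^ (2 * s)"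
        "\<bar>x - \<xi> j\<bar> \<le> 2 * h j * (v j x)\<^sup>2" "h j \<le> 2 * v j x * \<rho>" if "j < N" for j
        using part x that unfolding h_def \<rho>_def by blast+
      have one: "(\<Sum>j<N. poly (\<Psi> j) x) = 1" and vsum: "(\<Sum>j<N. 1 / (v j x)\<^sup>2) \<le> C2"
        using part x by blast+
      have "f x - poly p x = (\<Sum>j<N. (f x - poly (L j) x) * poly (\<Psi> j) x)"
        unfolding left_diff_distrib sum_subtractf sum_distrib_left[symmetric] one
        by (simp add: p_def poly_sum mult.commute)
      also have "\<bar>\<dots>\<bar> \<le> (C1 * 4 ^ k * 2 ^ r * 4 ^ K * (w * \<mu> ^ r)) * C2\<^sup>2"
      proof (rule localized_sum_le[where e = e and s = s and v = "\<lambda>j. v j x" and q = "\<lambda>j. poly (\<Psi> j) x"])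
        fix j assume j: "j < N"
        define V where "V = v j x"
        have V: "1 \<le> V" using px(1)[OF j] by (simp add: V_def)
        have V2: "1 \<le> V\<^sup>2" using V by simp
        have "\<bar>f x - poly (L j) x\<bar> \<le> C1 * omega k (D r) (h j) * min (h j) \<bar>x - \<alpha>\<bar> ^ r * (2 + \<bar>x - \<xi> j\<bar> / h j) ^ K"
          using L j x \<alpha> unfolding loc_def by blast
        also have "\<dots> \<le> C1 * ((4 * V) ^ k * w) * (2 * V * \<mu>) ^ r * (4 * V\<^sup>2) ^ K"
        proof (intro mult_mono power_mono mult_left_mono)
          show "omega k (D r) (h j) \<le> (4 * V) ^ k * w"
            unfolding w_def V_def using h(1)[OF j] px(1,5)[OF j] \<rho> by (intro omega_node_le cont) auto
          have "\<bar>x - \<alpha>\<bar> \<le> 2 * V * \<bar>x - \<alpha>\<bar>" using V mult_right_mono[of 1 "2 * V" "\<bar>x - \<alpha>\<bar>"] by simp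
          then show "min (h j) \<bar>x - \<alpha>\<bar> \<le> 2 * V * \<mu>"
            using px(5)[OF j] unfolding \<mu>_def V_def by (simp add: min_def)
          have "\<bar>x - \<xi> j\<bar> / h j \<le> 2 * V\<^sup>2"
            using px(4)[OF j] h[OF j] by (simp add: V_def pos_divide_le_eq mult_ac)
          then show "2 + \<bar>x - \<xi> j\<bar> / h j \<le> 4 * V\<^sup>2" using V2 by linarith
          show "0 \<le> omega k (D r) (h j)" using h[OF j] by (intro omega_nonneg cont) simp
        qed (use C1 h[OF j] V w \<mu> in auto)
        also have "\<dots> = C1 * 4 ^ k * 2 ^ r * 4 ^ K * (w * \<mu> ^ r) * V ^ e"
          unfolding e_def power_add power_mult power_mult_distrib by (simp only: mult_ac)
        finally show "\<bar>(f x - poly (L j) x) * poly (\<Psi> j) x\<bar>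
            \<le> C1 * 4 ^ k * 2 ^ r * 4 ^ K * (w * \<mu> ^ r) * v j x ^ e * poly (\<Psi> j) x"
          unfolding abs_mult V_def using px(2)[OF j] by (simp add: mult_right_mono)
      qed (use px vsum s C1 w \<mu> C2 in auto)
      finally show ?thesis unfolding w_def \<mu>_def \<rho>_def by (simp only: mult_ac)
    qed
    ultimately show ?thesis unfolding N_def by blast
  qed
  show ?thesis
  proof (rule exI[of _ G], rule exI[of _ "e + 2"], intro allI impI, elim conjE)
    fix s C2 assume s: "e + 2 \<le> 2 * s" "(1::real) \<le> C2"
    show "\<exists>C\<ge>0. \<forall>m \<Psi> \<xi> v f D B.
      m \<ge> 1 \<and> localized_partition s m C2 \<Psi> \<xi> v \<and> Cr_derivs r f D \<and> finite B \<and> card B \<le> P \<and> B \<subseteq> {-1..1} \<and>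
      (\<forall>x\<in>{-1..1}. rho m x \<le> 1 \<and> (\<forall>\<alpha>\<in>B. \<forall>\<beta>\<in>B. \<alpha> \<noteq> \<beta> \<longrightarrow> rho m x \<le> \<bar>\<alpha> - \<beta>\<bar>)) \<longrightarrow>
      (\<exists>p. degree p \<le> s * m + G \<and> (\<forall>\<alpha>\<in>B. \<forall>i<r. poly ((pderiv ^^ i) p) \<alpha> = D i \<alpha>) \<and>
        (\<forall>x\<in>{-1..1}. \<forall>\<alpha>\<in>B.
          \<bar>f x - poly p x\<bar> \<le> C * (omega k (D r) (rho m x) * min (rho m x) \<bar>x - \<alpha>\<bar> ^ r)))"
      by (rule exI[of _ "C1 * 4 ^ k * 2 ^ r * 4 ^ K * C2\<^sup>2"], rule conjI, use C1 in simp,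
          intro allI impI, elim conjE, rule main[OF s]; assumption)
  qed
qed

text \<open>The lower bound has exponent \<open>r\<close> although Q need only vanish to order \<mu>
  \<beta> <= r, because min \<rho> \<bar>x - \<beta>\<bar> / \<rho> is at most 1. A single good node
  suffices for it since all summands are nonnegative.\<close>

lemma one_sided_majorant:
  fixes k r P s :: nat and C2 :: real
  assumes s: "k + r + 2 * (r * P) + 2 \<le> 2 * s" and C2: "1 \<le> C2"
  shows "\<exists>C\<ge>0. \<forall>m \<Psi> \<xi> v g B \<mu>.
    m \<ge> 1 \<and> localized_partition s m C2 \<Psi> \<xi> v \<and> continuous_on {-1..1} g \<and> finite B \<and> card B \<le> P \<and> B \<noteq> {} \<and>
    (\<forall>\<alpha>\<in>B. \<mu> \<alpha> \<le> r \<and> (even (\<mu> \<alpha>) \<or> \<alpha> = -1 \<or> \<alpha> = 1)) \<and>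
    (\<forall>x\<in>{-1..1}. \<forall>\<alpha>\<in>B. \<forall>\<beta>\<in>B. \<alpha> \<noteq> \<beta> \<longrightarrow> 2 * rho m x \<le> \<bar>\<alpha> - \<beta>\<bar>) \<longrightarrow>
    (\<exists>Q. degree Q \<le> s * m + r * P \<and> (\<forall>\<alpha>\<in>B. [:-\<alpha>, 1:] ^ \<mu> \<alpha> dvd Q) \<and>
      (\<forall>x\<in>{-1..1}. poly Q x \<le> C * (omega k g (rho m x) * rho m x ^ r) \<and>
        (\<exists>\<beta>\<in>B. omega k g (rho m x) * min (rho m x) \<bar>x - \<beta>\<bar> ^ r \<le> poly Q x)))"
proof -
  define e where "e = k + r + 2 * (r * P)"
  \<comment> \<open>Compensates the losses at the good node: h j >= \<rho>/4, \<open>omega\<close>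
    at \<rho>/4 instead of \<rho>, a partition value of at least 1/C2, and 1/37 per linear
    factor.\<close>
  define Kc where "Kc = 4 ^ r * 8 ^ k * C2 * 37 ^ (r * P)"
  have Kc: "0 < Kc" unfolding Kc_def using C2 by simp
  define C where "C = Kc * 2 ^ r * 4 ^ k * 3 ^ (r * P) * C2\<^sup>2"
  have main: "\<exists>Q. degree Q \<le> s * m + r * P \<and> (\<forall>\<alpha>\<in>B. [:-\<alpha>, 1:] ^ \<mu> \<alpha> dvd Q) \<and>
      (\<forall>x\<in>{-1..1}. poly Q x \<le> C * (omega k g (rho m x) * rho m x ^ r) \<and>
        (\<exists>\<beta>\<in>B. omega k g (rho m x) * min (rho m x) \<bar>x - \<beta>\<bar> ^ r \<le> poly Q x))"
    if m: "m \<ge> 1" and part: "localized_partition s m C2 \<Psi> \<xi> v" and g: "continuous_on {-1..1} g"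
      and B: "finite B" "card B \<le> P" "B \<noteq> {}"
      and \<mu>: "\<forall>\<alpha>\<in>B. \<mu> \<alpha> \<le> r \<and> (even (\<mu> \<alpha>) \<or> \<alpha> = -1 \<or> \<alpha> = 1)"
      and sep: "\<forall>x\<in>{-1..1}. \<forall>\<alpha>\<in>B. \<forall>\<beta>\<in>B. \<alpha> \<noteq> \<beta> \<longrightarrow> 2 * rho m x \<le> \<bar>\<alpha> - \<beta>\<bar>" for m \<Psi> \<xi> v g B \<mu>
  proof -
    define N where "N = s * m"
    note part = part[unfolded localized_partition_def N_def[symmetric]]
    define h where "h j = rho m (\<xi> j)" for j
    have \<xi>: "\<xi> j \<in> {-1..1}" if "j < N" for j using part that by blast
    have h: "0 < h j" if "j < N" for j
      unfolding h_def using rho_pos[OF m \<xi>[OF that]] .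
    have wh: "0 \<le> omega k g (h j)" if "j < N" for j
      using h[OF that] by (intro omega_nonneg g) simp
    \<comment> \<open>Makes the factor 1 - x at the right endpoint, so that odd powers at both
      endpoints are nonnegative on [-1,1].\<close>
    define \<epsilon> where "\<epsilon> \<alpha> = (if \<alpha> = 1 then -1 else 1 :: real)" for \<alpha> :: real
    define \<phi> where "\<phi> j = (\<Prod>\<alpha>\<in>B. smult (\<epsilon> \<alpha> / (\<bar>\<xi> j - \<alpha>\<bar> + h j)) [:-\<alpha>, 1:] ^ \<mu> \<alpha>)" for j
    have \<phi>: "poly (\<phi> j) x = (\<Prod>\<alpha>\<in>B. (\<bar>x - \<alpha>\<bar> / (\<bar>\<xi> j - \<alpha>\<bar> + h j)) ^ \<mu> \<alpha>)"
      if j: "j < N" and x: "x \<in> {-1..1}" for j x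
      unfolding \<phi>_def poly_prod
    proof (rule prod.cong)
      fix \<alpha> assume \<alpha>: "\<alpha> \<in> B"
      define d where "d = \<bar>\<xi> j - \<alpha>\<bar> + h j"
      have d: "0 < d" unfolding d_def using h[OF j] by linarith
      have "(\<epsilon> \<alpha> / d * (x - \<alpha>)) ^ \<mu> \<alpha> = (\<bar>x - \<alpha>\<bar> / d) ^ \<mu> \<alpha>"
      proof (cases "\<alpha> = -1 \<or> \<alpha> = 1")
        case True
        then have "\<epsilon> \<alpha> * (x - \<alpha>) = \<bar>x - \<alpha>\<bar>" using x by (auto simp: \<epsilon>_def)
        then show ?thesis by (simp add: times_divide_eq_left)
      next
        case False
        then have "even (\<mu> \<alpha>)" using \<mu> \<alpha> by blast
        then have "((x - \<alpha>) / d) ^ \<mu> \<alpha> = \<bar>(x - \<alpha>) / d\<bar> ^ \<mu> \<alpha>" by (rule power_even_abs[symmetric])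
        then show ?thesis using False d by (simp add: \<epsilon>_def)
      qed
      then show "poly (smult (\<epsilon> \<alpha> / (\<bar>\<xi> j - \<alpha>\<bar> + h j)) [:-\<alpha>, 1:] ^ \<mu> \<alpha>) x = (\<bar>x - \<alpha>\<bar> / (\<bar>\<xi> j - \<alpha>\<bar> + h j)) ^ \<mu> \<alpha>"
        unfolding d_def[symmetric] poly_power poly_smult by simp
    qed simp
    have \<phi>0: "0 \<le> poly (\<phi> j) x" if "j < N" "x \<in> {-1..1}" for j x
      unfolding \<phi>[OF that] using h[OF that(1)] by (intro prod_nonneg zero_le_power divide_nonneg_nonneg) auto
    define Q where "Q = (\<Sum>j<N. smult (Kc * h j ^ r * omega k g (h j)) (\<Psi> j * \<phi> j))"
    have deg\<phi>: "degree (\<phi> j) \<le> r * P" for j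
    proof -
      have "degree (\<phi> j) \<le> (\<Sum>\<alpha>\<in>B. degree (smult (\<epsilon> \<alpha> / (\<bar>\<xi> j - \<alpha>\<bar> + h j)) [:-\<alpha>, 1:] ^ \<mu> \<alpha>))"
        unfolding \<phi>_def using degree_prod_sum_le[OF B(1)] by (simp add: comp_def)
      also have "\<dots> \<le> (\<Sum>\<alpha>\<in>B. r)"
      proof (rule sum_mono)
        fix \<alpha> assume "\<alpha> \<in> B"
        have "degree (smult (\<epsilon> \<alpha> / (\<bar>\<xi> j - \<alpha>\<bar> + h j)) [:-\<alpha>, 1:]) \<le> 1"
          by (rule order.trans[OF degree_smult_le]) simp
        then have "degree (smult (\<epsilon> \<alpha> / (\<bar>\<xi> j - \<alpha>\<bar> + h j)) [:-\<alpha>, 1:] ^ \<mu> \<alpha>) \<le> 1 * \<mu> \<alpha>"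
          by (intro order.trans[OF degree_power_le] mult_right_mono) auto
        then show "degree (smult (\<epsilon> \<alpha> / (\<bar>\<xi> j - \<alpha>\<bar> + h j)) [:-\<alpha>, 1:] ^ \<mu> \<alpha>) \<le> r"
          using \<mu> \<open>\<alpha> \<in> B\<close> by fastforce
      qed
      also have "\<dots> \<le> r * P" using B(2) by (simp add: mult.commute)
      finally show ?thesis .
    qed
    have "degree Q \<le> N + r * P"
      unfolding Q_def using part
      by (intro degree_sum_le order.trans[OF degree_smult_le] order.trans[OF degree_mult_le] add_mono deg\<phi>) auto
    moreover have "[:-\<alpha>, 1:] ^ \<mu> \<alpha> dvd Q" if \<alpha>: "\<alpha> \<in> B" for \<alpha>
      unfolding Q_def
    proof (intro dvd_sum dvd_smult dvd_mult)
      fix j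
      have "[:-\<alpha>, 1:] ^ \<mu> \<alpha> dvd smult (\<epsilon> \<alpha> / (\<bar>\<xi> j - \<alpha>\<bar> + h j)) [:-\<alpha>, 1:] ^ \<mu> \<alpha>"
        unfolding smult_power by (intro dvd_smult dvd_refl)
      also have "\<dots> dvd \<phi> j" unfolding \<phi>_def using \<alpha> B(1) by (intro dvd_prodI) auto
      finally show "[:-\<alpha>, 1:] ^ \<mu> \<alpha> dvd \<phi> j" .
    qed
    moreover have "poly Q x \<le> C * (omega k g (rho m x) * rho m x ^ r)"
      "\<exists>\<beta>\<in>B. omega k g (rho m x) * min (rho m x) \<bar>x - \<beta>\<bar> ^ r \<le> poly Q x" if x: "x \<in> {-1..1}" for x
    proof -
      define \<rho> where "\<rho> = rho m x"
      define w where "w = omega k g \<rho>"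
      have \<rho>: "0 < \<rho>" unfolding \<rho>_def using rho_pos[OF m x] .
      have w: "0 \<le> w" unfolding w_def using \<rho> by (intro omega_nonneg g) simp
      have px: "1 \<le> v j x" "0 \<le> poly (\<Psi> j) x" "poly (\<Psi> j) x \<le> C2 / v j x ^ (2 * s)"
        "\<bar>x - \<xi> j\<bar> \<le> 2 * h j * (v j x)\<^sup>2" "h j \<le> 2 * v j x * \<rho>" "\<rho> \<le> 2 * v j x * h j" if "j < N" for j
        using part x that unfolding h_def \<rho>_def by blast+
      have vsum: "(\<Sum>j<N. 1 / (v j x)\<^sup>2) \<le> C2" using part x by blast
      define T where "T j = Kc * h j ^ r * omega k g (h j) * (poly (\<Psi> j) x * poly (\<phi> j) x)" for j
      have Qx: "poly Q x = (\<Sum>j<N. T j)" by (simp add: Q_def poly_sum T_def)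
      have T0: "0 \<le> T j" if "j < N" for j
        unfolding T_def using Kc h[OF that] wh[OF that] px(2)[OF that] \<phi>0[OF that x] by simp
      have "\<bar>\<Sum>j<N. T j\<bar> \<le> (Kc * 2 ^ r * 4 ^ k * 3 ^ (r * P) * (w * \<rho> ^ r)) * C2\<^sup>2"
      proof (rule localized_sum_le[where e = e and s = s and v = "\<lambda>j. v j x" and q = "\<lambda>j. poly (\<Psi> j) x"])
        fix j assume j: "j < N"
        define V where "V = v j x"
        have V: "1 \<le> V" using px(1)[OF j] by (simp add: V_def)
        have V2: "1 \<le> V\<^sup>2" using V by simp
        have "poly (\<phi> j) x \<le> (\<Prod>\<alpha>\<in>B. (3 * V\<^sup>2) ^ r)"
          unfolding \<phi>[OF j x]
        proof (rule prod_mono, rule conjI)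
          fix \<alpha> assume \<alpha>: "\<alpha> \<in> B"
          have "\<bar>x - \<alpha>\<bar> \<le> \<bar>x - \<xi> j\<bar> + \<bar>\<xi> j - \<alpha>\<bar>" using abs_triangle_ineq[of "x - \<xi> j" "\<xi> j - \<alpha>"] by simp
          also have "\<dots> \<le> 2 * h j * V\<^sup>2 + 1 * \<bar>\<xi> j - \<alpha>\<bar>" using px(4)[OF j] by (simp add: V_def)
          also have "\<dots> \<le> 3 * V\<^sup>2 * h j + 3 * V\<^sup>2 * \<bar>\<xi> j - \<alpha>\<bar>"
            using V2 h[OF j] by (intro add_mono mult_right_mono) auto
          finally have "\<bar>x - \<alpha>\<bar> / (\<bar>\<xi> j - \<alpha>\<bar> + h j) \<le> 3 * V\<^sup>2"
            using h[OF j] by (subst pos_divide_le_eq) (auto simp: algebra_simps add_nonneg_pos)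
          then have "(\<bar>x - \<alpha>\<bar> / (\<bar>\<xi> j - \<alpha>\<bar> + h j)) ^ \<mu> \<alpha> \<le> (3 * V\<^sup>2) ^ \<mu> \<alpha>"
            using h[OF j] by (intro power_mono) auto
          also have "\<dots> \<le> (3 * V\<^sup>2) ^ r" using V2 \<mu> \<alpha> by (intro power_increasing) auto
          finally show "(\<bar>x - \<alpha>\<bar> / (\<bar>\<xi> j - \<alpha>\<bar> + h j)) ^ \<mu> \<alpha> \<le> (3 * V\<^sup>2) ^ r" .
        qed (use h[OF j] in auto)
        also have "\<dots> = (3 * V\<^sup>2) ^ (r * card B)" by (simp only: prod_constant power_mult)
        also have "\<dots> \<le> (3 * V\<^sup>2) ^ (r * P)" using V2 B(2) by (intro power_increasing) auto
        finally have "poly (\<phi> j) x \<le> (3 * V\<^sup>2) ^ (r * P)" .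
        then have "Kc * h j ^ r * omega k g (h j) * poly (\<phi> j) x
            \<le> Kc * (2 * V * \<rho>) ^ r * ((4 * V) ^ k * w) * (3 * V\<^sup>2) ^ (r * P)"
        proof (intro mult_mono power_mono mult_left_mono)
          show "omega k g (h j) \<le> (4 * V) ^ k * w"
            unfolding w_def V_def using h[OF j] px(1,5)[OF j] \<rho> by (intro omega_node_le g) auto
          show "h j \<le> 2 * V * \<rho>" using px(5)[OF j] by (simp add: V_def)
        qed (use Kc h[OF j] wh[OF j] \<phi>0[OF j x] V w \<rho> in auto)
        also have "\<dots> = Kc * 2 ^ r * 4 ^ k * 3 ^ (r * P) * (w * \<rho> ^ r) * V ^ e"
          unfolding e_def power_add power_mult_distrib power_mult[of V 2] by (simp only: mult_ac)
        finally have "Kc * h j ^ r * omega k g (h j) * poly (\<phi> j) x * poly (\<Psi> j) x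
            \<le> Kc * 2 ^ r * 4 ^ k * 3 ^ (r * P) * (w * \<rho> ^ r) * V ^ e * poly (\<Psi> j) x"
          using px(2)[OF j] by (rule mult_right_mono)
        then show "\<bar>T j\<bar> \<le> Kc * 2 ^ r * 4 ^ k * 3 ^ (r * P) * (w * \<rho> ^ r) * v j x ^ e * poly (\<Psi> j) x"
          unfolding abs_of_nonneg[OF T0[OF j]] unfolding T_def V_def by (simp only: mult_ac)
      qed (use px vsum s Kc w \<rho> C2 in \<open>auto simp: e_def\<close>)
      then show "poly Q x \<le> C * (omega k g (rho m x) * rho m x ^ r)"
        unfolding Qx C_def w_def \<rho>_def[symmetric] by (simp only: mult_ac abs_le_iff)
      define a where "a \<alpha> = min \<rho> \<bar>x - \<alpha>\<bar> / \<rho>" for \<alpha>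
      have a: "0 \<le> a \<alpha>" "a \<alpha> \<le> 1" for \<alpha> unfolding a_def using \<rho> by auto
      \<comment> \<open>Gaps of at least 2*\<rho> allow at most one point within \<rho> of
        \<open>x\<close>; that point is \<beta>, and if there is none any point will do.\<close>
      obtain \<beta> where \<beta>: "\<beta> \<in> B" "\<And>\<alpha>. \<alpha> \<in> B \<Longrightarrow> \<alpha> \<noteq> \<beta> \<Longrightarrow> a \<alpha> = 1"
      proof (cases "\<exists>\<beta>\<in>B. \<bar>x - \<beta>\<bar> < \<rho>")
        case True
        then obtain \<beta> where \<beta>: "\<beta> \<in> B" "\<bar>x - \<beta>\<bar> < \<rho>" by blast
        have "a \<alpha> = 1" if "\<alpha> \<in> B" "\<alpha> \<noteq> \<beta>" for \<alpha>
        proof -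
          have "2 * \<rho> \<le> \<bar>\<alpha> - \<beta>\<bar>" using sep x that \<beta>(1) unfolding \<rho>_def by blast
          then have "\<rho> \<le> \<bar>x - \<alpha>\<bar>" using \<beta>(2) by linarith
          then show ?thesis using \<rho> by (simp add: a_def)
        qed
        then show ?thesis using that \<beta>(1) by blast
      next
        case False
        then have "a \<alpha> = 1" if "\<alpha> \<in> B" for \<alpha> using that \<rho> by (force simp: a_def min_def)
        then show ?thesis using that B(3) by blast
      qed
      obtain j where j: "j < N" "1 / C2 \<le> poly (\<Psi> j) x" "v j x \<le> 2" using part x by blast
      have h1: "\<rho> / 4 \<le> h j"
        using px(6)[OF j(1)] mult_right_mono[OF j(3), of "h j"] h[OF j(1)] by linarith
      have h2: "h j \<le> 4 * \<rho>"
        using px(5)[OF j(1)] mult_right_mono[OF j(3), of \<rho>] \<rho> by linarith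
      have h3: "\<bar>x - \<xi> j\<bar> \<le> 8 * h j"
      proof -
        have "(v j x)\<^sup>2 \<le> 2\<^sup>2" using px(1)[OF j(1)] j(3) by (intro power_mono) auto
        then have "2 * h j * (v j x)\<^sup>2 \<le> 2 * h j * 4" using h[OF j(1)] by (intro mult_left_mono) auto
        then show ?thesis using px(4)[OF j(1)] by linarith
      qed
      have w8: "w / 8 ^ k \<le> omega k g (h j)"
      proof -
        have "w \<le> (2 * 4) ^ k * omega k g (\<rho> / 4)"
          unfolding w_def using omega_scale[OF g, of "\<rho> / 4" 4 k] \<rho> by simp
        then have "w / 8 ^ k \<le> omega k g (\<rho> / 4)" by (simp add: pos_divide_le_eq mult.commute)
        also have "\<dots> \<le> omega k g (h j)" using h1 \<rho> by (intro omega_mono g) auto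
        finally show ?thesis .
      qed
      have \<phi>low: "(1 / 37) ^ (r * P) * a \<beta> ^ r \<le> poly (\<phi> j) x"
      proof -
        have "(\<Prod>\<alpha>\<in>B. (1 / 37) ^ r * a \<alpha> ^ \<mu> \<alpha>) \<le> poly (\<phi> j) x"
          unfolding \<phi>[OF j(1) x]
        proof (rule prod_mono, rule conjI)
          fix \<alpha> assume \<alpha>: "\<alpha> \<in> B"
          \<comment> \<open>36 = (8 + 1) * 4, from \<bar>x - \<xi> j\<bar> <= 8 * h j and h j <=
            4*\<rho>. Comparing \<bar>x - \<alpha>\<bar> with \<rho> then gives the constant
            37.\<close>
          have "\<bar>\<xi> j - \<alpha>\<bar> + h j \<le> \<bar>x - \<alpha>\<bar> + 36 * \<rho>"
            using h2 h3 abs_triangle_ineq[of "\<xi> j - x" "x - \<alpha>"] abs_minus_commute[of x "\<xi> j"] by simp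
          then have "\<bar>x - \<alpha>\<bar> / (\<bar>x - \<alpha>\<bar> + 36 * \<rho>) \<le> \<bar>x - \<alpha>\<bar> / (\<bar>\<xi> j - \<alpha>\<bar> + h j)"
            using \<rho> h[OF j(1)] by (intro divide_left_mono mult_pos_pos add_nonneg_pos) auto
          moreover have "a \<alpha> / 37 \<le> \<bar>x - \<alpha>\<bar> / (\<bar>x - \<alpha>\<bar> + 36 * \<rho>)"
          proof (cases "\<rho> \<le> \<bar>x - \<alpha>\<bar>")
            case True
            then show ?thesis using \<rho> by (simp add: a_def field_simps)
          next
            case False
            then have "\<bar>x - \<alpha>\<bar> / (37 * \<rho>) \<le> \<bar>x - \<alpha>\<bar> / (\<bar>x - \<alpha>\<bar> + 36 * \<rho>)"
              using \<rho> by (intro divide_left_mono mult_pos_pos add_nonneg_pos) auto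
            then show ?thesis using False by (simp add: a_def mult.commute)
          qed
          ultimately have "a \<alpha> / 37 \<le> \<bar>x - \<alpha>\<bar> / (\<bar>\<xi> j - \<alpha>\<bar> + h j)" by (rule order.trans[rotated])
          then have "(a \<alpha> / 37) ^ \<mu> \<alpha> \<le> (\<bar>x - \<alpha>\<bar> / (\<bar>\<xi> j - \<alpha>\<bar> + h j)) ^ \<mu> \<alpha>"
            using a[of \<alpha>] by (intro power_mono) auto
          moreover have "(1 / 37) ^ r * a \<alpha> ^ \<mu> \<alpha> \<le> (1 / 37) ^ \<mu> \<alpha> * a \<alpha> ^ \<mu> \<alpha>"
            using \<mu> \<alpha> a[of \<alpha>] by (intro mult_right_mono power_decreasing) auto
          ultimately show "(1 / 37) ^ r * a \<alpha> ^ \<mu> \<alpha> \<le> (\<bar>x - \<alpha>\<bar> / (\<bar>\<xi> j - \<alpha>\<bar> + h j)) ^ \<mu> \<alpha>"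
            by (simp add: power_divide)
        qed (use a in auto)
        moreover have "(\<Prod>\<alpha>\<in>B. (1 / 37) ^ r * a \<alpha> ^ \<mu> \<alpha>) = (1 / 37) ^ (r * card B) * a \<beta> ^ \<mu> \<beta>"
        proof -
          have "(\<Prod>\<alpha>\<in>B. a \<alpha> ^ \<mu> \<alpha>) = a \<beta> ^ \<mu> \<beta> * (\<Prod>\<alpha>\<in>B - {\<beta>}. a \<alpha> ^ \<mu> \<alpha>)"
            using B(1) \<beta>(1) by (rule prod.remove)
          also have "(\<Prod>\<alpha>\<in>B - {\<beta>}. a \<alpha> ^ \<mu> \<alpha>) = 1" using \<beta>(2) by (intro prod.neutral) auto
          finally show ?thesis unfolding prod.distrib prod_constant power_mult by simp
        qed
        moreover have "(1 / 37) ^ (r * P) * a \<beta> ^ r \<le> (1 / 37) ^ (r * card B) * a \<beta> ^ \<mu> \<beta>"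
          using B(2) \<mu> \<beta>(1) a[of \<beta>] by (intro mult_mono power_decreasing) auto
        ultimately show ?thesis by linarith
      qed
      have "w * min \<rho> \<bar>x - \<beta>\<bar> ^ r = w * (a \<beta> * \<rho>) ^ r" using \<rho> by (simp add: a_def)
      also have "\<dots> = Kc * (\<rho> / 4) ^ r * (w / 8 ^ k) * ((1 / C2) * ((1 / 37) ^ (r * P) * a \<beta> ^ r))"
        using C2 by (simp add: Kc_def power_mult_distrib power_divide)
      also have "\<dots> \<le> T j"
        unfolding T_def
        by (intro mult_mono power_mono mult_left_mono h1 w8 \<phi>low j(2) mult_nonneg_nonneg zero_le_power)
          (use Kc h[OF j(1)] wh[OF j(1)] px(2)[OF j(1)] \<rho> w C2 a in auto)
      also have "T j \<le> poly Q x"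
        unfolding Qx using T0 j(1) by (intro member_le_sum) auto
      finally show "\<exists>\<beta>\<in>B. omega k g (rho m x) * min (rho m x) \<bar>x - \<beta>\<bar> ^ r \<le> poly Q x"
        unfolding w_def \<rho>_def using \<beta>(1) by blast
    qed
    ultimately show ?thesis unfolding N_def by blast
  qed
  have "0 \<le> C" unfolding C_def using Kc by simp
  show ?thesis
    by (rule exI[of _ C], rule conjI[OF \<open>0 \<le> C\<close>], intro allI impI, elim conjE, rule main; assumption)
qed

section \<open>Comparison of scales, the minimal gap, and assembly\<close>

lemma rho_le_rho:
  assumes "m \<ge> 1" "n \<ge> 1" "real n \<le> c * real m" "x \<in> {-1..1}" "1 \<le> c"
  shows "rho m x \<le> c\<^sup>2 * rho n x"
proof -
  define S where "S = sqrt (1 - x\<^sup>2)"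
  have S: "0 \<le> S" unfolding S_def using assms(4) by (auto simp: abs_square_le_1 abs_le_iff)
  have inv: "1 / real m \<le> c / real n" using assms by (simp add: field_simps)
  have "S / real m \<le> c\<^sup>2 * (S / real n)"
  proof -
    have "S * (1 / real m) \<le> S * (c / real n)" using inv S by (rule mult_left_mono)
    also have "\<dots> = c * (S / real n)" by simp
    also have "\<dots> \<le> c\<^sup>2 * (S / real n)"
      using assms(5) S power_increasing[of 1 2 c] by (intro mult_right_mono) auto
    finally show ?thesis by simp
  qed
  moreover have "1 / (real m)\<^sup>2 \<le> c\<^sup>2 * (1 / (real n)\<^sup>2)"
    using power_mono[OF inv, of 2] by (simp add: power_divide)
  ultimately show ?thesis unfolding rho_def S_def[symmetric] by (simp add: distrib_left)
qed

lemma rho_le: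
  assumes "m \<ge> 1"
  shows "rho m x \<le> 2 / real m"
proof -
  have "sqrt (1 - x\<^sup>2) / real m \<le> 1 / real m" by (intro divide_right_mono) auto
  moreover have "1 / (real m)\<^sup>2 \<le> 1 / real m"
    using assms by (simp add: power2_eq_square field_simps)
  ultimately show ?thesis unfolding rho_def by simp
qed

lemma dmin_le:
  assumes "finite A" "\<alpha> \<in> A \<union> {-1, 1}" "\<beta> \<in> A \<union> {-1, 1}" "\<alpha> \<noteq> \<beta>"
  shows "dmin A \<le> \<bar>\<alpha> - \<beta>\<bar>" "0 < dmin A"
proof -
  define S where "S = {\<bar>a - b\<bar> | a b. a \<in> A \<union> {-1, 1} \<and> b \<in> A \<union> {-1, 1} \<and> a \<noteq> b}"
  have "S \<subseteq> (\<lambda>(a, b). \<bar>a - b\<bar>) ` ((A \<union> {-1, 1}) \<times> (A \<union> {-1, 1}))" by (auto simp: S_def)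
  then have fin: "finite S" by (rule finite_subset) (use assms(1) in simp)
  have mem: "\<bar>\<alpha> - \<beta>\<bar> \<in> S" using assms by (auto simp: S_def)
  then show "dmin A \<le> \<bar>\<alpha> - \<beta>\<bar>" unfolding dmin_def S_def[symmetric] using fin by (rule Min_le[rotated])
  have "Min S \<in> S" using fin mem by (intro Min_in) auto
  then show "0 < dmin A" unfolding dmin_def S_def[symmetric] by (auto simp: S_def)
qed

theorem theorem2p2:
  fixes k p r :: nat and m1 m3 :: int
  assumes "k \<ge> 1" and "p \<ge> 1"
    and "(\<exists>j::nat. j \<ge> 1 \<and> r = 2 * j \<and> m1 = 2 * int j - 1 \<and> m3 = 2 * int j - 1) \<or>
         (\<exists>j::nat. r = 2 * j + 1 \<and> m1 = 2 * int j - 1 \<and> m3 = 2 * int j)"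
  shows "\<exists>c>0. \<exists>N :: real \<Rightarrow> nat. \<forall>A :: real set. \<forall>f D. \<forall>n.
    A \<subseteq> {-1..1} \<and> finite A \<and> card A = p \<and> Cr_derivs r f D \<and> n \<ge> N (dmin A) \<longrightarrow>
    (\<exists>P :: real poly. degree P \<le> n \<and>
       (\<forall>x\<in>{-1..1}. poly P x \<ge> f x) \<and>
       (\<forall>\<alpha>\<in>A. \<forall>i::nat. int i \<le> m1 \<longrightarrow> poly ((pderiv ^^ i) P) \<alpha> = D i \<alpha>) \<and>
       (\<forall>i::nat. int i \<le> m3 \<longrightarrow>
          poly ((pderiv ^^ i) P) (-1) = D i (-1) \<and> poly ((pderiv ^^ i) P) 1 = D i 1) \<and>
       (\<forall>x\<in>{-1..1}. \<bar>f x - poly P x\<bar> \<le>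
          c * (rho n x) ^ r * omega k (D r) (rho n x)))"
proof -
  \<comment> \<open>Unifies the two families of parameters: interior contact has order
    \<open>r0\<close>, the largest even number up to \<open>r\<close>, and endpoint contact has
    order \<open>r\<close>.\<close>
  define r0 where "r0 = 2 * (r div 2)"
  have r0: "even r0" "r0 \<le> r" by (simp_all add: r0_def)
  have m1: "int i \<le> m1 \<longleftrightarrow> i < r0" and m3: "int i \<le> m3 \<longleftrightarrow> i < r" for i :: nat
    using assms(3) unfolding r0_def by auto
  define q where "q = p + 2"
  obtain G K0 where GK: "\<forall>s C2. K0 \<le> 2 * s \<and> 1 \<le> C2 \<longrightarrow> (\<exists>C\<ge>0. \<forall>m \<Psi> \<xi> v f D B.
    m \<ge> 1 \<and> localized_partition s m C2 \<Psi> \<xi> v \<and> Cr_derivs r f D \<and> finite B \<and> card B \<le> q \<and> B \<subseteq> {-1..1} \<and>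
    (\<forall>x\<in>{-1..1}. rho m x \<le> 1 \<and> (\<forall>\<alpha>\<in>B. \<forall>\<beta>\<in>B. \<alpha> \<noteq> \<beta> \<longrightarrow> rho m x \<le> \<bar>\<alpha> - \<beta>\<bar>)) \<longrightarrow>
    (\<exists>p. degree p \<le> s * m + G \<and> (\<forall>\<alpha>\<in>B. \<forall>i<r. poly ((pderiv ^^ i) p) \<alpha> = D i \<alpha>) \<and>
      (\<forall>x\<in>{-1..1}. \<forall>\<alpha>\<in>B.
        \<bar>f x - poly p x\<bar> \<le> C * (omega k (D r) (rho m x) * min (rho m x) \<bar>x - \<alpha>\<bar> ^ r))))"
    using hermite_quasi_interpolant[OF assms(1), where r = r and P = q] by (elim exE)
  \<comment> \<open>7 permits the partition; the other summands let the decay 2s exceed the growth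
    in both the quasi-interpolant and the majorant.\<close>
  define s where "s = 7 + K0 + k + r + r * q"
  obtain C2 where C2: "1 \<le> C2" and part: "\<forall>m\<ge>1. \<exists>\<Psi> \<xi> v. localized_partition s m C2 \<Psi> \<xi> v"
    using ex_localized_partition[of s] by (auto simp: s_def)
  have "K0 \<le> 2 * s \<and> 1 \<le> C2" using C2 by (simp add: s_def)
  from GK[rule_format, OF this] obtain C3 where C3: "C3 \<ge> 0" and QI: "\<forall>m \<Psi> \<xi> v f D B.
    m \<ge> 1 \<and> localized_partition s m C2 \<Psi> \<xi> v \<and> Cr_derivs r f D \<and> finite B \<and> card B \<le> q \<and> B \<subseteq> {-1..1} \<and>
    (\<forall>x\<in>{-1..1}. rho m x \<le> 1 \<and> (\<forall>\<alpha>\<in>B. \<forall>\<beta>\<in>B. \<alpha> \<noteq> \<beta> \<longrightarrow> rho m x \<le> \<bar>\<alpha> - \<beta>\<bar>)) \<longrightarrow>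
    (\<exists>p. degree p \<le> s * m + G \<and> (\<forall>\<alpha>\<in>B. \<forall>i<r. poly ((pderiv ^^ i) p) \<alpha> = D i \<alpha>) \<and>
      (\<forall>x\<in>{-1..1}. \<forall>\<alpha>\<in>B.
        \<bar>f x - poly p x\<bar> \<le> C3 * (omega k (D r) (rho m x) * min (rho m x) \<bar>x - \<alpha>\<bar> ^ r)))"
    by (elim exE conjE)
  have "k + r + 2 * (r * q) + 2 \<le> 2 * s" by (simp add: s_def)
  from one_sided_majorant[OF this C2] obtain C4 where C4: "C4 \<ge> 0" and OM: "\<forall>m \<Psi> \<xi> v g B \<mu>.
    m \<ge> 1 \<and> localized_partition s m C2 \<Psi> \<xi> v \<and> continuous_on {-1..1} g \<and> finite B \<and> card B \<le> q \<and> B \<noteq> {} \<and>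
    (\<forall>\<alpha>\<in>B. \<mu> \<alpha> \<le> r \<and> (even (\<mu> \<alpha>) \<or> \<alpha> = -1 \<or> \<alpha> = 1)) \<and>
    (\<forall>x\<in>{-1..1}. \<forall>\<alpha>\<in>B. \<forall>\<beta>\<in>B. \<alpha> \<noteq> \<beta> \<longrightarrow> 2 * rho m x \<le> \<bar>\<alpha> - \<beta>\<bar>) \<longrightarrow>
    (\<exists>Q. degree Q \<le> s * m + r * q \<and> (\<forall>\<alpha>\<in>B. [:-\<alpha>, 1:] ^ \<mu> \<alpha> dvd Q) \<and>
      (\<forall>x\<in>{-1..1}. poly Q x \<le> C4 * (omega k g (rho m x) * rho m x ^ r) \<and>
        (\<exists>\<beta>\<in>B. omega k g (rho m x) * min (rho m x) \<bar>x - \<beta>\<bar> ^ r \<le> poly Q x)))"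
    by (elim exE conjE)
  define c0 where "c0 = (C3 + C3 * C4) * ((4 * real s)\<^sup>2) ^ r * (2 * (4 * real s)\<^sup>2) ^ k"
  have c0: "0 \<le> c0" unfolding c0_def using C3 C4 by simp
  \<comment> \<open>The first summand forces m >= 2 + 4/d, so that \<open>rho m\<close> <= 2/m is at
    most 1 and at most d/2. The second reserves room for the surplus degrees \<open>G\<close> and
    r*q.\<close>
  define N where "N d = 2 * (s * (2 + nat \<lceil>4 / d\<rceil>)) + 2 * (G + r * q)" for d :: real
  have main: "\<exists>P :: real poly. degree P \<le> n \<and>
       (\<forall>x\<in>{-1..1}. poly P x \<ge> f x) \<and>
       (\<forall>\<alpha>\<in>A. \<forall>i::nat. int i \<le> m1 \<longrightarrow> poly ((pderiv ^^ i) P) \<alpha> = D i \<alpha>) \<and>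
       (\<forall>i::nat. int i \<le> m3 \<longrightarrow>
          poly ((pderiv ^^ i) P) (-1) = D i (-1) \<and> poly ((pderiv ^^ i) P) 1 = D i 1) \<and>
       (\<forall>x\<in>{-1..1}. \<bar>f x - poly P x\<bar> \<le>
          (c0 + 1) * (rho n x) ^ r * omega k (D r) (rho n x))"
    if A: "A \<subseteq> {-1..1}" "finite A" "card A = p" and f: "Cr_derivs r f D" and n: "n \<ge> N (dmin A)" for A f D n
  proof -
    define B where "B = A \<union> {-1, 1}"
    have "card B \<le> card A + card {-1, 1 :: real}" unfolding B_def by (rule card_Un_le)
    then have B: "finite B" "B \<subseteq> {-1..1}" "card B \<le> q" "B \<noteq> {}" using A by (auto simp: B_def q_def)
    have d: "dmin A \<le> \<bar>\<alpha> - \<beta>\<bar>" if "\<alpha> \<in> B" "\<beta> \<in> B" "\<alpha> \<noteq> \<beta>" for \<alpha> \<beta>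
      using dmin_le(1)[OF A(2)] that unfolding B_def by blast
    have d0: "0 < dmin A" by (rule dmin_le(2)[OF A(2), of "-1" 1]) auto
    \<comment> \<open>s*m takes at most half of the degree \<open>n\<close>; the other half covers
      the surplus.\<close>
    define m where "m = n div (2 * s)"
    have s: "s \<ge> 7" by (simp add: s_def)
    have "(2 * s) * (2 + nat \<lceil>4 / dmin A\<rceil>) \<le> n" using n unfolding N_def by (simp add: mult.assoc)
    then have mlow: "2 + nat \<lceil>4 / dmin A\<rceil> \<le> m"
      unfolding m_def using s by (simp add: less_eq_div_iff_mult_less_eq mult.commute)
    have m: "m \<ge> 1" using mlow by simp
    have mn: "2 * (s * m) \<le> n" unfolding m_def by (metis div_times_less_eq_dividend mult.assoc mult.commute)
    have "2 * (G + r * q) \<le> n" using n unfolding N_def by (rule order.trans[OF le_add2])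
    moreover have "a + G \<le> n \<and> a + b \<le> n" if "2 * a \<le> n" "2 * (G + b) \<le> n" for a b
      using that by simp
    ultimately have deg: "s * m + G \<le> n" "s * m + r * q \<le> n" using mn by blast+
    have "1 \<le> s * m" using m s by simp
    then have n1: "n \<ge> 1" using mn by linarith
    have nm: "real n \<le> 4 * real s * real m"
    proof -
      have "n < 2 * s * (m + 1)" unfolding m_def using s by (simp add: dividend_less_times_div)
      also have "\<dots> \<le> 2 * s * (2 * m)" using m by (intro mult_left_mono) auto
      finally have "real n \<le> real (2 * s * (2 * m))" by (simp only: of_nat_le_iff)
      then show ?thesis by simp
    qed
    have \<rho>m: "rho m x \<le> 1" "2 * rho m x \<le> dmin A" if "x \<in> {-1..1}" for x
    proof -
      have "2 \<le> real m" using mlow by simp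
      then have "2 / real m \<le> 1" by simp
      then show "rho m x \<le> 1" using rho_le[OF m, of x] by linarith
      have "4 / dmin A \<le> real m" using mlow by linarith
      then have "4 / real m \<le> dmin A" using d0 m by (simp add: field_simps)
      then show "2 * rho m x \<le> dmin A" using rho_le[OF m, of x] by simp
    qed
    have cont: "continuous_on {-1..1} (D r)" using f by (simp add: Cr_derivs_def)
    obtain \<Psi> \<xi> v where P: "localized_partition s m C2 \<Psi> \<xi> v" using part m by blast
    have sep2: "2 * rho m x \<le> \<bar>\<alpha> - \<beta>\<bar>" if "x \<in> {-1..1}" "\<alpha> \<in> B" "\<beta> \<in> B" "\<alpha> \<noteq> \<beta>" for x \<alpha> \<beta>
      using \<rho>m(2)[OF that(1)] d[OF that(2-)] by linarith
    have sep1: "rho m x \<le> \<bar>\<alpha> - \<beta>\<bar>" if "x \<in> {-1..1}" "\<alpha> \<in> B" "\<beta> \<in> B" "\<alpha> \<noteq> \<beta>" for x \<alpha> \<beta>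
      using sep2[OF that] rho_pos[OF m that(1)] by linarith
    obtain P1 where P1: "degree P1 \<le> s * m + G" "\<And>\<alpha> i. \<alpha> \<in> B \<Longrightarrow> i < r \<Longrightarrow> poly ((pderiv ^^ i) P1) \<alpha> = D i \<alpha>"
      "\<And>x \<alpha>. x \<in> {-1..1} \<Longrightarrow> \<alpha> \<in> B \<Longrightarrow>
        \<bar>f x - poly P1 x\<bar> \<le> C3 * (omega k (D r) (rho m x) * min (rho m x) \<bar>x - \<alpha>\<bar> ^ r)"
      using QI[rule_format, of m \<Psi> \<xi> v f D B] m P f B \<rho>m(1) sep1 by blast
    define \<mu> where "\<mu> \<alpha> = (if \<alpha> = -1 \<or> \<alpha> = 1 then r else r0)" for \<alpha> :: real
    have \<mu>: "\<mu> \<alpha> \<le> r \<and> (even (\<mu> \<alpha>) \<or> \<alpha> = -1 \<or> \<alpha> = 1)" for \<alpha> using r0 by (simp add: \<mu>_def)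
    have \<mu>B: "\<forall>\<alpha>\<in>B. \<mu> \<alpha> \<le> r \<and> (even (\<mu> \<alpha>) \<or> \<alpha> = -1 \<or> \<alpha> = 1)" using \<mu> by (rule ballI)
    have sep2B: "\<forall>x\<in>{-1..1}. \<forall>\<alpha>\<in>B. \<forall>\<beta>\<in>B. \<alpha> \<noteq> \<beta> \<longrightarrow> 2 * rho m x \<le> \<bar>\<alpha> - \<beta>\<bar>"
      by (intro ballI impI sep2)
    from OM[rule_format, OF conjI[OF m conjI[OF P conjI[OF cont conjI[OF B(1) conjI[OF B(3) conjI[OF B(4) conjI[OF \<mu>B sep2B]]]]]]]]
    obtain Q where "degree Q \<le> s * m + r * q" "\<forall>\<alpha>\<in>B. [:-\<alpha>, 1:] ^ \<mu> \<alpha> dvd Q"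
      "\<forall>x\<in>{-1..1}. poly Q x \<le> C4 * (omega k (D r) (rho m x) * rho m x ^ r) \<and>
        (\<exists>\<beta>\<in>B. omega k (D r) (rho m x) * min (rho m x) \<bar>x - \<beta>\<bar> ^ r \<le> poly Q x)"
      by (elim exE conjE)
    then have Q: "degree Q \<le> s * m + r * q" "\<And>\<alpha>. \<alpha> \<in> B \<Longrightarrow> [:-\<alpha>, 1:] ^ \<mu> \<alpha> dvd Q"
      "\<And>x. x \<in> {-1..1} \<Longrightarrow> poly Q x \<le> C4 * (omega k (D r) (rho m x) * rho m x ^ r)"
      "\<And>x. x \<in> {-1..1} \<Longrightarrow> \<exists>\<beta>\<in>B. omega k (D r) (rho m x) * min (rho m x) \<bar>x - \<beta>\<bar> ^ r \<le> poly Q x"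
      by blast+
    \<comment> \<open>At each \<open>x\<close> the majorant names some \<beta>; the error bound of
      \<open>P1\<close>, read at this same \<beta>, is at most C3 * Q, hence R >= f.\<close>
    define R where "R = P1 + smult C3 Q"
    have "degree R \<le> n"
      unfolding R_def using P1(1) Q(1) deg
      by (intro degree_add_le order.trans[OF degree_smult_le]) auto
    moreover have interp: "poly ((pderiv ^^ i) R) \<alpha> = D i \<alpha>" if "\<alpha> \<in> B" "i < \<mu> \<alpha>" for \<alpha> i
    proof -
      have "poly ((pderiv ^^ i) Q) \<alpha> = 0" using Q(2) that by (simp add: linear_power_dvd_iff)
      moreover have "i < r" using that \<mu>[of \<alpha>] by simp
      ultimately show ?thesis
        using P1(2) that(1) by (simp add: R_def higher_pderiv_add higher_pderiv_smult)
    qed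
    moreover have "poly ((pderiv ^^ i) R) \<alpha> = D i \<alpha>" if "\<alpha> \<in> A" "int i \<le> m1" for \<alpha> i
      using interp[of \<alpha> i] that m1[of i] r0 by (simp add: B_def \<mu>_def split: if_splits)
    moreover have "poly ((pderiv ^^ i) R) (-1) = D i (-1) \<and> poly ((pderiv ^^ i) R) 1 = D i 1" if "int i \<le> m3" for i
      using interp[of "-1" i] interp[of 1 i] that m3[of i] by (simp add: B_def \<mu>_def)
    moreover have "f x \<le> poly R x"
      "\<bar>f x - poly R x\<bar> \<le> (c0 + 1) * (rho n x) ^ r * omega k (D r) (rho n x)" if x: "x \<in> {-1..1}" for x
    proof -
      define w where "w = omega k (D r) (rho m x)"
      have \<rho>0: "0 < rho m x" "0 < rho n x" using rho_pos[OF m x] rho_pos[OF n1 x] .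
      have w: "0 \<le> w" unfolding w_def using \<rho>0 by (intro omega_nonneg cont) simp
      obtain \<beta> where \<beta>: "\<beta> \<in> B" "w * min (rho m x) \<bar>x - \<beta>\<bar> ^ r \<le> poly Q x"
        using Q(4)[OF x] unfolding w_def by blast
      have b1: "\<bar>f x - poly P1 x\<bar> \<le> C3 * (w * min (rho m x) \<bar>x - \<beta>\<bar> ^ r)"
        using P1(3)[OF x \<beta>(1)] unfolding w_def .
      have b2: "C3 * (w * min (rho m x) \<bar>x - \<beta>\<bar> ^ r) \<le> C3 * poly Q x"
        using \<beta>(2) C3 by (rule mult_left_mono)
      have R: "poly R x = poly P1 x + C3 * poly Q x" by (simp add: R_def)
      show "f x \<le> poly R x" using b1 b2 R by linarith
      have "min (rho m x) \<bar>x - \<beta>\<bar> ^ r \<le> rho m x ^ r" using \<rho>0 by (intro power_mono) auto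
      then have b3: "C3 * (w * min (rho m x) \<bar>x - \<beta>\<bar> ^ r) \<le> C3 * (w * rho m x ^ r)"
        using C3 w by (intro mult_left_mono) auto
      have "C3 * poly Q x \<le> C3 * (C4 * (w * rho m x ^ r))"
        using Q(3)[OF x] C3 unfolding w_def by (rule mult_left_mono)
      moreover have "0 \<le> C3 * poly Q x" using b1 b2 by linarith
      ultimately have "\<bar>f x - poly R x\<bar> \<le> C3 * (w * rho m x ^ r) + C3 * (C4 * (w * rho m x ^ r))"
        using b1 b3 R by linarith
      also have "\<dots> = (C3 + C3 * C4) * rho m x ^ r * w" by (simp add: algebra_simps)
      also have "\<dots> \<le> (C3 + C3 * C4) * ((4 * real s)\<^sup>2 * rho n x) ^ r * ((2 * (4 * real s)\<^sup>2) ^ k * omega k (D r) (rho n x))"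
      proof (intro mult_mono mult_left_mono power_mono)
        have s1: "1 \<le> 4 * real s" using s by simp
        show le: "rho m x \<le> (4 * real s)\<^sup>2 * rho n x" by (rule rho_le_rho[OF m n1 nm x s1])
        have "w \<le> omega k (D r) ((4 * real s)\<^sup>2 * rho n x)"
          unfolding w_def using le \<rho>0 by (intro omega_mono cont) auto
        also have "\<dots> \<le> (2 * (4 * real s)\<^sup>2) ^ k * omega k (D r) (rho n x)"
          by (rule omega_scale[OF cont _ one_le_power[OF s1]]) (use \<rho>0 in simp)
        finally show "w \<le> (2 * (4 * real s)\<^sup>2) ^ k * omega k (D r) (rho n x)" .
      qed (use C3 C4 w \<rho>0 in auto)
      also have "\<dots> = c0 * rho n x ^ r * omega k (D r) (rho n x)"
        unfolding c0_def power_mult_distrib by (simp only: mult_ac)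
      also have "\<dots> \<le> (c0 + 1) * rho n x ^ r * omega k (D r) (rho n x)"
        using \<rho>0 by (intro mult_right_mono omega_nonneg cont) auto
      finally show "\<bar>f x - poly R x\<bar> \<le> (c0 + 1) * (rho n x) ^ r * omega k (D r) (rho n x)" .
    qed
    ultimately show ?thesis by (intro exI[of _ R]) blast
  qed
  show ?thesis
  \<comment> \<open>Adding 1 ensures strict positivity, as \<open>c0\<close> is only known to be
    nonnegative.\<close>
  proof (rule exI[of _ "c0 + 1"], rule conjI)
    show "0 < c0 + 1" using c0 by simp
  qed (rule exI[of _ N], intro allI impI, elim conjE, rule main; assumption)
qed

end
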